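(* Let $n\geqslant3$ and let $A=\mathcal B_{n+1}$ be Artin's braid group on $n+1\geqslant 4$ strands. Then the inequality $X_{NP}^A\preccurlyeq X_P^A$ is strict, i.e. the identity map $\Gamma(A,X_P^A)\to\Gamma(A,X_{NP}^A)$ is Lipschitz but not a quasi-isometry. In other words, the natural map $\mathcal A_\partial(\mathcal D_{n+1})\to\mathcal C(\mathcal D_{n+1})$ is not a quasi-isometry.
   Context: $\mathcal B_{n+1}=\langle s_1,\dots,s_n \mid s_is_j=s_js_i \text{ if } |i-j|\geqslant 2,\ s_is_{i+1}s_i=s_{i+1}s_is_{i+1}\rangle$, with Garside element (half twist) $\Delta=(s_1s_2\cdots s_n)(s_1\cdots s_{n-1})\cdots(s_1s_2)s_1$. It is identified with the mapping class group (boundary fixed pointwise) of the closed disk $\mathcal D_{n+1}$ with $n+1$ punctures, modelled as the disk of diameter $[0,n+2]$ in $\mathbb C$ with punctures $p_i=i$; $s_i$ is the half Dehn twist along the horizontal arc from $p_i$ to $p_{i+1}$. A standard parabolic subgroup is a subgroup generated by a subset $T\subset\{s_1,\dots,s_n\}$; it is proper if $T\neq\{s_1,\dots,s_n\}$, and irreducible if $T$ is nonempty and consists of consecutive generators. $X_P^A$ is the union of all proper irreducible standard parabolic subgroups and of $\langle\Delta^2\rangle$; $X_{NP}^A$ is the union of the normalizers in $A$ of all proper irreducible standard parabolic subgroups. Both generate $A$. For a generating set $X$ of a group $G$, $d_X$ is the word metric and $\Gamma(G,X)$ the Cayley graph. For generating sets $X,Y$ of $G$, write $X\preccurlyeq Y$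 if the identity map $(G,d_Y)\to(G,d_X)$ is Lipschitz, equivalently $\sup_{y\in Y}d_X(1_G,y)<\infty$. The curve graph $\mathcal C(\mathcal D_{n+1})$ has as vertices the isotopy classes of simple closed curves in $\mathcal D_{n+1}$ surrounding at least 2 and at most $n$ punctures; two distinct vertices are connected by an edge if and only if they can be realized disjointly. The boundary connecting arc graph $\mathcal A_\partial(\mathcal D_{n+1})$ has as vertices the isotopy classes of simple arcs in $\mathcal D_{n+1}$ with both endpoints in $\partial\mathcal D_{n+1}$ and not homotopic into a subset of $\partial\mathcal D_{n+1}$, where endpoints may slide freely along the boundary during isotopies; two distinct vertices are connected by an edge if and only if they can be realized disjointly. Orbit maps of the $\mathcal B_{n+1}$-actions give quasi-isometries $(A,d_{X_P^A})\to\mathcal A_\partial(\mathcal D_{n+1})$ and $(A,d_{X_{NP}^A})\to\mathcal C(\mathcal D_{n+1})$; the natural map $\mathcal A_\partial(\mathcal D_{n+1})\to\mathcal C(\mathcal D_{n+1})$ is the map (well defined up to bounded distance) corresponding to the identity of $A$ under these quasi-isometries. *)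

theory Defs
  imports "HOL-Analysis.Analysis" "HOL-Algebra.Generated_Groups" "HOL-Algebra.Group_Action"
begin

section \<open>Path metrics, Lipschitz maps and quasi-isometries\<close>

text \<open>Distances take the value infinity between points that are not joined by a path; on the
  graphs below (and for word metrics of generating sets) they are finite.\<close>

definition edge_dist :: "('a \<times> 'a) set \<Rightarrow> 'a \<Rightarrow> 'a \<Rightarrow> ereal" where
  "edge_dist E x y = (INF k\<in>{k. (x, y) \<in> E ^^ k}. ereal (real k))"

definition lipschitz_map ::
    "'a set \<Rightarrow> ('a \<Rightarrow> 'a \<Rightarrow> ereal) \<Rightarrow> 'b set \<Rightarrow> ('b \<Rightarrow> 'b \<Rightarrow> ereal) \<Rightarrow> ('a \<Rightarrow> 'b) \<Rightarrow> bool" where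
  "lipschitz_map V d W d' f \<longleftrightarrow>
     f \<in> V \<rightarrow> W \<and> (\<exists>L::real. L > 0 \<and> (\<forall>x\<in>V. \<forall>y\<in>V. d' (f x) (f y) \<le> ereal L * d x y))"

definition quasi_isometry ::
    "'a set \<Rightarrow> ('a \<Rightarrow> 'a \<Rightarrow> ereal) \<Rightarrow> 'b set \<Rightarrow> ('b \<Rightarrow> 'b \<Rightarrow> ereal) \<Rightarrow> ('a \<Rightarrow> 'b) \<Rightarrow> bool" where
  "quasi_isometry V d W d' f \<longleftrightarrow>
     f \<in> V \<rightarrow> W \<and>
     (\<exists>L C :: real. L \<ge> 1 \<and> C \<ge> 0 \<and>
        (\<forall>x\<in>V. \<forall>y\<in>V. ereal (1 / L) * d x y - ereal C \<le> d' (f x) (f y) \<and>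
                      d' (f x) (f y) \<le> ereal L * d x y + ereal C) \<and>
        (\<forall>w\<in>W. \<exists>v\<in>V. d' (f v) w \<le> ereal C))"

text \<open>Given quasi-isometries \<open>f\<close> from a space with underlying set \<open>G\<close> to \<open>(V, d)\<close> and \<open>h\<close> from
  another metric on \<open>G\<close> to \<open>(W, d')\<close>, the map \<open>V \<rightarrow> W\<close> corresponding to the identity of \<open>G\<close> is
  \<open>h \<circ> \<psi>\<close>, where \<open>\<psi>\<close> is a quasi-inverse of \<open>f\<close>, up to bounded distance. (As \<open>f\<close> is a
  quasi-isometry, the one-sided condition on \<open>\<psi>\<close> makes it a two-sided quasi-inverse.)\<close>

definition corresponds_to_identity ::
    "'g set \<Rightarrow> 'a set \<Rightarrow> ('a \<Rightarrow> 'a \<Rightarrow> ereal) \<Rightarrow> ('g \<Rightarrow> 'a) \<Rightarrow>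
     'b set \<Rightarrow> ('b \<Rightarrow> 'b \<Rightarrow> ereal) \<Rightarrow> ('g \<Rightarrow> 'b) \<Rightarrow> ('a \<Rightarrow> 'b) \<Rightarrow> bool" where
  "corresponds_to_identity G V d f W d' h \<phi> \<longleftrightarrow>
     \<phi> \<in> V \<rightarrow> W \<and>
     (\<exists>\<psi> \<in> V \<rightarrow> G. \<exists>K::real. \<forall>v\<in>V. d (f (\<psi> v)) v \<le> ereal K \<and> d' (\<phi> v) (h (\<psi> v)) \<le> ereal K)"


section \<open>Word metrics and Cayley graphs\<close>

definition word_metric :: "('a, 'm) monoid_scheme \<Rightarrow> 'a set \<Rightarrow> 'a \<Rightarrow> 'a \<Rightarrow> ereal" where
  "word_metric G X g h =
     (INF xs\<in>{xs. set xs \<subseteq> X \<union> m_inv G ` X \<and>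
                  foldr (\<lambda>x y. x \<otimes>\<^bsub>G\<^esub> y) xs \<one>\<^bsub>G\<^esub> = inv\<^bsub>G\<^esub> g \<otimes>\<^bsub>G\<^esub> h}. ereal (real (length xs)))"

definition gen_preceq :: "('a, 'm) monoid_scheme \<Rightarrow> 'a set \<Rightarrow> 'a set \<Rightarrow> bool" where
  "gen_preceq G X Y \<longleftrightarrow>
     lipschitz_map (carrier G) (word_metric G Y) (carrier G) (word_metric G X) (\<lambda>g. g)"

definition cayley_edges :: "('a, 'm) monoid_scheme \<Rightarrow> 'a set \<Rightarrow> ('a \<times> 'a) set" where
  "cayley_edges G X = {(g, g \<otimes>\<^bsub>G\<^esub> x) | g x. g \<in> carrier G \<and> x \<in> X \<union> m_inv G ` X}"


section \<open>Groups given by generators and relations\<close>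

text \<open>A word is a list of letters \<open>(s, e)\<close>, standing for \<open>s\<close> if \<open>e\<close> holds and for the inverse of
  \<open>s\<close> otherwise. The relation \<open>pres_eq S R\<close> is the congruence on words over \<open>S\<close> generated by \<open>R\<close>
  and free cancellation.\<close>

type_synonym 's word = "('s \<times> bool) list"

inductive pres_eq :: "'s set \<Rightarrow> ('s word \<times> 's word) set \<Rightarrow> 's word \<Rightarrow> 's word \<Rightarrow> bool"
  for S :: "'s set" and R :: "('s word \<times> 's word) set" where
  refl: "w \<in> lists (S \<times> UNIV) \<Longrightarrow> pres_eq S R w w"
| sym: "pres_eq S R u v \<Longrightarrow> pres_eq S R v u"
| trans: "pres_eq S R u v \<Longrightarrow> pres_eq S R v w \<Longrightarrow> pres_eq S R u w"
| append: "pres_eq S R u u' \<Longrightarrow> pres_eq S R v v' \<Longrightarrow> pres_eq S R (u @ v) (u' @ v')"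
| cancel: "s \<in> S \<Longrightarrow> pres_eq S R [(s, e), (s, \<not> e)] []"
| rel: "(u, v) \<in> R \<Longrightarrow> u \<in> lists (S \<times> UNIV) \<Longrightarrow> v \<in> lists (S \<times> UNIV) \<Longrightarrow> pres_eq S R u v"

definition pres_class :: "'s set \<Rightarrow> ('s word \<times> 's word) set \<Rightarrow> 's word \<Rightarrow> 's word set" where
  "pres_class S R w = {v. pres_eq S R w v}"

definition presented_group :: "'s set \<Rightarrow> ('s word \<times> 's word) set \<Rightarrow> 's word set monoid" where
  "presented_group S R =
     \<lparr> carrier = pres_class S R ` lists (S \<times> UNIV),
       mult = (\<lambda>X Y. \<Union>u\<in>X. \<Union>v\<in>Y. pres_class S R (u @ v)),
       one = pres_class S R [] \<rparr>"

lemma pres_eq_lists: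
  "pres_eq S R u v \<Longrightarrow> u \<in> lists (S \<times> UNIV) \<and> v \<in> lists (S \<times> UNIV)"
  by (induction rule: pres_eq.induct) auto

lemma pres_class_eqI: "pres_eq S R u v \<Longrightarrow> pres_class S R u = pres_class S R v"
  by (auto simp: pres_class_def intro: pres_eq.trans pres_eq.sym)

lemma presented_group_mult:
  assumes "u \<in> lists (S \<times> UNIV)" "v \<in> lists (S \<times> UNIV)"
  shows "pres_class S R u \<otimes>\<^bsub>presented_group S R\<^esub> pres_class S R v = pres_class S R (u @ v)"
proof -
  have "pres_class S R (u' @ v') = pres_class S R (u @ v)"
    if "u' \<in> pres_class S R u" "v' \<in> pres_class S R v" for u' v'
    using that by (intro pres_class_eqI pres_eq.append) (auto simp: pres_class_def intro: pres_eq.sym)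
  moreover have "u \<in> pres_class S R u" "v \<in> pres_class S R v"
    using assms by (auto simp: pres_class_def intro!: pres_eq.refl)
  ultimately have "(\<Union>u'\<in>pres_class S R u. \<Union>v'\<in>pres_class S R v. pres_class S R (u' @ v')) =
      pres_class S R (u @ v)"
    by blast
  then show ?thesis by (simp add: presented_group_def)
qed

lemma pres_eq_inverse:
  "w \<in> lists (S \<times> UNIV) \<Longrightarrow> pres_eq S R (rev (map (\<lambda>(s, e). (s, \<not> e)) w) @ w) []"
proof (induction w)
  case Nil
  then show ?case by (auto intro: pres_eq.refl)
next
  case (Cons a w)
  obtain s e where a: "a = (s, e)" by (cases a)
  let ?r = "rev (map (\<lambda>(s, e). (s, \<not> e)) w)"
  have s: "s \<in> S" and w: "w \<in> lists (S \<times> UNIV)" using Cons.prems a by auto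
  have r: "?r \<in> lists (S \<times> UNIV)" using w by (auto simp: lists_eq_set)
  have "pres_eq S R ([(s, \<not> e), (s, \<not> \<not> e)] @ w) ([] @ w)"
    by (intro pres_eq.append pres_eq.cancel pres_eq.refl s w)
  then have "pres_eq S R (?r @ ([(s, \<not> e), (s, e)] @ w)) (?r @ w)"
    using pres_eq.append[OF pres_eq.refl[OF r]] by fastforce
  then show ?case
    using pres_eq.trans Cons.IH[OF w] a by fastforce
qed

lemma group_presented_group: "group (presented_group S R)"
proof (rule groupI)
  let ?G = "presented_group S R"
  have carr: "carrier ?G = pres_class S R ` lists (S \<times> UNIV)"
    and one: "\<one>\<^bsub>?G\<^esub> = pres_class S R []"
    by (auto simp: presented_group_def)
  show "\<one>\<^bsub>?G\<^esub> \<in> carrier ?G" by (auto simp: carr one)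
  show "x \<otimes>\<^bsub>?G\<^esub> y \<in> carrier ?G" if "x \<in> carrier ?G" "y \<in> carrier ?G" for x y
  proof -
    obtain u v where uv: "u \<in> lists (S \<times> UNIV)" "v \<in> lists (S \<times> UNIV)"
      "x = pres_class S R u" "y = pres_class S R v"
      using \<open>x \<in> carrier ?G\<close> \<open>y \<in> carrier ?G\<close> unfolding carr by auto
    then have "x \<otimes>\<^bsub>?G\<^esub> y = pres_class S R (u @ v)" by (simp only: presented_group_mult)
    moreover have "u @ v \<in> lists (S \<times> UNIV)" using uv by simp
    ultimately show ?thesis unfolding carr by blast
  qed
  show "x \<otimes>\<^bsub>?G\<^esub> y \<otimes>\<^bsub>?G\<^esub> z = x \<otimes>\<^bsub>?G\<^esub> (y \<otimes>\<^bsub>?G\<^esub> z)"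
    if "x \<in> carrier ?G" "y \<in> carrier ?G" "z \<in> carrier ?G" for x y z
  proof -
    obtain u v w where "u \<in> lists (S \<times> UNIV)" "v \<in> lists (S \<times> UNIV)" "w \<in> lists (S \<times> UNIV)"
      "x = pres_class S R u" "y = pres_class S R v" "z = pres_class S R w"
      using \<open>x \<in> carrier ?G\<close> \<open>y \<in> carrier ?G\<close> \<open>z \<in> carrier ?G\<close> unfolding carr by auto
    then show ?thesis by (simp add: presented_group_mult del: in_lists_conv_set)
  qed
  show "\<one>\<^bsub>?G\<^esub> \<otimes>\<^bsub>?G\<^esub> x = x" if "x \<in> carrier ?G" for x
    using that unfolding carr one by (elim imageE) (simp add: presented_group_mult del: in_lists_conv_set)
  show "\<exists>y\<in>carrier ?G. y \<otimes>\<^bsub>?G\<^esub> x = \<one>\<^bsub>?G\<^esub>" if x: "x \<in> carrier ?G" for x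
  proof -
    from x obtain w where w: "w \<in> lists (S \<times> UNIV)" "x = pres_class S R w"
      unfolding carr by auto
    let ?r = "rev (map (\<lambda>(s, e). (s, \<not> e)) w)"
    have r: "?r \<in> lists (S \<times> UNIV)" using w(1) by (auto simp: lists_eq_set)
    have "pres_class S R ?r \<otimes>\<^bsub>?G\<^esub> x = \<one>\<^bsub>?G\<^esub>"
      unfolding one w(2) presented_group_mult[OF r w(1)]
      by (rule pres_class_eqI[OF pres_eq_inverse[OF w(1)]])
    with r show ?thesis unfolding carr by blast
  qed
qed


section \<open>The braid group on \<open>n + 1\<close> strands\<close>

definition braid_rels :: "nat \<Rightarrow> (nat word \<times> nat word) set" where
  "braid_rels n =
     {([(i, True), (j, True)], [(j, True), (i, True)]) | i j.
        i \<in> {1..n} \<and> j \<in> {1..n} \<and> \<bar>int i - int j\<bar> \<ge> 2} \<union>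
     {([(i, True), (Suc i, True), (i, True)], [(Suc i, True), (i, True), (Suc i, True)]) | i.
        i \<in> {1..n} \<and> Suc i \<in> {1..n}}"

definition braid_group :: "nat \<Rightarrow> nat word set monoid" where
  "braid_group n = presented_group {1..n} (braid_rels n)"

definition braid_class :: "nat \<Rightarrow> nat word \<Rightarrow> nat word set" where
  "braid_class n w = pres_class {1..n} (braid_rels n) w"

definition braid_gen :: "nat \<Rightarrow> nat \<Rightarrow> nat word set" where
  "braid_gen n i = braid_class n [(i, True)]"

text \<open>\<open>\<Delta> = (s\<^sub>1 \<dots> s\<^sub>n) (s\<^sub>1 \<dots> s\<^sub>n\<^sub>-\<^sub>1) \<dots> (s\<^sub>1 s\<^sub>2) s\<^sub>1\<close>\<close>

definition garside :: "nat \<Rightarrow> nat word set" where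
  "garside n = braid_class n
     (concat (map (\<lambda>k. map (\<lambda>i. (i, True)) [1..<Suc k]) (rev [1..<Suc n])))"

definition proper_irred_std_parabolics :: "nat \<Rightarrow> nat word set set set" where
  "proper_irred_std_parabolics n =
     {generate (braid_group n) (braid_gen n ` {i..j}) | i j.
        1 \<le> i \<and> i \<le> j \<and> j \<le> n \<and> {i..j} \<noteq> {1..n}}"

definition X_P :: "nat \<Rightarrow> nat word set set" where
  "X_P n = \<Union> (proper_irred_std_parabolics n) \<union>
     generate (braid_group n) {garside n \<otimes>\<^bsub>braid_group n\<^esub> garside n}"

definition X_NP :: "nat \<Rightarrow> nat word set set" where
  "X_NP n = (\<Union>P\<in>proper_irred_std_parabolics n. normalizer (braid_group n) P)"


section \<open>The punctured disk\<close>

text \<open>The closed disk of diameter \<open>[0, n + 2]\<close> and its \<open>n + 1\<close> punctures. The disk itself is kept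
  unpunctured; curves and arcs avoid the punctures and isotopies fix them.\<close>

definition disk :: "nat \<Rightarrow> complex set" where
  "disk n = cball (of_real ((real n + 2) / 2)) ((real n + 2) / 2)"

definition disk_boundary :: "nat \<Rightarrow> complex set" where
  "disk_boundary n = sphere (of_real ((real n + 2) / 2)) ((real n + 2) / 2)"

definition punctures :: "nat \<Rightarrow> complex set" where
  "punctures n = of_nat ` {1..n + 1}"

text \<open>Isotopy of subsets of the punctured disk: ambient isotopy by homeomorphisms of the disk which
  fix each puncture. The boundary circle is preserved, but not pointwise, so that endpoints of arcs
  may slide along it; for curves in the interior this freedom does not change isotopy classes.\<close>

definition isotopic :: "nat \<Rightarrow> complex set \<Rightarrow> complex set \<Rightarrow> bool" where
  "isotopic n C C' \<longleftrightarrow>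
     (\<exists>h :: real \<Rightarrow> complex \<Rightarrow> complex.
        continuous_on ({0..1} \<times> disk n) (\<lambda>(t, z). h t z) \<and>
        (\<forall>t\<in>{0..1}. (\<exists>k. homeomorphism (disk n) (disk n) (h t) k) \<and> (\<forall>p\<in>punctures n. h t p = p)) \<and>
        (\<forall>z\<in>disk n. h 0 z = z) \<and> h 1 ` C = C')"

definition isotopy_class :: "nat \<Rightarrow> complex set \<Rightarrow> complex set set" where
  "isotopy_class n C = {C'. isotopic n C C'}"

text \<open>Curves and arcs are unoriented, hence represented by their images.\<close>

definition simple_closed_curve :: "nat \<Rightarrow> complex set \<Rightarrow> bool" where
  "simple_closed_curve n C \<longleftrightarrow>
     (\<exists>g. simple_path g \<and> pathfinish g = pathstart g \<and> path_image g = C) \<and>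
     C \<subseteq> disk n - disk_boundary n - punctures n"

definition curve_graph_verts :: "nat \<Rightarrow> complex set set set" where
  "curve_graph_verts n =
     {isotopy_class n C | C. simple_closed_curve n C \<and>
        2 \<le> card (inside C \<inter> punctures n) \<and> card (inside C \<inter> punctures n) \<le> n}"

definition boundary_path :: "nat \<Rightarrow> (real \<Rightarrow> complex) \<Rightarrow> bool" where
  "boundary_path n g \<longleftrightarrow> pathstart g \<in> disk_boundary n \<and> pathfinish g \<in> disk_boundary n"

definition inessential :: "nat \<Rightarrow> (real \<Rightarrow> complex) \<Rightarrow> bool" where
  "inessential n g \<longleftrightarrow>
     (\<exists>b. path_image b \<subseteq> disk_boundary n \<and>
        homotopic_with (boundary_path n) (top_of_set {0..1}) (top_of_set (disk n - punctures n)) g b)"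

definition proper_arc :: "nat \<Rightarrow> (real \<Rightarrow> complex) \<Rightarrow> bool" where
  "proper_arc n g \<longleftrightarrow>
     arc g \<and> path_image g \<subseteq> disk n - punctures n \<and>
     path_image g \<inter> disk_boundary n = {pathstart g, pathfinish g}"

definition arc_graph_verts :: "nat \<Rightarrow> complex set set set" where
  "arc_graph_verts n =
     {isotopy_class n (path_image g) | g. proper_arc n g \<and> \<not> inessential n g}"

definition disjointness_edges :: "'a set set set \<Rightarrow> ('a set set \<times> 'a set set) set" where
  "disjointness_edges V =
     {(v, w). v \<in> V \<and> w \<in> V \<and> v \<noteq> w \<and> (\<exists>C\<in>v. \<exists>C'\<in>w. C \<inter> C' = {})}"

abbreviation curve_graph_dist :: "nat \<Rightarrow> complex set set \<Rightarrow> complex set set \<Rightarrow> ereal" where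
  "curve_graph_dist n \<equiv> edge_dist (disjointness_edges (curve_graph_verts n))"

abbreviation arc_graph_dist :: "nat \<Rightarrow> complex set set \<Rightarrow> complex set set \<Rightarrow> ereal" where
  "arc_graph_dist n \<equiv> edge_dist (disjointness_edges (arc_graph_verts n))"


section \<open>The action of the braid group\<close>

text \<open>The half Dehn twist exchanging the punctures \<open>i\<close> and \<open>i + 1\<close>: rotation by \<open>\<pi>\<close> on the round disk
  with diameter \<open>[i, i + 1]\<close>, interpolated to the identity in a surrounding annulus of outer radius
  \<open>3/4\<close>, which contains no other puncture. It is the inverse twist if \<open>e\<close> is false.\<close>

definition half_twist :: "nat \<Rightarrow> bool \<Rightarrow> complex \<Rightarrow> complex" where
  "half_twist i e z =
     (let c = of_nat i + 1 / 2
      in c + (z - c) * cis ((if e then pi else - pi) * max 0 (min 1 (3 - 4 * cmod (z - c)))))"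

definition word_homeo :: "nat word \<Rightarrow> complex \<Rightarrow> complex" where
  "word_homeo w = foldr (\<lambda>(i, e) f. half_twist i e \<circ> f) w id"

text \<open>A braid \<open>g\<close> is a class of words, and any two words in it induce isotopic homeomorphisms of the
  punctured disk. So each \<open>w \<in> g\<close> maps the isotopy class \<open>v\<close> to the same class, which the union
  below picks out.\<close>

definition braid_act :: "nat word set \<Rightarrow> complex set set \<Rightarrow> complex set set" where
  "braid_act g v = (\<Union>w\<in>g. (\<lambda>C. word_homeo w ` C) ` v)"

end

theory Submission
  imports Defs
begin

text \<open>
  The braid group acts (Hurwitz action) on the free product of \<open>n + 1\<close> copies of \<open>\<int>/2\<close>, the
  orbifold group of the disk with cone points of order 2 at the punctures. Its elements, the
  reduced words in the letters \<open>1, \<dots>, n + 1\<close>, are the vertices of a planar tree. Reading this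
  tree from the boundary yields a linear order on reduced words that all braids preserve, and the
  boundary word \<open>\<delta> = 1 2 \<dots> (n + 1)\<close> acts as a translation commuting with all braids. The letters
  \<open>1\<close> and \<open>n + 1\<close> stand for the boundary arcs around the first and the last puncture. These have no
  linked lifts, hence neither have their images under any braid.

  Let \<open>m = n - 1\<close> and let \<open>h\<close> be a pseudo-Anosov braid of the disk whose first \<open>m\<close> punctures are
  merged into a fat one. It centralizes \<open>\<langle>s\<^sub>1, \<dots>, s\<^sub>m\<^sub>-\<^sub>1\<rangle>\<close>, so its powers lie in \<open>X_NP\<close>. Modulo
  \<open>\<delta>\<close> it maps the complement of an interval \<open>J\<close> around its repelling point into an interval that is
  linked with \<open>J\<close>. So if \<open>g 1\<close> is in \<open>h\<^sup>j\<^sup>+\<^sup>1\<close> of the complement of \<open>J\<close>, then \<open>g (n + 1)\<close> is in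
  \<open>h\<^sup>j\<close> of it, and conversely. Every element of a proper parabolic subgroup fixes \<open>1\<close> or \<open>n + 1\<close>
  and thus costs at most two of these levels, while the full twist is central and acts on the
  letter \<open>1\<close> as conjugation by \<open>\<delta>\<close>, which does not change the level. Therefore \<open>h\<^sup>2\<^sup>K\<^sup>+\<^sup>1\<close> is not a
  product of \<open>K\<close> elements of \<open>X_P\<close>.
\<close>

section \<open>Reduced words and the Hurwitz action\<close>

text \<open>The lower bound on \<open>X_P\<close>-length is proved without intersection numbers,
  foliations or any theory of pseudo-Anosov maps: the dynamics is reduced to the images of two
  explicit words, \<open>lower_end\<close> and \<open>upper_end\<close>, under one application of
  \<open>fat_braid\<close>, and the rest is preservation of a linear order. Two obstacles shape the
  proof. A parabolic factor fixes one of the arcs \<open>1\<close> and \<open>n + 1\<close>, but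
  either may occur, and linking compares an arc only with the other one; passing to the other letter
  and back covers both cases and explains the constant 2. Moreover the base vertex itself lies on a
  boundary line, along which \<delta> does not respect the order (it carries the greatest word to
  the least), hence the recurring condition \<open>off_boundary\<close>. The bound n >= 3 makes the
  centralized subgroup nontrivial, since it is generated by m - 1 = n - 2 half twists. The two
  graphs enter only through the given quasi-isometries and the symmetry of adjacency, so the claim
  on the natural map follows formally from the comparison of word metrics.\<close>

fun letter_mult :: "nat \<Rightarrow> nat list \<Rightarrow> nat list" where
  "letter_mult x [] = [x]"
| "letter_mult x (y # w) = (if x = y then w else x # y # w)"

definition word_mult :: "nat list \<Rightarrow> nat list \<Rightarrow> nat list" where
  "word_mult u w = foldr letter_mult u w"

lemma word_mult_Nil [simp]: "word_mult [] w = w"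
  and word_mult_Cons [simp]: "word_mult (x # u) w = letter_mult x (word_mult u w)"
  and word_mult_append: "word_mult (u @ v) w = word_mult u (word_mult v w)"
  by (simp_all add: word_mult_def)

lemma distinct_adj_letter_mult: "distinct_adj w \<Longrightarrow> distinct_adj (letter_mult x w)"
  by (cases w) (auto simp: distinct_adj_Cons)

lemma letter_mult_Cons: "distinct_adj (x # w) \<Longrightarrow> letter_mult x w = x # w"
  by (cases w) (auto simp: distinct_adj_Cons)

lemma letter_mult_letter_mult: "distinct_adj w \<Longrightarrow> letter_mult x (letter_mult x w) = w"
  by (cases w; cases "tl w") (auto simp: distinct_adj_Cons)

lemma distinct_adj_word_mult: "distinct_adj w \<Longrightarrow> distinct_adj (word_mult u w)"
  by (induction u) (auto intro: distinct_adj_letter_mult)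

lemma word_mult_eq_append: "distinct_adj (u @ w) \<Longrightarrow> word_mult u w = u @ w"
proof (induction u)
  case (Cons x u)
  then have "distinct_adj (u @ w)" by (cases "u @ w") (auto simp: distinct_adj_Cons)
  with Cons show ?case by (simp add: letter_mult_Cons)
qed simp

lemma word_mult_Nil_right: "distinct_adj u \<Longrightarrow> word_mult u [] = u"
  using word_mult_eq_append[of u "[]"] by simp

lemma word_mult_rev_word_mult: "distinct_adj w \<Longrightarrow> word_mult (rev u) (word_mult u w) = w"
proof (induction u arbitrary: w)
  case (Cons x u)
  then show ?case by (simp add: word_mult_append letter_mult_letter_mult distinct_adj_word_mult)
qed simp

lemma word_mult_word_mult_rev: "distinct_adj w \<Longrightarrow> word_mult u (word_mult (rev u) w) = w"
  using word_mult_rev_word_mult[of w "rev u"] by simp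

lemma word_mult_letter_mult: "distinct_adj w \<Longrightarrow> word_mult (letter_mult x u) w = letter_mult x
  (word_mult u w)"
  by (cases u) (auto simp: letter_mult_letter_mult distinct_adj_word_mult)

lemma word_mult_assoc: "distinct_adj w \<Longrightarrow> word_mult (word_mult u v) w = word_mult u (word_mult v w)"
  by (induction u) (auto simp: word_mult_letter_mult)

lemma set_letter_mult: "set (letter_mult x w) \<subseteq> insert x (set w)"
  by (cases w) auto

lemma set_word_mult: "set (word_mult u w) \<subseteq> set u \<union> set w"
  by (induction u) (use set_letter_mult in fastforce)+

section \<open>Palindromic substitutions and the Hurwitz action\<close>

definition subst_letters :: "(nat \<Rightarrow> nat list) \<Rightarrow> nat list \<Rightarrow> nat list" where
  "subst_letters \<sigma> w = foldr (\<lambda>x. word_mult (\<sigma> x)) w []"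

lemma subst_letters_Nil [simp]: "subst_letters \<sigma> [] = []"
  and subst_letters_Cons [simp]: "subst_letters \<sigma> (x # w) = word_mult (\<sigma> x) (subst_letters \<sigma> w)"
  by (simp_all add: subst_letters_def)

lemma distinct_adj_subst_letters [simp]: "distinct_adj (subst_letters \<sigma> w)"
  by (induction w) (auto intro: distinct_adj_word_mult)

text \<open>In the free product the inverse of a word is its reversal, so a palindrome has square 1.
  A substitution with palindromic images therefore respects the relation x x = 1.\<close>

lemma subst_letters_letter_mult:
  assumes "\<And>x. rev (\<sigma> x) = \<sigma> x"
  shows "subst_letters \<sigma> (letter_mult x w) = word_mult (\<sigma> x) (subst_letters \<sigma> w)"
proof (cases w)
  case (Cons y v)
  then show ?thesis
    using word_mult_rev_word_mult[of "subst_letters \<sigma> v" "\<sigma> x"] assms[of x] by auto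
qed simp

lemma subst_letters_word_mult:
  assumes "\<And>x. rev (\<sigma> x) = \<sigma> x"
  shows "subst_letters \<sigma> (word_mult u w) = word_mult (subst_letters \<sigma> u) (subst_letters \<sigma> w)"
  by (induction u) (auto simp: subst_letters_letter_mult[OF assms] word_mult_assoc)

text \<open>The Artin automorphism of a half twist modulo x x = 1. It exchanges i and i + 1 up to
  conjugation and keeps the product i (i + 1), which is why the boundary word will be
  invariant.\<close>

definition twist_letter :: "nat \<times> bool \<Rightarrow> nat \<Rightarrow> nat list" where
  "twist_letter = (\<lambda>(i, e) x.
     if e then (if x = i then [i, Suc i, i] else if x = Suc i then [i] else [x])
     else (if x = i then [Suc i] else if x = Suc i then [Suc i, i, Suc i] else [x]))"

definition hurwitz :: "nat word \<Rightarrow> nat list \<Rightarrow> nat list" where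
  "hurwitz b w = foldr (\<lambda>l. subst_letters (twist_letter l)) b w"

lemma hurwitz_Nil [simp]: "hurwitz [] w = w"
  and hurwitz_Cons: "hurwitz (l # b) w = subst_letters (twist_letter l) (hurwitz b w)"
  and hurwitz_append: "hurwitz (a @ b) w = hurwitz a (hurwitz b w)"
  by (simp_all add: hurwitz_def)

lemma rev_twist: "rev (twist_letter l x) = twist_letter l x"
  by (auto simp: twist_letter_def split: prod.splits)

lemma hurwitz_empty [simp]: "hurwitz b [] = []"
  by (induction b) (auto simp: hurwitz_Cons)

lemma distinct_adj_hurwitz: "distinct_adj w \<Longrightarrow> distinct_adj (hurwitz b w)"
  by (cases b) (auto simp: hurwitz_Cons)

lemma hurwitz_word_mult: "hurwitz b (word_mult u w) = word_mult (hurwitz b u) (hurwitz b w)"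
  by (induction b) (auto simp: hurwitz_Cons subst_letters_word_mult rev_twist)

lemma hurwitz_Cons_right: "distinct_adj (x # w) \<Longrightarrow> hurwitz b (x # w) = word_mult (hurwitz b [x])
  (hurwitz b w)"
  using hurwitz_word_mult[of b "[x]" w] by (simp add: letter_mult_Cons)

lemma set_subst_letters_subset:
  assumes "\<And>x. x \<in> S \<Longrightarrow> set (\<sigma> x) \<subseteq> S" "set w \<subseteq> S"
  shows "set (subst_letters \<sigma> w) \<subseteq> S"
  using assms(2)
proof (induction w)
  case (Cons x w)
  then show ?case using set_word_mult[of "\<sigma> x" "subst_letters \<sigma> w"] assms(1)[of x] by auto
qed simp

lemma set_hurwitz_subset:
  assumes "b \<in> lists ({1..n} \<times> UNIV)" "set w \<subseteq> {1..Suc n}"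
  shows "set (hurwitz b w) \<subseteq> {1..Suc n}"
  using assms(1)
proof (induction b)
  case (Cons l b)
  then have "fst l \<in> {1..n}" by auto
  then show ?case unfolding hurwitz_Cons using Cons
    by (intro set_subst_letters_subset) (auto simp: twist_letter_def split: prod.splits if_splits)
qed (use assms in simp)

lemma hurwitz_eqI:
  assumes "\<And>x. x \<in> S \<Longrightarrow> hurwitz a [x] = hurwitz b [x]" "distinct_adj w" "set w \<subseteq> S"
  shows "hurwitz a w = hurwitz b w"
  using assms(2,3)
proof (induction w)
  case (Cons x w)
  then have "hurwitz a w = hurwitz b w" by (cases w) (auto simp: distinct_adj_Cons)
  with Cons show ?case by (simp add: hurwitz_Cons_right[of x w] assms(1))
qed simp

text \<open>After the letter \<open>p\<close> the order of the next items is \<open>p + 1, p + 2, \<dots>, 0, 1, \<dots>, p - 1\<close>, the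
  counterclockwise order around a vertex entered through the edge \<open>p\<close>. The item \<open>0\<close> is the end of
  the word, standing for the boundary line at this vertex.\<close>

fun cyc_less :: "nat \<Rightarrow> nat \<Rightarrow> nat \<Rightarrow> bool" where
  "cyc_less p a b \<longleftrightarrow> (if p \<le> a then (p \<le> b \<and> a < b) \<or> b < p else a < b \<and> b < p)"

declare cyc_less.simps [simp del]
lemmas cyc_less_def = cyc_less.simps

text \<open>A lexicographic order whose alphabet is reordered at every vertex: the first parameter
  is the edge through which the current vertex was entered. The value 0 at the start means entering
  the base vertex from its boundary line.\<close>

fun word_less :: "nat \<Rightarrow> nat list \<Rightarrow> nat list \<Rightarrow> bool" where
  "word_less p [] [] = False"
| "word_less p [] (b # v) = cyc_less p 0 b"
| "word_less p (a # u) [] = cyc_less p a 0"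
| "word_less p (a # u) (b # v) = (if a = b then word_less a u v else cyc_less p a b)"

lemma word_less_irrefl [simp]: "\<not> word_less p u u"
  by (induction u arbitrary: p) auto

text \<open>A letter 0 would be indistinguishable from the end of the word.\<close>

lemma word_less_total: "0 \<notin> set u \<Longrightarrow> 0 \<notin> set v \<Longrightarrow> u \<noteq> v \<Longrightarrow> word_less p u v \<or> word_less p v u"
  by (induction p u v rule: word_less.induct) (auto simp: cyc_less_def)

lemma cyc_less_irrefl [simp]: "\<not> cyc_less p a a"
  by (auto simp: cyc_less_def)

lemma cyc_less_trans: "cyc_less p a b \<Longrightarrow> cyc_less p b c \<Longrightarrow> cyc_less p a c"
  by (auto simp: cyc_less_def split: if_splits)

lemma cyc_less_asym: "cyc_less p a b \<Longrightarrow> cyc_less p b a \<Longrightarrow> False"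
  using cyc_less_trans cyc_less_irrefl by blast

lemma word_less_trans: "word_less p u v \<Longrightarrow> word_less p v w \<Longrightarrow> word_less p u w"
proof (induction u arbitrary: p v w)
  case Nil
  then show ?case
    by (cases v; cases w) (auto split: if_splits dest: cyc_less_trans cyc_less_asym)
next
  case (Cons a u)
  then show ?case
    by (cases v; cases w) (auto split: if_splits dest: cyc_less_trans cyc_less_asym)
qed

lemma word_less_asym: "word_less p u v \<Longrightarrow> \<not> word_less p v u"
  using word_less_trans word_less_irrefl by blast

definition hd_or_0 :: "nat list \<Rightarrow> nat" where "hd_or_0 w = (case w of [] \<Rightarrow> 0 | x # _ \<Rightarrow> x)"
lemma hd_or_0_simps [simp]: "hd_or_0 [] = 0" "hd_or_0 (x # w) = x" by (simp_all add: hd_or_0_def)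

lemma word_less_hd_or_0_neq: "hd_or_0 u \<noteq> hd_or_0 v \<Longrightarrow> word_less p u v \<longleftrightarrow> cyc_less p (hd_or_0 u)
  (hd_or_0 v)"
  by (cases u; cases v) auto

section \<open>Half twists preserve the order\<close>

lemma letter_mult_hd_or_0: "hd_or_0 w \<noteq> x \<Longrightarrow> letter_mult x w = x # w"
  by (cases w) auto

definition pos_reduced :: "nat list \<Rightarrow> bool" where
  "pos_reduced w \<longleftrightarrow> distinct_adj w \<and> 0 \<notin> set w"

lemma pos_reduced_Nil [simp]: "pos_reduced []"
  by (simp add: pos_reduced_def)

lemma pos_reduced_Cons: "pos_reduced (x # w) \<longleftrightarrow> x \<noteq> 0 \<and> hd_or_0 w \<noteq> x \<and> pos_reduced w"
  by (cases w) (auto simp: pos_reduced_def)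

context
  fixes i :: nat
  assumes i: "i > 0"
begin

definition sigma where "sigma = subst_letters (twist_letter (i, True))"

lemma sigma_Nil: "sigma [] = []"
  and sigma_Cons: "sigma (x # w) = word_mult
    (if x = i then [i, Suc i, i] else if x = Suc i then [i] else [x]) (sigma w)"
  and distinct_adj_sigma: "distinct_adj (sigma w)"
  by (simp_all add: sigma_def twist_letter_def)

text \<open>The invariant that bounds cancellation: a front letter can change only from i + 1 to i,
  so images of tails cannot cancel against other letters.\<close>

definition sigma_hd_ok where
  "sigma_hd_ok w \<longleftrightarrow> (hd_or_0 w = i \<longrightarrow> hd_or_0 (sigma w) = i) \<and>
    (hd_or_0 w = Suc i \<longrightarrow> hd_or_0 (sigma w) \<in> {i, Suc i}) \<and>
     (hd_or_0 w \<notin> {i, Suc i} \<longrightarrow> hd_or_0 (sigma w) = hd_or_0 w)"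

text \<open>Cancellation happens only inside alternating runs of i and i + 1: i (i + 1) and (i + 1)
  i reproduce themselves, and (i + 1) i (i + 1) shrinks to i + 1. The guards on the next letter make
  the junction with the image of the tail reduced.\<close>

lemma sigma_eqs_aux:
  assumes "sigma_hd_ok t"
  shows "x \<notin> {i, Suc i} \<Longrightarrow> hd_or_0 t \<noteq> x \<Longrightarrow> sigma (x # t) = x # sigma t"
    and "hd_or_0 t \<notin> {i, Suc i} \<Longrightarrow> sigma (i # t) = i # Suc i # i # sigma t"
    and "hd_or_0 t \<noteq> Suc i \<Longrightarrow> sigma (i # Suc i # t) = i # Suc i # sigma t"
    and "hd_or_0 t \<notin> {i, Suc i} \<Longrightarrow> sigma (Suc i # t) = i # sigma t"
    and "hd_or_0 t \<notin> {i, Suc i} \<Longrightarrow> sigma (Suc i # i # t) = Suc i # i # sigma t"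
    and "hd_or_0 t \<noteq> Suc i \<Longrightarrow> sigma (Suc i # i # Suc i # t) = Suc i # sigma t"
proof -
  note [simp] = sigma_Cons letter_mult_hd_or_0 letter_mult_letter_mult distinct_adj_sigma
    distinct_adj_letter_mult
  show "sigma (x # t) = x # sigma t" if "x \<notin> {i, Suc i}" "hd_or_0 t \<noteq> x"
    using assms that by (cases "hd_or_0 t = i"; cases "hd_or_0 t = Suc i")
      (auto simp: sigma_hd_ok_def)
  show "sigma (i # t) = i # Suc i # i # sigma t" if "hd_or_0 t \<notin> {i, Suc i}"
    using assms that by (cases "hd_or_0 t = i"; cases "hd_or_0 t = Suc i")
      (auto simp: sigma_hd_ok_def)
  show "sigma (i # Suc i # t) = i # Suc i # sigma t" if "hd_or_0 t \<noteq> Suc i"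
    using assms that by (cases "hd_or_0 t = i"; cases "hd_or_0 t = Suc i")
      (auto simp: sigma_hd_ok_def)
  show "sigma (Suc i # t) = i # sigma t" if "hd_or_0 t \<notin> {i, Suc i}"
    using assms that by (cases "hd_or_0 t = i"; cases "hd_or_0 t = Suc i")
      (auto simp: sigma_hd_ok_def)
  show "sigma (Suc i # i # t) = Suc i # i # sigma t" if "hd_or_0 t \<notin> {i, Suc i}"
    using assms that by (cases "hd_or_0 t = i"; cases "hd_or_0 t = Suc i")
      (auto simp: sigma_hd_ok_def)
  show "sigma (Suc i # i # Suc i # t) = Suc i # sigma t" if "hd_or_0 t \<noteq> Suc i"
    using assms that by (cases "hd_or_0 t = i"; cases "hd_or_0 t = Suc i")
      (auto simp: sigma_hd_ok_def)
qed

lemma sigma_hd_ok: "pos_reduced w \<Longrightarrow> sigma_hd_ok w"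
proof (induction w rule: length_induct)
  case (1 w)
  have IH: "sigma_hd_ok t" if "length t < length w" "pos_reduced t" for t
    using 1 that by blast
  show ?case
  proof (cases w)
    case Nil
    then show ?thesis using i by (simp add: sigma_hd_ok_def sigma_Nil)
  next
    case w: (Cons x t)
    note wd = "1.prems"[unfolded w]
    have t: "sigma_hd_ok t" "hd_or_0 t \<noteq> x" "pos_reduced t"
      using IH[of t] wd w by (auto simp: pos_reduced_Cons)
    show ?thesis
    proof (cases "hd_or_0 t \<in> {i, Suc i}")
      case False
      then show ?thesis using sigma_eqs_aux(1,2,4)[of t] t w
        by (cases "x = i"; cases "x = Suc i") (auto simp: sigma_hd_ok_def)
    next
      case True
      then obtain y s where s: "t = y # s" "y \<in> {i, Suc i}" using i by (cases t) auto
      have s': "sigma_hd_ok s" "hd_or_0 s \<noteq> y" "pos_reduced s"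
        using IH[of s] t w s by (auto simp: pos_reduced_Cons)
      show ?thesis
      proof (cases "x \<in> {i, Suc i}")
        case False
        then show ?thesis using sigma_eqs_aux(1)[of t] t w by (auto simp: sigma_hd_ok_def)
      next
        case x: True
        show ?thesis
        proof (cases "x = i")
          case True
          then show ?thesis using s s' t w sigma_eqs_aux(3)[of s] by (auto simp: sigma_hd_ok_def)
        next
          case False
          then have xy: "x = Suc i" "y = i" using x s t by auto
          show ?thesis
          proof (cases "hd_or_0 s = Suc i")
            case False
            then show ?thesis using xy s s' w sigma_eqs_aux(5)[of s] by (auto simp: sigma_hd_ok_def)
          next
            case True
            then obtain r where r: "s = Suc i # r" by (cases s) auto
            have "sigma_hd_ok r" "hd_or_0 r \<noteq> Suc i"
              using IH[of r] s' w s r by (auto simp: pos_reduced_Cons)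
            then show ?thesis using xy s r w sigma_eqs_aux(6)[of r] by (auto simp: sigma_hd_ok_def)
          qed
        qed
      qed
    qed
  qed
qed

lemma pos_reduced_cases:
  assumes "pos_reduced w"
  obtains (other) "hd_or_0 w \<notin> {i, Suc i}" | (lower) t where "w = i # t" "pos_reduced t"
    "hd_or_0 t \<noteq> i"
    | (upper) t where "w = Suc i # t" "pos_reduced t" "hd_or_0 t \<noteq> Suc i"
proof (cases w)
  case Nil
  then show ?thesis using i other by simp
next
  case (Cons x t)
  then show ?thesis using assms that
    by (cases "x = i"; cases "x = Suc i") (auto simp: pos_reduced_Cons)
qed

lemma sigma_hd_or_0: "pos_reduced w \<Longrightarrow> hd_or_0 w \<notin> {i, Suc i} \<Longrightarrow> hd_or_0 (sigma w) = hd_or_0 w"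
  using sigma_hd_ok[of w] by (auto simp: sigma_hd_ok_def)

lemmas sigma_eqs = sigma_eqs_aux[OF sigma_hd_ok]

lemma sigma_fst: assumes "pos_reduced (i # t)" obtains z where "sigma (i # t) = i # Suc i # z"
proof (cases "hd_or_0 t = Suc i")
  case True
  then obtain s where "t = Suc i # s" by (cases t) auto
  then show ?thesis using that assms sigma_eqs(3)[of s] by (auto simp: pos_reduced_Cons)
next
  case False
  then show ?thesis using that assms sigma_eqs(2)[of t] by (auto simp: pos_reduced_Cons)
qed

lemma sigma_snd:
  assumes "pos_reduced (Suc i # t)"
  obtains z where "sigma (Suc i # t) = Suc i # z" "hd_or_0 t = i" |
    "sigma (Suc i # t) = i # sigma t" "hd_or_0 t \<notin> {i, Suc i}"
proof (cases "hd_or_0 t = i")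
  case True
  then obtain s where s: "t = i # s" using i by (cases t) auto
  show ?thesis
  proof (cases "hd_or_0 s = Suc i")
    case True
    then obtain r where "s = Suc i # r" by (cases s) auto
    then show ?thesis using that(1) assms s sigma_eqs(6)[of r] by (auto simp: pos_reduced_Cons)
  next
    case False
    then show ?thesis using that(1) assms s sigma_eqs(5)[of s] by (auto simp: pos_reduced_Cons)
  qed
next
  case False
  then show ?thesis using that(2) assms sigma_eqs(4)[of t] by (auto simp: pos_reduced_Cons)
qed

text \<open>In the context i + 1 the item i is the last one. If the left word also starts with i, it
  goes on with i + 1, the earliest possible item after i. This decides the comparisons in which one
  image continues a common prefix ending in i + 1 with an extra i.\<close>

lemma sigma_before:
  assumes "pos_reduced u" "hd_or_0 u \<noteq> Suc i" "pos_reduced v" "hd_or_0 v \<notin> {i, Suc i}"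
  shows "word_less (Suc i) (sigma u) (i # sigma v)"
  using assms(1)
proof (cases rule: pos_reduced_cases)
  case other
  then have "hd_or_0 (sigma u) = hd_or_0 u" using sigma_hd_or_0 assms by blast
  with other show ?thesis by (subst word_less_hd_or_0_neq) (auto simp: cyc_less_def)
next
  case (lower t)
  then obtain z where "sigma u = i # Suc i # z" using sigma_fst[of t] assms(1) by metis
  with sigma_hd_or_0[OF assms(3,4)] assms(4) show ?thesis
    by (auto simp: word_less_hd_or_0_neq cyc_less_def)
qed (use assms in auto)

text \<open>The context p varies for the induction. The context i is excluded because the image of a
  common letter i may be partly cancelled by what follows; such prefixes are removed together with
  the next letters instead.\<close>

theorem word_less_sigma:
  assumes "pos_reduced u" "pos_reduced v" "p \<noteq> i" "p = 0 \<or> hd_or_0 u \<noteq> p \<and> hd_or_0 v \<noteq> p"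
    "word_less p u v"
  shows "word_less p (sigma u) (sigma v)"
  using assms
proof (induction u arbitrary: p v rule: length_induct)
  case (1 u p v)
  have IH: "word_less q (sigma s) (sigma t)" if "length s < length u" "pos_reduced s"
    "pos_reduced t" "q \<noteq> i"
    "q = 0 \<or> hd_or_0 s \<noteq> q \<and> hd_or_0 t \<noteq> q" "word_less q s t" for q s t
    using "1.IH" that by blast
  \<comment> \<open>No cancellation reaches across heads outside {i, i + 1}. Since i + 1 may be
    replaced by i in the image, the context may change from i + 1 to i; both contexts order the
    remaining items alike.\<close>
  have oo: "word_less q (sigma s) (sigma t)" if "length s \<le> length u" "pos_reduced s"
    "pos_reduced t" "hd_or_0 s \<notin> {i, Suc i}" "hd_or_0 t \<notin> {i, Suc i}"
    "word_less r s t" "r = q \<or> r = Suc i \<and> q = i" for q r s t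
  proof (cases "hd_or_0 s = hd_or_0 t")
    case True
    show ?thesis
    proof (cases s)
      case Nil
      with True that show ?thesis by (cases t) auto
    next
      case s: (Cons x s')
      with True that obtain t' where t: "t = x # t'" by (cases t) auto
      have "word_less x (sigma s') (sigma t')" using that s t
        by (intro IH) (auto simp: pos_reduced_Cons)
      then show ?thesis using that s t sigma_eqs(1)[of s' x] sigma_eqs(1)[of t' x]
        by (auto simp: pos_reduced_Cons)
    qed
  next
    case False
    then show ?thesis using that sigma_hd_or_0[of s] sigma_hd_or_0[of t]
      by (auto simp: word_less_hd_or_0_neq cyc_less_def split: if_splits)
  qed
  show ?case
    using "1.prems"(1)
  proof (cases rule: pos_reduced_cases)
    case u: other
    show ?thesis using "1.prems"(2)
    proof (cases rule: pos_reduced_cases)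
      case other
      then show ?thesis using oo[of u v p p] 1 u by auto
    next
      case (lower t)
      obtain z where z: "sigma v = i # Suc i # z" using sigma_fst[of t] lower "1.prems" by metis
      show ?thesis using z u lower "1.prems"(5) sigma_hd_or_0[OF "1.prems"(1) u]
        by (auto simp: word_less_hd_or_0_neq)
    next
      case (upper t)
      then have "hd_or_0 (sigma v) \<in> {i, Suc i}" using sigma_hd_ok[of v] "1.prems"
        by (auto simp: sigma_hd_ok_def)
      then show ?thesis using u upper "1.prems"(3-5) sigma_hd_or_0[OF "1.prems"(1) u]
        by (auto simp: word_less_hd_or_0_neq cyc_less_def split: if_splits)
    qed
  next
    case u: (lower s)
    obtain z where z: "sigma u = i # Suc i # z" using sigma_fst[of s] u "1.prems" by metis
    show ?thesis using "1.prems"(2)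
    proof (cases rule: pos_reduced_cases)
      case other
      then show ?thesis using z u "1.prems"(5) sigma_hd_or_0[OF "1.prems"(2) other]
        by (auto simp: word_less_hd_or_0_neq)
    next
      case (upper t)
      then have "pos_reduced (Suc i # t)" using "1.prems" by simp
      then show ?thesis
      proof (cases rule: sigma_snd)
        case (1 z')
        then show ?thesis using z u upper "1.prems" by simp
      next
        case 2
        then show ?thesis using z upper sigma_hd_or_0[of t] \<open>pos_reduced t\<close>
          by (auto simp: word_less_hd_or_0_neq cyc_less_def)
      qed
    next
      case v: (lower t)
      have st: "word_less i s t" using "1.prems"(5) u v by simp
      consider "hd_or_0 s = Suc i" "hd_or_0 t = Suc i" | "hd_or_0 s = Suc i"
        "hd_or_0 t \<notin> {i, Suc i}"
        | "hd_or_0 s \<notin> {i, Suc i}" "hd_or_0 t \<notin> {i, Suc i}" | "hd_or_0 s \<notin> {i, Suc i}"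
          "hd_or_0 t = Suc i"
        using u v by auto
      then show ?thesis
      proof cases
        case 1
        then obtain s' t' where s': "s = Suc i # s'" "t = Suc i # t'" by (cases s; cases t) auto
        then have "word_less (Suc i) (sigma s') (sigma t')" using u v st
          by (intro IH) (auto simp: pos_reduced_Cons)
        then show ?thesis using u v s' sigma_eqs(3)[of s'] sigma_eqs(3)[of t']
          by (auto simp: pos_reduced_Cons)
      next
        case 2
        then obtain s' where s': "s = Suc i # s'" by (cases s) auto
        then have "word_less (Suc i) (sigma s') (i # sigma t)" using u v 2
          by (intro sigma_before) (auto simp: pos_reduced_Cons)
        then show ?thesis using u v s' 2 sigma_eqs(3)[of s'] sigma_eqs(2)[of t]
          by (auto simp: pos_reduced_Cons)
      next
        case 3
        then have "word_less i (sigma s) (sigma t)" using oo[of s t i i] u v st by auto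
        then show ?thesis using u v 3 sigma_eqs(2)[of s] sigma_eqs(2)[of t]
          by (auto simp: pos_reduced_Cons)
      next
        case 4
        \<comment> \<open>After i the item i + 1 is the earliest that can follow, so t would be the
          smaller word.\<close>
        then have False using st by (auto simp: word_less_hd_or_0_neq cyc_less_def split: if_splits)
        then show ?thesis ..
      qed
    qed
  next
    case u: (upper s)
    have hu: "hd_or_0 (sigma u) \<in> {i, Suc i}" using sigma_hd_ok[of u] "1.prems" u
      by (auto simp: sigma_hd_ok_def)
    have p': "p \<notin> {i, Suc i}" using "1.prems" u by auto
    show ?thesis using "1.prems"(2)
    proof (cases rule: pos_reduced_cases)
      case other
      then show ?thesis using hu u "1.prems"(3-5) sigma_hd_or_0[OF "1.prems"(2) other]
        by (auto simp: word_less_hd_or_0_neq cyc_less_def split: if_splits)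
    next
      case (lower t)
      then have False using u "1.prems"(3-5) by (auto simp: cyc_less_def split: if_splits)
      then show ?thesis ..
    next
      case v: (upper t)
      have st: "word_less (Suc i) s t" using "1.prems"(5) u v by simp
      consider "hd_or_0 s = i" "hd_or_0 t = i" | "hd_or_0 s = i" "hd_or_0 t \<notin> {i, Suc i}"
        | "hd_or_0 s \<notin> {i, Suc i}" "hd_or_0 t \<notin> {i, Suc i}" | "hd_or_0 s \<notin> {i, Suc i}"
          "hd_or_0 t = i"
        using u v by auto
      then show ?thesis
      proof cases
        case 1
        then obtain s' t' where s': "s = i # s'" "t = i # t'" using i by (cases s; cases t) auto
        have st': "word_less i s' t'" using st s' by simp
        have ok': "pos_reduced s'" "pos_reduced t'" "hd_or_0 s' \<noteq> i" "hd_or_0 t' \<noteq> i" using u v s'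
          by (auto simp: pos_reduced_Cons)
        consider "hd_or_0 s' = Suc i" "hd_or_0 t' = Suc i" | "hd_or_0 s' = Suc i"
          "hd_or_0 t' \<notin> {i, Suc i}"
          | "hd_or_0 s' \<notin> {i, Suc i}" "hd_or_0 t' \<notin> {i, Suc i}" | "hd_or_0 s' \<notin> {i, Suc i}"
            "hd_or_0 t' = Suc i"
          using ok' by auto
        then show ?thesis
        proof cases
          case 1
          then obtain s2 t2 where s2: "s' = Suc i # s2" "t' = Suc i # t2"
            by (cases s'; cases t') auto
          then have "word_less (Suc i) (sigma s2) (sigma t2)" using u s' ok' st'
            by (intro IH) (auto simp: pos_reduced_Cons)
          then show ?thesis using u v s' s2 ok' sigma_eqs(6)[of s2] sigma_eqs(6)[of t2]
            by (auto simp: pos_reduced_Cons)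
        next
          case 2
          then obtain s2 where s2: "s' = Suc i # s2" by (cases s') auto
          then have "word_less (Suc i) (sigma s2) (i # sigma t')" using ok' 2
            by (intro sigma_before) (auto simp: pos_reduced_Cons)
          then show ?thesis using u v s' s2 ok' 2 sigma_eqs(6)[of s2] sigma_eqs(5)[of t']
            by (auto simp: pos_reduced_Cons)
        next
          case 3
          then have "word_less i (sigma s') (sigma t')" using oo[of s' t' i i] u s' ok' st' by auto
          then show ?thesis using u v s' ok' 3 sigma_eqs(5)[of s'] sigma_eqs(5)[of t'] by auto
        next
          case 4
          then have False using st' by (auto simp: word_less_hd_or_0_neq cyc_less_def split:
            if_splits)
          then show ?thesis ..
        qed
      next
        case 2
        then have False using st by (auto simp: word_less_hd_or_0_neq cyc_less_def split: if_splits)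
        then show ?thesis ..
      next
        case 3
        then have "word_less i (sigma s) (sigma t)" using oo[of s t "Suc i" i] u v st by auto
        then show ?thesis using u v 3 sigma_eqs(4)[of s] sigma_eqs(4)[of t] by auto
      next
        case 4
        then obtain z where "sigma v = Suc i # z"
          using sigma_snd[of t] "1.prems"(2) v by (metis insert_iff)
        \<comment> \<open>Here the images part at the first letter, i against i + 1, and these are
          in the right order for every context other than i and i + 1.\<close>
        moreover have "sigma u = i # sigma s" using 4 u sigma_eqs(4)[of s] by auto
        ultimately show ?thesis using p' by (auto simp: cyc_less_def)
      qed
    qed
  qed
qed

end

section \<open>The boundary word\<close>

lemma twist_False_True: "hurwitz [(i, \<not> e), (i, e)] [x] = [x]"
  by (cases e) (auto simp: hurwitz_Cons twist_letter_def)

lemma hurwitz_cancel: "distinct_adj w \<Longrightarrow> hurwitz [(i, e), (i, \<not> e)] w = w"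
  using hurwitz_eqI[of UNIV "[(i, e), (i, \<not> e)]" "[]" w] twist_False_True[of i "\<not> e"] by simp

definition word_inv :: "'a word \<Rightarrow> 'a word" where
  "word_inv b = rev (map (\<lambda>(s, e). (s, \<not> e)) b)"

lemma word_inv_Cons: "word_inv ((s, e) # b) = word_inv b @ [(s, \<not> e)]"
  and word_inv_word_inv [simp]: "word_inv (word_inv b) = b"
  by (induction b) (auto simp: word_inv_def rev_map comp_def)

lemma word_inv_lists: "b \<in> lists (T \<times> UNIV) \<Longrightarrow> word_inv b \<in> lists (T \<times> UNIV)"
  by (induction b) (auto simp: word_inv_def)

lemma hurwitz_word_inv_hurwitz: "distinct_adj w \<Longrightarrow> hurwitz (word_inv b) (hurwitz b w) = w"
proof (induction b)
  case Nil
  then show ?case by (simp add: word_inv_def)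
next
  case (Cons l b)
  obtain i e where l: "l = (i, e)" by fastforce
  have "hurwitz [(i, \<not> e)] (hurwitz [(i, e)] (hurwitz b w)) = hurwitz b w"
    using hurwitz_cancel[of "hurwitz b w" i "\<not> e"] Cons.prems
      by (simp add: hurwitz_Cons distinct_adj_hurwitz)
  then show ?case using Cons by (simp add: l word_inv_Cons hurwitz_append hurwitz_Cons)
qed

lemma hurwitz_hurwitz_word_inv: "distinct_adj w \<Longrightarrow> hurwitz b (hurwitz (word_inv b) w) = w"
  using hurwitz_word_inv_hurwitz[of w "word_inv b"] by simp

lemma hurwitz_far: "\<bar>int i - int j\<bar> \<ge> 2 \<Longrightarrow> hurwitz [(i, True), (j, True)] [x] = hurwitz
  [(j, True), (i, True)] [x]"
  by (auto simp: hurwitz_Cons twist_letter_def)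

lemma hurwitz_braid:
  "hurwitz [(i, True), (Suc i, True), (i, True)] [x] = hurwitz
    [(Suc i, True), (i, True), (Suc i, True)] [x]"
  by (auto simp: hurwitz_Cons twist_letter_def)

text \<open>Braid relations need checking on single letters only, because both sides act by
  homomorphisms. Thus \<open>hurwitz\<close> descends to the braid group.\<close>

lemma hurwitz_cong:
  assumes "pres_eq {1..n} (braid_rels n) a b" "distinct_adj w"
  shows "hurwitz a w = hurwitz b w"
  using assms
proof (induction arbitrary: w rule: pres_eq.induct)
  case (append u u' v v')
  then show ?case by (metis hurwitz_append distinct_adj_hurwitz)
next
  case (cancel s e)
  then show ?case using hurwitz_cancel[of w s e] by simp
next
  case (rel u v)
  then show ?case
    using hurwitz_eqI[of UNIV u v w] hurwitz_far hurwitz_braid unfolding braid_rels_def by blast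
qed auto

definition reduced :: "nat \<Rightarrow> nat list set" where
  "reduced N = {w. distinct_adj w \<and> set w \<subseteq> {1..N}}"

lemma reduced_pos_reduced: "w \<in> reduced N \<Longrightarrow> pos_reduced w"
  by (auto simp: reduced_def pos_reduced_def)

lemma reduced_distinct_adj: "w \<in> reduced N \<Longrightarrow> distinct_adj w"
  by (auto simp: reduced_def)

lemma hurwitz_reduced:
  "b \<in> lists ({1..n} \<times> UNIV) \<Longrightarrow> w \<in> reduced (Suc n) \<Longrightarrow> hurwitz b w \<in> reduced (Suc n)"
  using set_hurwitz_subset[of b n w] by (auto simp: reduced_def distinct_adj_hurwitz)

lemma word_mult_reduced: "set u \<subseteq> {1..N} \<Longrightarrow> w \<in> reduced N \<Longrightarrow> word_mult u w \<in> reduced N"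
  using set_word_mult[of u w] by (fastforce simp: reduced_def distinct_adj_word_mult)

lemma word_less_hurwitz_gen:
  assumes "i \<in> {1..n}" "u \<in> reduced (Suc n)" "v \<in> reduced (Suc n)" "word_less 0 u v"
  shows "word_less 0 (hurwitz [(i, e)] u) (hurwitz [(i, e)] v)"
proof (cases e)
  case True
  then show ?thesis
    using word_less_sigma[of i u v 0] assms reduced_pos_reduced
      by (auto simp: hurwitz_Cons sigma_def)
next
  case False
  let ?u = "hurwitz [(i, False)] u" and ?v = "hurwitz [(i, False)] v"
  have d: "?u \<in> reduced (Suc n)" "?v \<in> reduced (Suc n)" using assms
    by (auto intro!: hurwitz_reduced)
  have eq: "hurwitz [(i, True)] ?u = u" "hurwitz [(i, True)] ?v = v"
    using hurwitz_cancel[of u i True] hurwitz_cancel[of v i True] assms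
    by (auto simp: hurwitz_Cons reduced_def)
  \<comment> \<open>The inverse of an order-preserving bijection of a total order preserves the
    order, so only the positive half twist had to be analysed.\<close>
  have "\<not> word_less 0 ?v ?u"
  proof
    assume "word_less 0 ?v ?u"
    then have "word_less 0 (hurwitz [(i, True)] ?v) (hurwitz [(i, True)] ?u)"
      using word_less_sigma[of i ?v ?u 0] d reduced_pos_reduced assms(1)
        by (auto simp: hurwitz_Cons sigma_def)
    then show False using eq assms(4) word_less_asym by metis
  qed
  moreover have "?u \<noteq> ?v" using eq assms(4) by (metis word_less_irrefl)
  ultimately show ?thesis
    using word_less_total[of ?u ?v 0] d False reduced_pos_reduced by (auto simp: pos_reduced_def)
qed

lemma word_less_hurwitz:
  assumes "b \<in> lists ({1..n} \<times> UNIV)" "u \<in> reduced (Suc n)" "v \<in> reduced (Suc n)" "word_less 0 u v"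
  shows "word_less 0 (hurwitz b u) (hurwitz b v)"
  using assms(1)
proof (induction b)
  case (Cons l b)
  obtain i e where l: "l = (i, e)" by fastforce
  have "word_less 0 (hurwitz [(i, e)] (hurwitz b u)) (hurwitz [(i, e)] (hurwitz b v))"
    using Cons assms l by (intro word_less_hurwitz_gen[of i n] hurwitz_reduced) auto
  then show ?case by (simp add: l hurwitz_Cons)
qed (use assms in simp)

definition delta :: "nat \<Rightarrow> nat list" where
  "delta N = [1..<Suc N]"

lemma delta_Suc: "delta (Suc k) = delta k @ [Suc k]"
  by (simp add: delta_def)

lemma set_delta: "set (delta N) = {1..N}"
  by (auto simp: delta_def)

lemma distinct_adj_distinct: "distinct w \<Longrightarrow> distinct_adj w"
  by (induction w) (auto simp: distinct_adj_Cons)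

lemma distinct_adj_upt: "distinct_adj [a..<b]"
  by (simp add: distinct_adj_distinct)

lemma delta_reduced: "delta N \<in> reduced N"
  by (simp add: reduced_def set_delta) (simp only: delta_def distinct_adj_upt)

lemma subst_letters_fix:
  assumes "distinct_adj w" "\<And>x. x \<in> set w \<Longrightarrow> \<sigma> x = [x]"
  shows "subst_letters \<sigma> w = w"
  using assms
proof (induction w)
  case (Cons x w)
  then have "distinct_adj w" by (cases w) auto
  with Cons show ?case by (simp add: letter_mult_Cons)
qed simp

lemma subst_letters_append:
  assumes "\<And>x. rev (\<sigma> x) = \<sigma> x" "distinct_adj (u @ v)"
  shows "subst_letters \<sigma> (u @ v) = word_mult (subst_letters \<sigma> u) (subst_letters \<sigma> v)"
  using subst_letters_word_mult[of \<sigma> u v, OF assms(1)] word_mult_eq_append[OF assms(2)] by simp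

text \<open>The half twist keeps the product of the two adjacent letters that it exchanges and fixes
  all others.\<close>

lemma hurwitz_delta_gen:
  assumes "i \<in> {1..n}"
  shows "hurwitz [(i, e)] (delta (Suc n)) = delta (Suc n)"
proof -
  define A where "A = [1..<i]"
  define B where "B = [Suc (Suc i)..<Suc (Suc n)]"
  have eq: "delta (Suc n) = A @ i # Suc i # B"
    using assms upt_add_eq_append[of 1 i "Suc (Suc n) - i"] upt_conv_Cons[of i "Suc (Suc n)"]
      upt_conv_Cons[of "Suc i" "Suc (Suc n)"]
    by (auto simp: delta_def A_def B_def)
  have AB: "distinct_adj (A @ i # Suc i # B)"
    using delta_reduced[of "Suc n"] eq by (simp add: reduced_def)
  have fA: "subst_letters (twist_letter (i, e)) A = A" and fB:
    "subst_letters (twist_letter (i, e)) B = B"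
    using AB by (auto intro!: subst_letters_fix simp: distinct_adj_append_iff distinct_adj_Cons)
      (auto simp: twist_letter_def A_def B_def)
  have "hd_or_0 B \<notin> {i, Suc i}"
    using assms by (auto simp: hd_or_0_def upt_rec B_def split: list.splits)
  then have c: "letter_mult x B = x # B" if "x = i \<or> x = Suc i" for x
    using that by (intro letter_mult_hd_or_0) auto
  have "subst_letters (twist_letter (i, e)) (i # Suc i # B) = i # Suc i # B"
    by (simp add: fB) (auto simp: twist_letter_def c)
  then show ?thesis
    unfolding eq using AB by (simp add: hurwitz_Cons subst_letters_append rev_twist fA
      word_mult_eq_append)
qed

lemma hurwitz_delta: "b \<in> lists ({1..n} \<times> UNIV) \<Longrightarrow> hurwitz b (delta (Suc n)) = delta (Suc n)"
proof (induction b)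
  case (Cons l b)
  then show ?case using hurwitz_delta_gen[of "fst l" n "snd l"] by (auto simp: hurwitz_Cons)
qed simp

lemma hurwitz_rev_delta:
  assumes "b \<in> lists ({1..n} \<times> UNIV)"
  shows "hurwitz b (rev (delta (Suc n))) = rev (delta (Suc n))"
proof -
  let ?d = "delta (Suc n)"
  have da: "distinct_adj ?d" "distinct_adj (rev ?d)" using delta_reduced by (auto simp: reduced_def)
  have "word_mult ?d (hurwitz b (rev ?d)) = hurwitz b (word_mult ?d (rev ?d))"
    by (simp add: hurwitz_word_mult hurwitz_delta[OF assms])
  also have "word_mult ?d (rev ?d) = []"
    using word_mult_word_mult_rev[of "[]" ?d] word_mult_Nil_right[OF da(2)] by simp
  finally have "word_mult (rev ?d) (word_mult ?d (hurwitz b (rev ?d))) = word_mult (rev ?d) []"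
    by simp
  then show ?thesis
    using word_mult_rev_word_mult[of "hurwitz b (rev ?d)" ?d] word_mult_Nil_right da
      by (simp add: distinct_adj_hurwitz)
qed

section \<open>Integer powers of the boundary word\<close>

definition delta_shift :: "nat \<Rightarrow> int \<Rightarrow> nat list \<Rightarrow> nat list" where
  "delta_shift N k = (if k \<ge> 0 then word_mult (delta N) ^^ nat k else word_mult (rev (delta N)) ^^
    nat (- k))"

lemma delta_shift_0 [simp]: "delta_shift N 0 w = w"
  by (simp add: delta_shift_def)

lemma distinct_adj_delta_shift: "distinct_adj w \<Longrightarrow> distinct_adj (delta_shift N k w)"
proof -
  have "distinct_adj ((word_mult u ^^ j) w)" if "distinct_adj w" for u j
    using that by (induction j) (auto intro: distinct_adj_word_mult)
  then show "distinct_adj w \<Longrightarrow> ?thesis" by (simp add: delta_shift_def)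
qed

lemma delta_shift_add1:
  assumes "distinct_adj w" shows "delta_shift N (k + 1) w = word_mult (delta N) (delta_shift N k w)"
proof (cases "k \<ge> 0")
  case True
  then show ?thesis by (simp add: delta_shift_def nat_add_distrib)
next
  case False
  then have *: "nat (- k) = Suc (nat (- (k + 1)))" by simp
  have "distinct_adj ((word_mult (rev (delta N)) ^^ j) w)" for j
    using assms by (induction j) (auto intro: distinct_adj_word_mult)
  then show ?thesis using False assms word_mult_word_mult_rev[of w "delta N"]
    word_mult_word_mult_rev[of _ "delta N"]
    by (cases "k + 1 = 0") (auto simp: delta_shift_def *)
qed

lemma delta_shift_diff1:
  assumes "distinct_adj w" shows "delta_shift N (k - 1) w = word_mult (rev (delta N))
    (delta_shift N k w)"
  using delta_shift_add1[OF assms, of N "k - 1"]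
    word_mult_rev_word_mult[of "delta_shift N (k - 1) w" "delta N"] assms
  by (simp add: distinct_adj_delta_shift)

lemma delta_shift_add: "distinct_adj w \<Longrightarrow> delta_shift N (k + l) w = delta_shift N k
  (delta_shift N l w)"
proof (induction k rule: int_induct[where k = 0])
  case (step1 i)
  then show ?case
    using delta_shift_add1[of w N "i + l"] delta_shift_add1[of "delta_shift N l w" N i]
      by (simp add: algebra_simps distinct_adj_delta_shift)
next
  case (step2 i)
  then show ?case
    using delta_shift_diff1[of w N "i + l"] delta_shift_diff1[of "delta_shift N l w" N i]
      by (simp add: algebra_simps distinct_adj_delta_shift)
qed simp

lemma delta_shift_word_mult: "distinct_adj w \<Longrightarrow> delta_shift N k (word_mult u w) = word_mult
  (delta_shift N k u) w"
proof -
  have "(word_mult x ^^ j) (word_mult u w) = word_mult ((word_mult x ^^ j) u) w" if "distinct_adj w"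
    for x j
    using that by (induction j) (auto simp: word_mult_assoc)
  then show "distinct_adj w \<Longrightarrow> ?thesis" by (simp add: delta_shift_def)
qed

lemma hurwitz_delta_shift:
  assumes "b \<in> lists ({1..n} \<times> UNIV)"
  shows "hurwitz b (delta_shift (Suc n) k w) = delta_shift (Suc n) k (hurwitz b w)"
proof -
  have "hurwitz b ((word_mult u ^^ j) w) = (word_mult u ^^ j) (hurwitz b w)" if "hurwitz b u = u"
    for u j
    by (induction j) (auto simp: hurwitz_word_mult that)
  then show ?thesis using hurwitz_delta[OF assms] hurwitz_rev_delta[OF assms]
    by (simp add: delta_shift_def)
qed

lemma delta_shift_reduced: "w \<in> reduced N \<Longrightarrow> delta_shift N k w \<in> reduced N"
proof -
  have "(word_mult u ^^ j) w \<in> reduced N" if "set u \<subseteq> {1..N}" "w \<in> reduced N" for u j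
    using that by (induction j) (auto intro: word_mult_reduced[OF that(1)])
  then show "w \<in> reduced N \<Longrightarrow> ?thesis" by (simp add: delta_shift_def set_delta)
qed

lemma word_less_append: "word_less p (c @ a # u) (c @ a # v) \<longleftrightarrow> word_less a u v"
  by (induction c arbitrary: p) auto

text \<open>After cancellation the right word follows delta only up to some j and then leaves it,
  while the left word continues with j + 1, the earliest item after j. The exception is total
  cancellation, which yields the empty word, the least of all.\<close>

lemma word_less_word_mult_delta_aux1:
  assumes "pos_reduced v" "hd_or_0 v \<noteq> Suc k" "v \<noteq> rev (delta k)"
  shows "word_less 0 (delta k @ Suc k # u) (word_mult (delta k) v)"
  using assms
proof (induction k arbitrary: u v)
  case 0
  then show ?case by (cases v) (auto simp: delta_def cyc_less_def pos_reduced_def)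
next
  case (Suc k)
  show ?case
  proof (cases "hd_or_0 v = Suc k")
    case True
    then obtain v' where v: "v = Suc k # v'" by (cases v) auto
    then show ?thesis using Suc.IH[of v' "Suc (Suc k) # u"] Suc.prems
      by (auto simp: delta_Suc word_mult_append pos_reduced_Cons)
  next
    case False
    have d: "distinct_adj (delta k @ Suc k # v)"
    proof -
      have "pos_reduced (Suc k # v)" using False Suc.prems by (simp add: pos_reduced_Cons)
      then have "distinct_adj (Suc k # v)" by (simp only: pos_reduced_def)
      then show ?thesis
        using False Suc.prems(1) by (auto simp: distinct_adj_append_iff delta_def distinct_adj_upt)
    qed
    have "word_less (Suc k) (Suc (Suc k) # u) v"
      using False Suc.prems(2) by (subst word_less_hd_or_0_neq) (auto simp: cyc_less_def)
    then show ?thesis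
      using False word_mult_eq_append[OF d]
        by (simp add: delta_Suc word_mult_append letter_mult_hd_or_0 word_less_append)
  qed
qed

lemma reduced_Cons: "x # w \<in> reduced N \<longleftrightarrow> x \<in> {1..N} \<and> hd_or_0 w \<noteq> x \<and> w \<in> reduced N"
proof (cases "x = 0")
  case False
  then show ?thesis by (cases w) (auto simp: reduced_def)
qed (auto simp: reduced_def)

lemma hd_or_0_le: "w \<in> reduced N \<Longrightarrow> hd_or_0 w \<le> N"
  by (cases w) (auto simp: reduced_def)

text \<open>The form needed for induction: once both words have lost the common letters N, ..., k +
  1 to delta, they are compared in the context of the letter removed last, or in the context 0 if
  nothing has been removed.\<close>

lemma word_less_word_mult_delta_aux2:
  assumes "k \<le> N" "N > 0" "u \<in> reduced N" "v \<in> reduced N" "hd_or_0 u \<noteq> Suc k" "hd_or_0 v \<noteq> Suc k"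
    "word_less (if k < N then Suc k else 0) u v" "v \<noteq> rev (delta k)"
  shows "word_less 0 (word_mult (delta k) u) (word_mult (delta k) v)"
  using assms
proof (induction k arbitrary: u v)
  case 0
  show ?case
  proof (cases "hd_or_0 u = hd_or_0 v")
    case True
    then show ?thesis using 0 by (cases u; cases v) (auto simp: delta_def reduced_def)
  next
    case False
    then show ?thesis using 0
      by (auto simp: delta_def word_less_hd_or_0_neq cyc_less_def reduced_Cons split: if_splits)
        (metis hd_or_0_simps(2) neq_Nil_conv not_gr_zero reduced_Cons atLeastAtMost_iff
          not_one_le_zero)
  qed
next
  case (Suc k)
  define p where "p = (if Suc k < N then Suc (Suc k) else 0)"
  have p: "p = Suc (Suc k) \<or> p = 0 \<and> N = Suc k" using Suc.prems by (auto simp: p_def)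
  have word_less: "word_less p u v" using Suc.prems by (simp add: p_def)
  note word_le = hd_or_0_le[OF Suc.prems(3)] hd_or_0_le[OF Suc.prems(4)]
  have ap: "word_mult (delta (Suc k)) w = delta k @ Suc k # w"
    if "w \<in> reduced N" "hd_or_0 w \<noteq> Suc k" for w
  proof -
    have "Suc k # w \<in> reduced N" using that Suc.prems by (simp add: reduced_Cons)
    then have "distinct_adj (delta k @ Suc k # w)"
      by (auto simp: distinct_adj_append_iff delta_def distinct_adj_upt reduced_def)
    then show ?thesis
      using that word_mult_eq_append[of "delta k" "Suc k # w"]
        by (simp add: delta_Suc word_mult_append letter_mult_hd_or_0)
  qed
  consider "hd_or_0 u = Suc k" "hd_or_0 v = Suc k" | "hd_or_0 u \<noteq> Suc k" "hd_or_0 v = Suc k"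
    | "hd_or_0 u \<noteq> Suc k" "hd_or_0 v \<noteq> Suc k" | "hd_or_0 u = Suc k" "hd_or_0 v \<noteq> Suc k" by blast
  then show ?case
  proof cases
    case 1
    then obtain u' v' where w: "u = Suc k # u'" "v = Suc k # v'" by (cases u; cases v) auto
    then show ?thesis using Suc.IH[of u' v'] Suc.prems word_less
      by (auto simp: delta_Suc word_mult_append reduced_Cons)
  next
    case 2
    then obtain v' where w: "v = Suc k # v'" by (cases v) auto
    have "word_less 0 (delta k @ Suc k # u) (word_mult (delta k) v')"
      using w Suc.prems by (intro word_less_word_mult_delta_aux1)
        (auto simp: reduced_Cons reduced_pos_reduced delta_Suc)
    then show ?thesis using ap[of u] 2 Suc.prems w by (simp add: delta_Suc word_mult_append)
  next
    case 3
    \<comment> \<open>Apart from the excluded heads k + 1 and k + 2, the old context and k + 1 order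
      all items alike; if the old context is 0, then k + 1 is the greatest letter N.\<close>
    have "word_less (Suc k) u v"
    proof (cases "hd_or_0 u = hd_or_0 v")
      case True
      then show ?thesis using word_less
        by (cases u; cases v) (use Suc.prems in \<open>auto simp: reduced_def\<close>)
    next
      case False
      then show ?thesis using word_less p 3 word_le Suc.prems(5,6)
        by (auto simp: word_less_hd_or_0_neq cyc_less_def split: if_splits)
    qed
    then show ?thesis using ap 3 Suc.prems by (simp add: word_less_append)
  next
    case 4
    then have False using word_less p word_le Suc.prems(5,6)
      by (auto simp: word_less_hd_or_0_neq cyc_less_def split: if_splits)
    then show ?thesis ..
  qed
qed

text \<open>Among reduced words \<open>rev (delta N)\<close> is the greatest, and delta sends it to
  the empty word, the least. This is the only point where the translation wraps around.\<close>

lemma word_less_word_mult_delta: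
  assumes "N > 0" "u \<in> reduced N" "v \<in> reduced N" "word_less 0 u v" "v \<noteq> rev (delta N)"
  shows "word_less 0 (word_mult (delta N) u) (word_mult (delta N) v)"
  using word_less_word_mult_delta_aux2[of N N u v] assms hd_or_0_le[of u N] hd_or_0_le[of v N]
    by auto

text \<open>The powers of delta are the vertices along the boundary line of the base vertex. On all
  other words every power of delta preserves the order.\<close>

definition off_boundary :: "nat \<Rightarrow> nat list \<Rightarrow> bool" where
  "off_boundary N w \<longleftrightarrow> (\<forall>k. w \<noteq> delta_shift N k [])"

lemma off_boundary_shift: "distinct_adj w \<Longrightarrow> off_boundary N w \<Longrightarrow> off_boundary N (delta_shift N k w)"
  unfolding off_boundary_def using delta_shift_add[of w N "- k" k] delta_shift_add[of "[]" N "- k"]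
  by (metis add.left_inverse delta_shift_0 distinct_adj_Nil)

lemma delta_shift_1: "delta_shift N 1 w = word_mult (delta N) w"
  and delta_shift_minus_1: "delta_shift N (- 1) w = word_mult (rev (delta N)) w"
  by (simp_all add: delta_shift_def)

lemma word_less_delta_shift_1:
  assumes "N > 0" "u \<in> reduced N" "v \<in> reduced N" "word_less 0 u v" "off_boundary N v"
  shows "word_less 0 (delta_shift N 1 u) (delta_shift N 1 v)"
proof -
  have "v \<noteq> rev (delta N)"
    using assms(5) word_mult_Nil_right[of "rev (delta N)"] delta_reduced[of N]
    by (auto simp: off_boundary_def delta_shift_minus_1 reduced_def dest: spec[of _ "- 1"])
  then show ?thesis using word_less_word_mult_delta assms by (simp add: delta_shift_1)
qed

lemma word_less_delta_shift:
  assumes "N > 0" "u \<in> reduced N" "v \<in> reduced N" "word_less 0 u v" "off_boundary N u"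
    "off_boundary N v"
  shows "word_less 0 (delta_shift N k u) (delta_shift N k v)"
proof -
  note d = reduced_distinct_adj[OF assms(2)] reduced_distinct_adj[OF assms(3)]
  show ?thesis
  proof (induction k rule: int_induct[where k = 0])
    case base
    then show ?case using assms by simp
  next
    case (step1 i)
    then show ?case
      using word_less_delta_shift_1[of N "delta_shift N i u" "delta_shift N i v"] assms d
      by (simp add: delta_shift_add1 delta_shift_1 delta_shift_reduced off_boundary_shift)
  next
    case (step2 i)
    let ?u = "delta_shift N (i - 1) u" and ?v = "delta_shift N (i - 1) v"
    have e: "delta_shift N i u = delta_shift N 1 ?u" "delta_shift N i v = delta_shift N 1 ?v"
      using delta_shift_add[of u N 1 "i - 1"] delta_shift_add[of v N 1 "i - 1"] d by simp_all
    have dd: "?u \<in> reduced N" "?v \<in> reduced N" "off_boundary N ?u" using assms d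
      by (auto intro: delta_shift_reduced off_boundary_shift)
    have "\<not> word_less 0 ?v ?u"
      using word_less_delta_shift_1[of N ?v ?u] dd e step2(2) assms(1) word_less_asym by metis
    moreover have "?u \<noteq> ?v" using e step2(2) by (metis word_less_irrefl)
    ultimately show ?case using word_less_total[of ?u ?v 0] dd reduced_pos_reduced
      by (auto simp: pos_reduced_def)
  qed
qed

section \<open>Unlinked arcs and the fundamental domain of the boundary translation\<close>

lemma word_mult_single:
  "distinct_adj w \<Longrightarrow> word_mult w [x] = (if w \<noteq> [] \<and> last w = x then butlast w else w @ [x])"
proof (induction w)
  case (Cons a w)
  then have "distinct_adj w" by (cases w) auto
  with Cons.IH have IH: "word_mult w [x] = (if w \<noteq> [] \<and> last w = x then butlast w else w @ [x])"
    by simp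
  show ?case
  proof (cases w)
    case Nil
    then show ?thesis by auto
  next
    case (Cons b v)
    then show ?thesis using IH Cons.prems by (cases v) (auto simp: letter_mult_hd_or_0)
  qed
qed simp

text \<open>A nonempty word below [1] has the form 1 d ..., and multiplication by N on the right
  affects only its end, so the product does not get above [1]: after 1 the end of the word is the
  last item. Hence a lift of the last arc does not cross the arc from [] to [1]; for w = [] the two
  merely share an end.\<close>

lemma unlinked_1:
  assumes "w \<in> reduced N" "N > 1" "word_less 0 w [1]" "word_less 0 [1] (word_mult w [N])"
  shows "w = []"
proof (rule ccontr)
  assume "w \<noteq> []"
  then obtain a c where w: "w = a # c" by (cases w) auto
  then have a: "a = 1" "c \<noteq> []" using assms
    by (auto simp: cyc_less_def reduced_def split: if_splits)
  then obtain d r where c: "c = d # r" by (cases c) auto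
  have "d > 0" using assms w c by (auto simp: reduced_def)
  moreover have "word_mult w [N] = [1] \<or> (\<exists>t. word_mult w [N] = 1 # d # t)"
    using word_mult_single[OF reduced_distinct_adj[OF assms(1)], of N] w a c by (cases r) auto
  ultimately show False using assms(4) by (auto simp: cyc_less_def)
qed

text \<open>The analogue for the last arc: after N the end of the word comes first, so a word below
  [N] is empty or starts with a smaller letter, and a letter 1 appended to it does not lift it above
  [N].\<close>

lemma unlinked_N:
  assumes "w \<in> reduced N" "N > 1" "word_less 0 w [N]" "word_less 0 [N] (word_mult w [1])"
  shows False
proof (cases w)
  case Nil
  then show False using assms by (auto simp: cyc_less_def split: if_splits)
next
  case (Cons a c)
  have a: "a \<in> {1..N}" "set c \<subseteq> {1..N}" "distinct_adj w" using assms Cons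
    by (auto simp: reduced_def)
  show False
  proof (cases "a = N")
    case True
    then show False using assms(3) Cons a by (cases c) (auto simp: cyc_less_def split: if_splits)
  next
    case False
    have "word_mult w [1] = [] \<or> (\<exists>t. word_mult w [1] = a # t)"
      using word_mult_single[OF a(3), of 1] Cons by (cases c) auto
    then show False using assms(4) a False by (auto simp: cyc_less_def split: if_splits)
  qed
qed

section \<open>Dynamics of the boundary translation\<close>

lemma word_mult_cases:
  assumes "distinct_adj xs" "xs \<noteq> []" "distinct_adj w"
  shows "(\<exists>t. word_mult xs w = hd xs # t) \<or> w = rev xs @ word_mult xs w"
  using assms
proof (induction xs arbitrary: w rule: rev_induct)
  case (snoc x xs)
  show ?case
  proof (cases "hd_or_0 w = x \<and> w \<noteq> []")
    case True
    then obtain v where w: "w = x # v" by (cases w) auto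
    show ?thesis
    proof (cases "xs = []")
      case False
      have "distinct_adj v" using snoc.prems w by (cases v) auto
      then show ?thesis using snoc.IH[of v] snoc.prems False w
        by (auto simp: word_mult_append distinct_adj_append_iff)
    qed (simp add: w)
  next
    case False
    then have "distinct_adj (xs @ x # w)"
      using snoc.prems by (cases w) (auto simp: distinct_adj_append_iff)
    moreover have "letter_mult x w = x # w" using False by (cases w) auto
    ultimately have "word_mult (xs @ [x]) w = xs @ x # w"
      by (simp add: word_mult_append word_mult_eq_append)
    then show ?thesis by (cases xs) auto
  qed
qed simp

lemma delta_simps [simp]:
  "length (delta N) = N" "delta N = [] \<longleftrightarrow> N = 0" "N > 0 \<Longrightarrow> hd (delta N) = 1"
    "N > 0 \<Longrightarrow> last (delta N) = N"
  by (auto simp: delta_def hd_append)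

lemma distinct_adj_delta [simp]: "distinct_adj (delta N)"
  using delta_reduced[of N] by (simp add: reduced_def)

lemma hd_rev_delta [simp]: "N > 0 \<Longrightarrow> hd (rev (delta N)) = N" "N > 0 \<Longrightarrow> last (rev (delta N)) = 1"
  by (simp_all add: hd_rev last_rev)

text \<open>Multiplication by delta either leaves its letter 1 in front or swallows delta entirely.
  The latter shortens the word by N, so it cannot go on forever.\<close>

lemma delta_shift_hd_1:
  assumes "N > 0" "w \<in> reduced N" "off_boundary N w"
  shows "\<exists>k::nat. hd_or_0 (delta_shift N (int k) w) = 1"
  using assms
proof (induction w rule: length_induct)
  case (1 w)
  have d: "distinct_adj (delta N)" "delta N \<noteq> []" "hd (delta N) = 1" "distinct_adj w"
    using 1 by (auto simp: reduced_def)
  consider t where "delta_shift N 1 w = 1 # t" | "w = rev (delta N) @ delta_shift N 1 w"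
    using word_mult_cases[of "delta N" w] d by (auto simp: delta_shift_1)
  then show ?case
  proof cases
    case 1
    then show ?thesis by (intro exI[of _ 1]) simp
  next
    case 2
    have "length (delta_shift N 1 w) < length w"
      using arg_cong[OF 2, of length] assms(1) by simp
    then obtain k :: nat where "hd_or_0 (delta_shift N (int k) (delta_shift N 1 w)) = 1"
      using 1 d by (metis delta_shift_reduced off_boundary_shift)
    then show ?thesis using d by (intro exI[of _ "Suc k"])
      (simp add: delta_shift_add[symmetric] algebra_simps)
  qed
qed

lemma delta_shift_hd_N:
  assumes "N > 0" "w \<in> reduced N" "off_boundary N w"
  shows "\<exists>k::nat. hd_or_0 (delta_shift N (- int k) w) = N"
  using assms
proof (induction w rule: length_induct)
  case (1 w)
  have d: "distinct_adj (rev (delta N))" "rev (delta N) \<noteq> []" "hd (rev (delta N)) = N"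
    "distinct_adj w"
    using 1 by (auto simp: reduced_def)
  consider t where "delta_shift N (- 1) w = N # t" | "w = delta N @ delta_shift N (- 1) w"
    using word_mult_cases[of "rev (delta N)" w] d by (auto simp: delta_shift_minus_1)
  then show ?case
  proof cases
    case 1
    then show ?thesis by (intro exI[of _ 1]) simp
  next
    case 2
    have "length (delta_shift N (- 1) w) < length w"
      using arg_cong[OF 2, of length] assms(1) by simp
    then obtain k :: nat where "hd_or_0 (delta_shift N (- int k) (delta_shift N (- 1) w)) = N"
      using 1 d by (metis delta_shift_reduced off_boundary_shift)
    then show ?thesis using d
      by (intro exI[of _ "Suc k"]) (simp add: delta_shift_add[symmetric] algebra_simps)
  qed
qed

text \<open>For 1 < y < N the word [y] separates the words starting with 1, reached by positive
  shifts, from those starting with N, reached by negative ones. The exponent k is a crossing between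
  the two; it puts w into the fundamental domain that begins at [y].\<close>

lemma delta_shift_fundamental:
  assumes "w \<in> reduced N" "off_boundary N w" "1 < y" "y < N"
  shows "\<exists>k. \<not> word_less 0 (delta_shift N k w) [y] \<and> word_less 0 (delta_shift N (k + 1) w) [y]"
proof -
  obtain a b :: nat where ab: "hd_or_0 (delta_shift N (int a) w) = 1"
    "hd_or_0 (delta_shift N (- int b) w) = N"
    using delta_shift_hd_1[of N w] delta_shift_hd_N[of N w] assms by auto
  define P where "P j \<longleftrightarrow> word_less 0 (delta_shift N (- int b + int j) w) [y]" for j :: nat
  have "P (a + b)" using ab(1) assms by (auto simp: P_def word_less_hd_or_0_neq cyc_less_def)
  moreover have "\<not> P 0" using ab(2) assms by (auto simp: P_def word_less_hd_or_0_neq cyc_less_def)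
  ultimately obtain j where "\<not> P j" "P (Suc j)"
    by (metis exists_least_lemma)
  then show ?thesis unfolding P_def by (intro exI[of _ "- int b + int j"]) (simp add: algebra_simps)
qed

text \<open>Powers of delta are plain concatenations: a copy ends in N and the next starts with 1,
  so nothing cancels when N > 1.\<close>

lemma delta_shift_Nil_pos:
  assumes "N > 1" "k > 0" shows "delta_shift N k [] = delta N @ delta_shift N (k - 1) []"
proof -
  have "delta_shift N (int (Suc j)) [] = delta N @ delta_shift N (int j) []" for j
  proof (induction j)
    case 0
    show ?case by (simp add: delta_shift_1 word_mult_Nil_right)
  next
    case (Suc j)
    define v where "v = delta_shift N (int (Suc j)) []"
    have "hd v = 1" using Suc assms by (simp add: v_def hd_append)
    moreover have "distinct_adj v" by (simp add: v_def distinct_adj_delta_shift)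
    ultimately have "distinct_adj (delta N @ v)"
      using assms by (simp add: distinct_adj_append_iff)
    moreover have "delta_shift N (int (Suc (Suc j))) [] = word_mult (delta N) v"
      using delta_shift_add1[of "[]" N "int (Suc j)"] by (simp add: v_def algebra_simps)
    ultimately show ?case by (simp add: word_mult_eq_append v_def)
  qed
  from this[of "nat (k - 1)"] show ?thesis using assms by simp
qed

lemma delta_shift_Nil_neg:
  assumes "N > 1" "k < 0" shows "delta_shift N k [] = rev (delta N) @ delta_shift N (k + 1) []"
proof -
  have "delta_shift N (- int (Suc j)) [] = rev (delta N) @ delta_shift N (- int j) []" for j
  proof (induction j)
    case 0
    show ?case by (simp add: delta_shift_minus_1 word_mult_Nil_right)
  next
    case (Suc j)
    define v where "v = delta_shift N (- int (Suc j)) []"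
    have "hd v = N" using Suc assms by (simp add: v_def hd_append)
    moreover have "distinct_adj v" by (simp add: v_def distinct_adj_delta_shift)
    ultimately have "distinct_adj (rev (delta N) @ v)"
      using assms by (simp add: distinct_adj_append_iff)
    moreover have "delta_shift N (- int (Suc (Suc j))) [] = word_mult (rev (delta N)) v"
      using delta_shift_diff1[of "[]" N "- int (Suc j)"] by (simp add: v_def algebra_simps)
    ultimately show ?case by (simp add: word_mult_eq_append v_def)
  qed
  from this[of "nat (- k - 1)"] show ?thesis using assms by (simp add: add.commute)
qed

text \<open>A negative power is \<open>rev (delta N)\<close> followed by nothing or by a further
  copy of it. The last assumption is restricted to these continuations, because words that begin
  with \<open>rev (delta N)\<close> and continue otherwise are off the boundary too.\<close>

lemma off_boundaryI:
  assumes "N > 1" "w \<noteq> []" "\<And>t. w \<noteq> delta N @ t"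
    "\<And>t. t = [] \<or> (\<exists>s. t = rev (delta N) @ s) \<Longrightarrow> w \<noteq> rev (delta N) @ t"
  shows "off_boundary N w"
  unfolding off_boundary_def
proof
  fix k :: int
  consider "k = 0" | "k > 0" | "k = - 1" | "k < - 1" by linarith
  then show "w \<noteq> delta_shift N k []"
    using assms delta_shift_Nil_pos[of N k] delta_shift_Nil_neg[of N k]
      delta_shift_Nil_neg[of N "k + 1"] by cases auto
qed

lemma off_boundary_single: "N > 1 \<Longrightarrow> off_boundary N [x]"
  by (intro off_boundaryI) (auto simp: Cons_eq_append_conv dest: arg_cong[of _ _ length])

definition word_le :: "nat list \<Rightarrow> nat list \<Rightarrow> bool" where
  "word_le u v \<longleftrightarrow> u = v \<or> word_less 0 u v"

lemma word_le_word_less_trans: "word_le u v \<Longrightarrow> word_less 0 v w \<Longrightarrow> word_less 0 u w"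
  and word_less_word_le_trans: "word_less 0 u v \<Longrightarrow> word_le v w \<Longrightarrow> word_less 0 u w"
  by (auto simp: word_le_def intro: word_less_trans)

lemma word_le_hurwitz:
  assumes "b \<in> lists ({1..n} \<times> UNIV)" "u \<in> reduced (Suc n)" "v \<in> reduced (Suc n)" "word_le u v"
  shows "word_le (hurwitz b u) (hurwitz b v)"
  using assms word_less_hurwitz by (auto simp: word_le_def)

lemma off_boundary_hurwitz:
  assumes "b \<in> lists ({1..n} \<times> UNIV)" "distinct_adj w" "off_boundary (Suc n) w"
  shows "off_boundary (Suc n) (hurwitz b w)"
  unfolding off_boundary_def
proof (intro allI notI)
  fix k assume "hurwitz b w = delta_shift (Suc n) k []"
  then have "hurwitz (word_inv b) (hurwitz b w) = delta_shift (Suc n) k []"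
    using hurwitz_delta_shift[OF word_inv_lists[OF assms(1)], of k "[]"] by simp
  then show False using assms hurwitz_word_inv_hurwitz by (auto simp: off_boundary_def)
qed

section \<open>Action of the words s_1 ... s_k and their reversals on letters\<close>

definition cycle_word :: "nat \<Rightarrow> nat word" where
  "cycle_word k = map (\<lambda>i. (i, True)) [1..<Suc k]"

lemma cycle_word_Suc: "cycle_word (Suc k) = cycle_word k @ [(Suc k, True)]"
  by (simp add: cycle_word_def)

lemma hurwitz_cycle_word:
  "i \<in> {1..k} \<Longrightarrow> hurwitz (cycle_word k) [i] = [1, Suc i, 1]" "hurwitz (cycle_word k) [Suc k] = [1]"
  "i > Suc k \<Longrightarrow> hurwitz (cycle_word k) [i] = [i]"
proof (induction k arbitrary: i)
  case 0
  { case 1 then show ?case by simp }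
  { case 2 then show ?case by (simp add: cycle_word_def) }
  { case 3 then show ?case by (simp add: cycle_word_def) }
next
  case (Suc k)
  { case 1
    have "hurwitz (cycle_word k) [Suc k, Suc (Suc k), Suc k] = [1, Suc (Suc k), 1]"
      using Suc.IH(2) Suc.IH(3)[of "Suc (Suc k)"]
      by (simp add: hurwitz_Cons_right[of "Suc k" "[Suc (Suc k), Suc k]"]
        hurwitz_Cons_right[of "Suc (Suc k)" "[Suc k]"])
    with 1 show ?case using Suc.IH(1)[of i]
      by (cases "i = Suc k") (auto simp: cycle_word_Suc hurwitz_append hurwitz_Cons
        twist_letter_def) }
  { case 2 then show ?case using Suc.IH(2)
    by (simp add: cycle_word_Suc hurwitz_append hurwitz_Cons twist_letter_def) }
  { case 3 then show ?case using Suc.IH(3)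
    by (simp add: cycle_word_Suc hurwitz_append hurwitz_Cons twist_letter_def) }
qed

lemma hurwitz_rev_cycle_word:
  "hurwitz (rev (cycle_word k)) [1] = delta k @ Suc k # rev (delta k)"
  "i \<in> {1..k} \<Longrightarrow> hurwitz (rev (cycle_word k)) [Suc i] = [i]"
  "i > Suc k \<Longrightarrow> hurwitz (rev (cycle_word k)) [i] = [i]"
proof (induction k arbitrary: i)
  case 0
  { case 1 then show ?case by (simp add: cycle_word_def delta_def) }
  { case 2 then show ?case by simp }
  { case 3 then show ?case by (simp add: cycle_word_def) }
next
  case (Suc k)
  have step: "hurwitz (rev (cycle_word (Suc k))) w = subst_letters (twist_letter (Suc k, True))
    (hurwitz (rev (cycle_word k)) w)" for w
    by (simp add: cycle_word_Suc hurwitz_Cons)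
  { case 1
    have d: "distinct_adj (delta k)" using delta_reduced[of k] by (simp add: reduced_def)
    have fx: "subst_letters (twist_letter (Suc k, True)) (delta k) = delta k"
      "subst_letters (twist_letter (Suc k, True)) (rev (delta k)) = rev (delta k)"
      using d by (auto intro!: subst_letters_fix simp: set_delta twist_letter_def)
    have dd: "distinct_adj (delta k @ Suc k # Suc (Suc k) # Suc k # rev (delta k))"
      "distinct_adj (delta k @ Suc k # rev (delta k))"
      using d by (cases k; auto simp: distinct_adj_append_iff distinct_adj_Cons delta_def
        hd_append)+
    have h: "hd_or_0 (rev (delta k)) \<noteq> x" if "x > k" for x
      using that by (cases k) (auto simp: delta_def)
    have t: "twist_letter (Suc k, True) (Suc k) = [Suc k, Suc (Suc k), Suc k]"
      by (simp add: twist_letter_def)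
    have "subst_letters (twist_letter (Suc k, True)) (delta k @ Suc k # rev (delta k)) =
        word_mult (delta k) (subst_letters (twist_letter (Suc k, True)) (Suc k # rev (delta k)))"
      using subst_letters_append[OF rev_twist dd(2)] fx by simp
    also have "subst_letters (twist_letter (Suc k, True)) (Suc k # rev (delta k)) = Suc k # Suc
      (Suc k) # Suc k # rev (delta k)"
      using fx h t by (simp add: letter_mult_hd_or_0)
    also have "word_mult (delta k) \<dots> = delta k @ Suc k # Suc (Suc k) # Suc k # rev (delta k)"
      using dd by (simp add: word_mult_eq_append)
    finally show ?case unfolding step Suc.IH(1) by (simp add: delta_Suc) }
  { case 2 then show ?case using Suc.IH(2)[of i] Suc.IH(3)[of "Suc (Suc k)"]
      by (cases "i = Suc k") (auto simp: step twist_letter_def) }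
  { case 3 then show ?case using Suc.IH(3) by (simp add: step twist_letter_def) }
qed

section \<open>A braid with north-south dynamics\<close>

context
  fixes m :: nat
  assumes m: "m \<ge> 2"
begin

abbreviation "pen \<equiv> Suc m"
abbreviation "ult \<equiv> Suc (Suc m)"

text \<open>The cycle words drag puncture m + 1 once around the first m, which is s_1 s_1 in the
  disk with three punctures obtained by merging these. So \<open>fat_braid\<close> becomes the
  inverse of s_2 followed by s_1 s_1; its matrix in SL(2, Z) has trace 4 and is therefore
  hyperbolic.\<close>

definition fat_braid :: "nat word" where
  "fat_braid = (pen, False) # rev (cycle_word m) @ cycle_word m"

definition fat_rev where "fat_rev = rev (delta m)"
definition fat_conj where "fat_conj = delta m @ ult # fat_rev"

lemma fat_rev_facts: "distinct_adj fat_rev" "hd fat_rev = m" "last fat_rev = 1" "fat_rev \<noteq> []"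
  "set fat_rev = {1..m}"
  using m by (auto simp: fat_rev_def set_delta)

lemma delta_ult: "delta ult = delta m @ [pen, ult]" "rev (delta ult) = ult # pen # fat_rev"
  by (simp_all add: delta_Suc fat_rev_def)

lemma delta_Cons: obtains t where "delta ult = 1 # 2 # t"
  using m by (auto simp: delta_def upt_conv_Cons numeral_2_eq_2 simp del: upt_Suc)

lemma off_boundary_ultI:
  assumes "w \<noteq> []" "hd w \<noteq> 1" "\<nexists>t. w = ult # pen # t"
  shows "off_boundary ult w"
proof (rule off_boundaryI)
  show "w \<noteq> delta ult @ t" for t using assms by (metis delta_Cons append_Cons list.sel(1))
  show "w \<noteq> rev (delta ult) @ t" for t using assms(3) by (auto simp only: delta_ult(2) append_Cons)
qed (use assms in auto)

lemma distinct_adj_fat_conj: "distinct_adj fat_conj" "rev fat_conj = fat_conj"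
  using fat_rev_facts m by (auto simp: fat_conj_def fat_rev_def distinct_adj_append_iff
    distinct_adj_Cons)

lemma fat_braid_lists: "fat_braid \<in> lists ({1..pen} \<times> UNIV)"
  by (auto simp: fat_braid_def cycle_word_def)

lemma hurwitz_pen_conj: "hurwitz (rev (cycle_word m)) [1] = delta m @ pen # fat_rev"
    "hurwitz [(pen, False)] (delta m @ pen # fat_rev) = fat_conj"
proof -
  show "hurwitz (rev (cycle_word m)) [1] = delta m @ pen # fat_rev"
    using hurwitz_rev_cycle_word(1)[of m] by (simp add: fat_rev_def)
  have "distinct_adj (delta m @ pen # fat_rev)"
    using fat_rev_facts m by (auto simp: distinct_adj_append_iff distinct_adj_Cons)
  moreover have "subst_letters (twist_letter (pen, False)) (delta m) = delta m"
    "subst_letters (twist_letter (pen, False)) fat_rev = fat_rev"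
    using fat_rev_facts by (auto intro!: subst_letters_fix simp: twist_letter_def set_delta)
  moreover have "letter_mult ult fat_rev = ult # fat_rev" using fat_rev_facts
    by (intro letter_mult_hd_or_0) (cases fat_rev; auto)
  moreover have "twist_letter (pen, False) pen = [ult]" by (simp add: twist_letter_def)
  ultimately have "hurwitz [(pen, False)] (delta m @ pen # fat_rev) = word_mult (delta m)
    (ult # fat_rev)"
    by (simp add: hurwitz_Cons subst_letters_append rev_twist)
  also have "\<dots> = fat_conj" using distinct_adj_fat_conj
    by (simp add: fat_conj_def word_mult_eq_append)
  finally show "hurwitz [(pen, False)] (delta m @ pen # fat_rev) = fat_conj" .
qed

lemma hurwitz_fat_braid_low: assumes "i \<in> {1..m}" shows
  "hurwitz fat_braid [i] = word_mult fat_conj (word_mult [i] fat_conj)"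
proof -
  have "hurwitz fat_braid [i] = hurwitz [(pen, False)] (hurwitz (rev (cycle_word m)) [1, Suc i, 1])"
    using hurwitz_cycle_word(1)[OF assms] by (simp add: fat_braid_def hurwitz_Cons hurwitz_append)
  also have "[1, Suc i, 1] = word_mult [1] (word_mult [Suc i] [1])" using assms by auto
  also have "hurwitz [(pen, False)] (hurwitz (rev (cycle_word m)) \<dots>) = word_mult fat_conj
    (word_mult (hurwitz [(pen, False)] [i]) fat_conj)"
    by (simp only: hurwitz_word_mult hurwitz_pen_conj hurwitz_rev_cycle_word(2)[OF assms])
  also have "hurwitz [(pen, False)] [i] = [i]" using assms
    by (simp add: hurwitz_Cons twist_letter_def)
  finally show ?thesis .
qed

lemma hurwitz_fat_braid_pen: "hurwitz fat_braid [pen] = fat_conj"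
  using hurwitz_pen_conj hurwitz_cycle_word(2)[of m]
    by (simp add: fat_braid_def hurwitz_Cons hurwitz_append)

lemma hurwitz_fat_braid_ult: "hurwitz fat_braid [ult] = [ult, pen, ult]"
  using hurwitz_cycle_word(3)[of m ult] hurwitz_rev_cycle_word(3)[of m ult]
  by (simp add: fat_braid_def hurwitz_Cons hurwitz_append twist_letter_def)

lemma fat_conj_involution: "distinct_adj w \<Longrightarrow> word_mult fat_conj (word_mult fat_conj w) = w"
  using word_mult_rev_word_mult[of w fat_conj] distinct_adj_fat_conj by simp

text \<open>This is what makes the first m punctures a single fat one: all their letters are
  conjugated by the same involution, so the inner factors cancel in pairs.\<close>

lemma hurwitz_fat_braid_word: "distinct_adj w \<Longrightarrow> set w \<subseteq> {1..m} \<Longrightarrow> hurwitz fat_braid w = word_mult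
  fat_conj (word_mult w fat_conj)"
proof (induction w)
  case Nil
  then show ?case using fat_conj_involution[of "[]"] word_mult_Nil_right distinct_adj_fat_conj
    by simp
next
  case (Cons x w)
  then have d: "distinct_adj w" by (cases w) auto
  have "hurwitz fat_braid (x # w) = word_mult (word_mult fat_conj (word_mult [x] fat_conj))
    (word_mult fat_conj (word_mult w fat_conj))"
    using Cons d hurwitz_fat_braid_low[of x] by (subst hurwitz_Cons_right) auto
  also have "\<dots> = word_mult fat_conj
    (word_mult [x] (word_mult fat_conj (word_mult fat_conj (word_mult w fat_conj))))"
    by (simp add: word_mult_assoc distinct_adj_word_mult distinct_adj_fat_conj
      word_mult_letter_mult)
  finally show ?case by (simp add: fat_conj_involution distinct_adj_word_mult distinct_adj_fat_conj)
qed

definition lower_end where "lower_end = pen # fat_rev @ [ult]"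
definition upper_end where "upper_end = ult # pen # fat_rev @ [pen]"

lemma fat_rev_Cons: obtains V where "fat_rev = m # V"
  using fat_rev_facts by (cases fat_rev) auto

lemma distinct_adj_ends: "distinct_adj lower_end" "distinct_adj upper_end"
  "distinct_adj (pen # fat_rev @ [pen])"
    "distinct_adj (ult # fat_rev @ [ult, pen, ult])" "distinct_adj (ult # pen # ult # fat_rev)"
  using fat_rev_facts m by (auto simp: lower_end_def upper_end_def distinct_adj_append_iff
    distinct_adj_Cons)

lemma ends_reduced: "lower_end \<in> reduced ult" "upper_end \<in> reduced ult"
  using distinct_adj_ends fat_rev_facts m by (auto simp: reduced_def lower_end_def upper_end_def)

text \<open>The letter \<open>pen\<close> maps to \<open>fat_conj\<close>, which cancels the left
  half of the conjugation of \<open>fat_rev\<close>; then \<open>fat_rev\<close> meets its inverse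
  \<open>delta m\<close> inside the remaining \<open>fat_conj\<close>.\<close>

lemma hurwitz_fat_braid_lower_end: "hurwitz fat_braid lower_end = ult # fat_rev @ [ult, pen, ult]"
proof -
  have d: "distinct_adj (fat_rev @ [ult])" "distinct_adj (fat_rev @ [ult, pen, ult])"
    using distinct_adj_ends by (auto simp: lower_end_def distinct_adj_append_iff distinct_adj_Cons)
  have "lower_end = word_mult [pen] (word_mult fat_rev [ult])"
    using distinct_adj_ends(1) d by (simp add: word_mult_eq_append letter_mult_Cons lower_end_def)
  then have "hurwitz fat_braid lower_end = word_mult fat_conj
    (word_mult (word_mult fat_conj (word_mult fat_rev fat_conj)) [ult, pen, ult])"
    using hurwitz_fat_braid_word[of fat_rev] fat_rev_facts
      by (simp only: hurwitz_word_mult hurwitz_fat_braid_pen hurwitz_fat_braid_ult)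
  also have "\<dots> = word_mult fat_rev (word_mult fat_conj [ult, pen, ult])"
    by (simp add: word_mult_assoc fat_conj_involution distinct_adj_word_mult)
  also have "word_mult fat_conj [ult, pen, ult] = word_mult (delta m)
    (ult # fat_rev @ [ult, pen, ult])"
    using d distinct_adj_ends(4) by (simp add: fat_conj_def word_mult_append word_mult_eq_append
      letter_mult_Cons del: letter_mult.simps)
  also have "word_mult fat_rev \<dots> = ult # fat_rev @ [ult, pen, ult]"
    using word_mult_rev_word_mult[OF distinct_adj_ends(4), of "delta m"] by (simp add: fat_rev_def)
  finally show ?thesis .
qed

text \<open>The two letters \<open>pen\<close> around \<open>fat_rev\<close> map to
  \<open>fat_conj\<close> and cancel both halves of its conjugation.\<close>

lemma hurwitz_fat_braid_upper_end: "hurwitz fat_braid upper_end = ult # pen # ult # fat_rev"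
proof -
  have d: "distinct_adj (fat_rev @ [pen])"
    using distinct_adj_ends(3) by (auto simp: distinct_adj_append_iff distinct_adj_Cons)
  have "upper_end = word_mult [ult] (word_mult [pen] (word_mult fat_rev [pen]))"
    using distinct_adj_ends(2,3) d by (simp add: word_mult_eq_append letter_mult_Cons upper_end_def)
  then have "hurwitz fat_braid upper_end = word_mult [ult, pen, ult]
    (word_mult fat_conj (word_mult (word_mult fat_conj (word_mult fat_rev fat_conj)) fat_conj))"
    using hurwitz_fat_braid_word[of fat_rev] fat_rev_facts
      by (simp only: hurwitz_word_mult hurwitz_fat_braid_pen hurwitz_fat_braid_ult)
  also have "\<dots> = word_mult [ult, pen, ult] (word_mult fat_rev (word_mult fat_conj fat_conj))"
    by (simp only: word_mult_assoc fat_conj_involution distinct_adj_word_mult distinct_adj_fat_conj)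
  also have "word_mult fat_conj fat_conj = []"
    using fat_conj_involution[of "[]"] word_mult_Nil_right[of fat_conj] distinct_adj_fat_conj
      by simp
  also have "word_mult fat_rev [] = fat_rev" using fat_rev_facts by (simp add: word_mult_Nil_right)
  also have "word_mult [ult, pen, ult] fat_rev = ult # pen # ult # fat_rev"
    using distinct_adj_ends(5) word_mult_eq_append[of "[ult, pen, ult]" fat_rev] by simp
  finally show ?thesis .
qed

section \<open>Levels of trapping under powers of the fat braid\<close>

definition fat_power :: "nat \<Rightarrow> nat word" where
  "fat_power j = concat (replicate j fat_braid)"

lemma fat_power_lists: "fat_power j \<in> lists ({1..pen} \<times> UNIV)"
  using fat_braid_lists by (induction j) (auto simp: fat_power_def)

lemma fat_power_Suc: "fat_power (Suc j) = fat_power j @ fat_braid"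
  unfolding fat_power_def by (metis append_Nil2 concat.simps concat_append replicate_Suc
    replicate_append_same)

text \<open>The interval \<open>J\<close> runs from \<open>[pen]\<close> to \<open>lower_end\<close>, and \<open>upper_end\<close> is \<open>\<delta>\<^sup>-\<^sup>1 [pen]\<close>. So
  modulo \<open>\<delta>\<close> the complement of \<open>J\<close> runs from \<open>lower_end\<close> to \<open>upper_end\<close>. The assumptions of
  \<open>not_linked\<close> say that the first arc is in the image of this complement under \<open>fat_braid\<close> and
  the second one in \<open>J\<close>; the translate of the second arc by \<open>g = ult \<cdot> \<delta>\<^sup>i\<close> is then linked with
  the first.\<close>

definition trapped :: "nat \<Rightarrow> nat list \<Rightarrow> bool" where
  "trapped j a \<longleftrightarrow>
    (\<exists>k. word_le (hurwitz (fat_power j) lower_end) (delta_shift ult k a) \<and> word_le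
      (delta_shift ult k a) (hurwitz (fat_power j) upper_end))"

lemma not_linked:
  assumes b: "b \<in> lists ({1..pen} \<times> UNIV)" and x: "{x, x'} = {1, ult}"
    and a: "word_le (ult # fat_rev @ [ult, pen, ult]) (delta_shift ult k (hurwitz b [x]))"
      "word_le (delta_shift ult k (hurwitz b [x])) (ult # pen # ult # fat_rev)"
    and b': "\<not> word_less 0 (delta_shift ult i (hurwitz b [x'])) [pen]"
      "word_less 0 (delta_shift ult i (hurwitz b [x'])) lower_end"
  shows False
proof -
  obtain V where V: "fat_rev = m # V" by (rule fat_rev_Cons)
  have z1: "ult > 1" "ult > 0" by auto
  have xd: "[x] \<in> reduced ult" "[x'] \<in> reduced ult" using x
    by (auto simp: reduced_def doubleton_eq_iff)
  define a1 where "a1 = delta_shift ult k (hurwitz b [x])"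
  define b1 where "b1 = delta_shift ult i (hurwitz b [x'])"
  have bd: "hurwitz b [x] \<in> reduced ult" "hurwitz b [x'] \<in> reduced ult"
    using hurwitz_reduced[OF b] xd by auto
  have dd: "a1 \<in> reduced ult" "b1 \<in> reduced ult" using bd delta_shift_reduced
    by (auto simp: a1_def b1_def)
  have off: "off_boundary ult (hurwitz b [x])" "off_boundary ult (hurwitz b [x'])"
    using off_boundary_hurwitz[OF b] off_boundary_single[OF z1(1)] by auto
  \<comment> \<open>Both ends of the interval J begin with \<open>pen\<close>, so everything in it
    does.\<close>
  have hb: "hd_or_0 b1 = pen"
  proof (rule ccontr)
    assume "hd_or_0 b1 \<noteq> pen"
    then show False using b' by (auto simp: b1_def[symmetric] word_less_hd_or_0_neq lower_end_def
      cyc_less_def split: if_splits)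
  qed
  then obtain b2 where b2: "b1 = pen # b2" by (cases b1) auto
  \<comment> \<open>After \<open>pen\<close> the items \<open>pen\<close> and \<open>ult\<close>
    precede the end of the word; a continuation by one of them would fall below [pen].\<close>
  have b2': "hd_or_0 b2 < pen"
    using b'(1) dd(2) hd_or_0_le[of b2 ult]
      by (cases b2) (auto simp: b1_def[symmetric] b2 cyc_less_def reduced_Cons split: if_splits)
  have zb: "ult # b1 \<in> reduced ult" using dd hb by (simp add: reduced_Cons)
  \<comment> \<open>Needed to shift the comparison by delta later. The delicate case is a word
    starting with \<open>rev (delta ult)\<close>: being below \<open>lower_end\<close> restricts how
    b1 continues, which excludes powers of delta.\<close>
  have off_zb: "off_boundary ult (ult # b1)"
  proof (rule off_boundaryI[OF z1(1)])
    show "ult # b1 \<noteq> delta ult @ t" for t using delta_Cons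
      by (metis append_Cons list.inject old.nat.distinct(1) nat.inject One_nat_def)
    show "ult # b1 \<noteq> rev (delta ult) @ t" if t: "t = [] \<or> (\<exists>s. t = rev (delta ult) @ s)" for t
    proof
      assume "ult # b1 = rev (delta ult) @ t"
      then have b1t: "b1 = pen # fat_rev @ t" by (simp only: delta_ult(2) append_Cons list.inject)
      have Us: "fat_rev = butlast fat_rev @ [1]" using fat_rev_facts
        by (metis append_butlast_last_id)
      have "word_less 0 (pen # fat_rev @ t) lower_end" using b'(2) b1t
        by (simp add: b1_def[symmetric])
      then have "word_less 1 t [ult]"
        using word_less_append[of 0 "pen # butlast fat_rev" 1 t "[ult]"] Us
          by (simp add: lower_end_def del: word_less.simps)
            (metis append.assoc append_Cons append_Nil)
      then show False using t by (auto simp: delta_ult cyc_less_def)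
    qed
  qed simp
  \<comment> \<open>The words agree on \<open>ult\<close>, \<open>pen\<close>; then
    \<open>ult\<close> is the earliest item after \<open>pen\<close>, whereas b1 continues with a
    smaller letter or ends.\<close>
  have lt2: "word_less 0 (delta_shift ult k (hurwitz b [x])) (ult # b1)"
  proof (rule word_le_word_less_trans[OF a(2)])
    show "word_less 0 (ult # pen # ult # fat_rev) (ult # b1)"
      using b2' b2 by (auto simp: word_less_hd_or_0_neq cyc_less_def)
  qed
  define g where "g = word_mult [ult] (delta_shift ult i [])"
  have gb: "word_mult g (hurwitz b [x']) = ult # b1"
  proof -
    have "word_mult g (hurwitz b [x']) = word_mult [ult]
      (word_mult (delta_shift ult i []) (hurwitz b [x']))"
      unfolding g_def using bd by (simp add: word_mult_letter_mult reduced_distinct_adj)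
    also have "word_mult (delta_shift ult i []) (hurwitz b [x']) = b1"
      unfolding b1_def using delta_shift_word_mult[of "hurwitz b [x']" ult i "[]"] bd
        by (simp add: reduced_distinct_adj)
    also have "word_mult [ult] b1 = ult # b1" using hb by (simp add: letter_mult_hd_or_0)
    finally show ?thesis .
  qed
  have gd: "g \<in> reduced ult" unfolding g_def
    by (intro word_mult_reduced delta_shift_reduced) (auto simp: reduced_def)
  \<comment> \<open>According to the sign of i, g is [ult], starts with \<open>ult\<close> 1, or
    starts with \<open>pen\<close>. All of these precede \<open>ult\<close> m because after
    \<open>ult\<close> the end and the letter 1 come before m; this uses m >= 2.\<close>
  have lt1: "word_less 0 g (delta_shift ult k (hurwitz b [x]))"
  proof (rule word_less_word_le_trans[OF _ a(1)])
    consider "i = 0" | "i > 0" | "i < 0" by linarith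
    then show "word_less 0 g (ult # fat_rev @ [ult, pen, ult])"
    proof cases
      case 1
      then show ?thesis using V m by (simp add: g_def cyc_less_def)
    next
      case 2
      then obtain t where "delta_shift ult i [] = delta ult @ t" using delta_shift_Nil_pos[OF z1(1)]
        by blast
      then obtain t' where "delta_shift ult i [] = 1 # t'" by (metis delta_Cons append_Cons)
      then show ?thesis using V m by (simp add: g_def cyc_less_def)
    next
      case 3
      then obtain t where "delta_shift ult i [] = ult # pen # t"
        using delta_shift_Nil_neg[OF z1(1)] delta_ult by auto
      then show ?thesis by (simp add: g_def cyc_less_def)
    qed
  qed
  have off_g: "off_boundary ult g"
  proof -
    consider "i = 0" | t where "delta_shift ult i [] = delta ult @ t" | t where
      "delta_shift ult i [] = rev (delta ult) @ t"
      using delta_shift_Nil_pos[OF z1(1), of i] delta_shift_Nil_neg[OF z1(1), of i]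
        by (cases i "0 :: int" rule: linorder_cases) auto
    then show ?thesis
    proof cases
      case 1
      then show ?thesis using off_boundary_single[OF z1(1)] by (simp add: g_def)
    next
      case 2
      then obtain t' where "delta_shift ult i [] = 1 # t'" by (metis delta_Cons append_Cons)
      then have "g = ult # 1 # t'" by (simp add: g_def)
      then show ?thesis using m by (intro off_boundary_ultI) auto
    next
      case 3
      then have "g = pen # fat_rev @ t" by (simp only: g_def delta_ult(2) append_Cons) simp
      then show ?thesis using m by (intro off_boundary_ultI) auto
    qed
  qed
  \<comment> \<open>Undoing the shift by k and then b turns the first arc into the letter x and the
    second into the lift of x' that starts at w. The two inequalities then say that these standard
    arcs are linked.\<close>
  let ?w = "hurwitz (word_inv b) (delta_shift ult (- k) g)"
  have wb: "word_inv b \<in> lists ({1..pen} \<times> UNIV)" using b by (rule word_inv_lists)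
  have "word_less 0 (delta_shift ult (- k) g)
    (delta_shift ult (- k) (delta_shift ult k (hurwitz b [x])))"
    using gd off_g lt1 bd off by (intro word_less_delta_shift)
      (auto intro: delta_shift_reduced off_boundary_shift reduced_distinct_adj)
  then have "word_less 0 ?w (hurwitz (word_inv b)
    (delta_shift ult (- k) (delta_shift ult k (hurwitz b [x]))))"
    using gd bd by (intro word_less_hurwitz[OF wb]) (auto intro: delta_shift_reduced)
  then have 1: "word_less 0 ?w [x]"
    using bd delta_shift_add[of "hurwitz b [x]" ult "- k" k] hurwitz_word_inv_hurwitz[of "[x]" b]
      by (simp add: reduced_distinct_adj)
  have "word_less 0 (delta_shift ult (- k) (delta_shift ult k (hurwitz b [x])))
    (delta_shift ult (- k) (word_mult g (hurwitz b [x'])))"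
    unfolding gb using zb off_zb lt2 bd off
      by (intro word_less_delta_shift)
        (auto intro: delta_shift_reduced off_boundary_shift reduced_distinct_adj)
  then have "word_less 0 (hurwitz (word_inv b)
    (delta_shift ult (- k) (delta_shift ult k (hurwitz b [x]))))
      (hurwitz (word_inv b) (delta_shift ult (- k) (word_mult g (hurwitz b [x']))))"
    using gb zb bd by (intro word_less_hurwitz[OF wb]) (auto intro: delta_shift_reduced)
  then have 2: "word_less 0 [x] (word_mult ?w [x'])"
    using bd delta_shift_add[of "hurwitz b [x]" ult "- k" k] hurwitz_word_inv_hurwitz[of _ b]
    by (simp add: reduced_distinct_adj delta_shift_word_mult hurwitz_word_mult)
  have wd: "?w \<in> reduced ult" using hurwitz_reduced[OF wb] gd delta_shift_reduced by blast
  have "x = 1 \<and> x' = ult \<or> x = ult \<and> x' = 1" using x by (auto simp: doubleton_eq_iff)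
  \<comment> \<open>The unlinked arcs leave only a common end point, which would put g on the
    boundary line.\<close>
  then have "?w = []" using 1 2 wd unlinked_1 unlinked_N z1 by metis
  then have "hurwitz b ?w = []" by simp
  then have "delta_shift ult (- k) g = []"
    using hurwitz_hurwitz_word_inv[of "delta_shift ult (- k) g" b] gd
      by (simp add: reduced_distinct_adj distinct_adj_delta_shift)
  then have "off_boundary ult []" using off_boundary_shift[of g ult "- k"] off_g gd
    by (simp add: reduced_distinct_adj)
  then show False unfolding off_boundary_def using delta_shift_0 by metis
qed

text \<open>Undoing the first j powers reduces to the image of the complement of J under one
  \<open>fat_braid\<close>. A shift moves the other arc into the fundamental domain starting at
  [pen]; \<open>not_linked\<close> keeps it out of J, so it lies between \<open>lower_end\<close>
  and \<open>upper_end\<close>.\<close>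

lemma trapped_step:
  assumes b: "b \<in> lists ({1..pen} \<times> UNIV)" and x: "{x, x'} = {1, ult}"
    and tr: "trapped (Suc j) (hurwitz b [x])"
  shows "trapped j (hurwitz b [x'])"
proof -
  have z1: "ult > 1" by simp
  obtain k where k: "word_le (hurwitz (fat_power (Suc j)) lower_end)
    (delta_shift ult k (hurwitz b [x]))" "word_le (delta_shift ult k (hurwitz b [x]))
      (hurwitz (fat_power (Suc j)) upper_end)"
    using tr by (auto simp: trapped_def)
  define b' where "b' = word_inv (fat_power j) @ b"
  have wj: "word_inv (fat_power j) \<in> lists ({1..pen} \<times> UNIV)" using fat_power_lists
    by (rule word_inv_lists)
  have b': "b' \<in> lists ({1..pen} \<times> UNIV)" using wj b by (simp add: b'_def)
  have xd: "[x] \<in> reduced ult" "[x'] \<in> reduced ult" using x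
    by (auto simp: reduced_def doubleton_eq_iff)
  note bd = hurwitz_reduced[OF b xd(1)] hurwitz_reduced[OF b' xd(2)]
  have h': "hurwitz (word_inv (fat_power j)) (hurwitz (fat_power (Suc j)) w) = hurwitz fat_braid w"
    if "distinct_adj w" for w
    using hurwitz_word_inv_hurwitz[of "hurwitz fat_braid w" "fat_power j"] that
      by (simp add: fat_power_Suc hurwitz_append distinct_adj_hurwitz)
  have "word_le (hurwitz (word_inv (fat_power j)) (hurwitz (fat_power (Suc j)) lower_end))
    (hurwitz (word_inv (fat_power j)) (delta_shift ult k (hurwitz b [x])))"
    "word_le (hurwitz (word_inv (fat_power j)) (delta_shift ult k (hurwitz b [x])))
      (hurwitz (word_inv (fat_power j)) (hurwitz (fat_power (Suc j)) upper_end))"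
    using k bd ends_reduced by (auto intro!: word_le_hurwitz[OF wj] delta_shift_reduced
      hurwitz_reduced fat_power_lists)
  then have k': "word_le (ult # fat_rev @ [ult, pen, ult]) (delta_shift ult k (hurwitz b' [x]))"
    "word_le (delta_shift ult k (hurwitz b' [x])) (ult # pen # ult # fat_rev)"
    using hurwitz_delta_shift[OF wj]
      by (simp_all add: h' distinct_adj_ends hurwitz_fat_braid_lower_end hurwitz_fat_braid_upper_end
        b'_def hurwitz_append)
  have off: "off_boundary ult (hurwitz b' [x'])"
    using off_boundary_hurwitz[OF b'] off_boundary_single[OF z1] by auto
  then obtain i where i: "\<not> word_less 0 (delta_shift ult i (hurwitz b' [x'])) [pen]"
    "word_less 0 (delta_shift ult (i + 1) (hurwitz b' [x'])) [pen]"
    using delta_shift_fundamental[of "hurwitz b' [x']" ult pen] bd m by auto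
  have "\<not> word_less 0 (delta_shift ult i (hurwitz b' [x'])) lower_end"
    using not_linked[OF b' x k'] i(1) by blast
  then have 1: "word_le lower_end (delta_shift ult i (hurwitz b' [x']))"
    using word_less_total[of lower_end "delta_shift ult i (hurwitz b' [x'])" 0]
      reduced_pos_reduced[OF ends_reduced(1)]
        reduced_pos_reduced[OF delta_shift_reduced[OF bd(2)], of i]
    by (auto simp: word_le_def pos_reduced_def)
  have yd: "[pen] \<in> reduced ult" by (simp add: reduced_def)
  have "word_less 0 (delta_shift ult (- 1) (delta_shift ult (i + 1) (hurwitz b' [x'])))
    (delta_shift ult (- 1) [pen])"
    using i(2) bd off off_boundary_single[OF z1]
    by (intro word_less_delta_shift)
      (auto intro: delta_shift_reduced off_boundary_shift reduced_distinct_adj yd)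
  moreover have "delta_shift ult (- 1) [pen] = upper_end"
    using word_mult_eq_append[of "rev (delta ult)" "[pen]"] distinct_adj_ends
      by (simp add: delta_shift_minus_1 delta_ult(2) upper_end_def del: word_mult_Cons)
  ultimately have 2: "word_le (delta_shift ult i (hurwitz b' [x'])) upper_end"
    using delta_shift_add[of "hurwitz b' [x']" ult "- 1" "i + 1"] bd
      by (simp add: reduced_distinct_adj word_le_def)
  have "hurwitz (fat_power j) (delta_shift ult i (hurwitz b' [x'])) = delta_shift ult i
    (hurwitz b [x'])"
    using hurwitz_delta_shift[OF fat_power_lists]
      hurwitz_hurwitz_word_inv[of "hurwitz b [x']" "fat_power j"]
    by (simp add: b'_def hurwitz_append distinct_adj_hurwitz)
  then have "word_le (hurwitz (fat_power j) lower_end) (delta_shift ult i (hurwitz b [x']))"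
    "word_le (delta_shift ult i (hurwitz b [x'])) (hurwitz (fat_power j) upper_end)"
    using word_le_hurwitz[OF fat_power_lists _ _ 1, of j]
      word_le_hurwitz[OF fat_power_lists _ _ 2, of j] bd ends_reduced delta_shift_reduced by metis+
  then show ?thesis by (auto simp: trapped_def)
qed

text \<open>If c fixes \<open>ult\<close>, it is dropped after the step from 1 to
  \<open>ult\<close>; if it fixes 1, it is dropped before that step. The step back to 1 makes the
  cost the same in both cases.\<close>

lemma trapped_two:
  assumes b: "b \<in> lists ({1..pen} \<times> UNIV)" "c \<in> lists ({1..pen} \<times> UNIV)"
    and c: "hurwitz c [1] = [1] \<or> hurwitz c [ult] = [ult]"
    and tr: "trapped (Suc (Suc j)) (hurwitz (b @ c) [1])"
  shows "trapped j (hurwitz b [1])"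
proof -
  have bc: "b @ c \<in> lists ({1..pen} \<times> UNIV)" using b by simp
  have "trapped (Suc j) (hurwitz (b @ c) [ult])"
    using trapped_step[OF bc _ tr, of ult] by simp
  then have "trapped (Suc j) (hurwitz b [ult])"
  proof (cases "hurwitz c [ult] = [ult]")
    case False
    then show ?thesis using c tr trapped_step[OF b(1) _, of 1 ult "Suc j"]
      by (simp add: hurwitz_append)
  qed (simp add: hurwitz_append)
  then show ?thesis using trapped_step[OF b(1), of ult 1 j] by (simp add: insert_commute)
qed

lemma trapped_chain:
  assumes "\<And>c. c \<in> set cs \<Longrightarrow> c \<in> lists ({1..pen} \<times> UNIV) \<and>
    (hurwitz c [1] = [1] \<or> hurwitz c [ult] = [ult])"
    and "trapped (j + 2 * length cs) (hurwitz (concat cs) [1])"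
  shows "trapped j [1]"
  using assms
proof (induction cs rule: rev_induct)
  case (snoc c cs)
  have "concat cs \<in> lists ({1..pen} \<times> UNIV)" using snoc.prems(1) by fastforce
  then have "trapped (j + 2 * length cs) (hurwitz (concat cs) [1])"
    using trapped_two[of "concat cs" c "j + 2 * length cs"] snoc.prems by simp
  then show ?case using snoc by simp
qed simp

text \<open>For k >= 0 the shifts of [1] start with 1 and lie below the trapping interval. For k < 0
  they start with \<open>ult\<close>, \<open>pen\<close>, m and lie above it; m >= 2 ensures that m
  survives when the last letter 1 cancels at k = -1.\<close>

lemma not_trapped_1: "\<not> trapped 1 [1]"
proof
  have z1: "ult > 1" by simp
  assume "trapped 1 [1]"
  then obtain k where k: "word_le (ult # fat_rev @ [ult, pen, ult]) (delta_shift ult k [1])"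
    "word_le (delta_shift ult k [1]) (ult # pen # ult # fat_rev)"
    by (auto simp: trapped_def fat_power_def hurwitz_fat_braid_lower_end
      hurwitz_fat_braid_upper_end)
  have fat_conj: "delta_shift ult k [1] = word_mult (delta_shift ult k []) [1]"
    using delta_shift_word_mult[of "[1]" ult k "[]"] by simp
  have d: "distinct_adj (delta_shift ult k [])" by (simp add: distinct_adj_delta_shift)
  consider "k = 0" | t where "delta_shift ult k [] = delta ult @ t" | t where
    "delta_shift ult k [] = rev (delta ult) @ t"
    using delta_shift_Nil_pos[OF z1, of k] delta_shift_Nil_neg[OF z1, of k]
      by (cases k "0 :: int" rule: linorder_cases) auto
  then show False
  proof cases
    case 1
    then show False using k(1) by (auto simp: word_le_def cyc_less_def)
  next
    case 2
    then obtain t' where "delta_shift ult k [] = 1 # 2 # t'" by (metis delta_Cons append_Cons)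
    then have "\<exists>s. delta_shift ult k [1] = 1 # s" using fat_conj d word_mult_single[OF d, of 1]
      by (cases t') auto
    then show False using k(1) by (auto simp: word_le_def cyc_less_def)
  next
    case 3
    obtain V where "fat_rev = m # V" by (rule fat_rev_Cons)
    then have "delta_shift ult k [] = ult # pen # m # V @ t" using 3 by (simp add: delta_ult(2))
    then have "\<exists>s. delta_shift ult k [1] = ult # pen # m # s"
      using fat_conj m word_mult_single[OF d, of 1] by auto
    then show False using k(2) by (auto simp: word_le_def cyc_less_def)
  qed
qed

text \<open>The conjugate by a power of delta anticipates a central factor in a product. Before h is
  applied, shifting by l - 1 turns it into \<open>ult\<close>, \<open>pen\<close>, m, ..., 2
  followed by the l-th power of delta, which lies between \<open>lower_end\<close> and
  \<open>upper_end\<close> for every l.\<close>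

lemma trapped_start:
  "trapped j (hurwitz (fat_power j) (delta_shift ult (- l) (word_mult [1] (delta_shift ult l []))))"
proof -
  have z1: "ult > 1" by simp
  obtain W where W: "fat_rev = W @ [1]" using fat_rev_facts by (metis append_butlast_last_id)
  have W2: "W \<noteq> []" "last W = 2" "distinct_adj W"
  proof -
    obtain k where "m = Suc k" "k > 0" using m by (cases m) auto
    then have "delta m = 1 # [2..<Suc m]"
      by (simp add: delta_def upt_conv_Cons numeral_2_eq_2 del: upt_Suc)
    then have "W = rev [2..<Suc m]" using W by (simp add: fat_rev_def)
    then show "W \<noteq> []" "last W = 2" "distinct_adj W"
      using m by (simp_all add: last_rev distinct_adj_upt del: upt_Suc)
  qed
  let ?r = "delta_shift ult l []"
  have r: "?r = [] \<or> (\<exists>t. ?r = 1 # 2 # t) \<or> (\<exists>t. ?r = ult # t)"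
  proof -
    consider "l = 0" | t where "delta_shift ult l [] = delta ult @ t" | t where
      "delta_shift ult l [] = rev (delta ult) @ t"
      using delta_shift_Nil_pos[OF z1, of l] delta_shift_Nil_neg[OF z1, of l]
        by (cases l "0 :: int" rule: linorder_cases) auto
    then show ?thesis
    proof cases
      case 2
      then show ?thesis by (metis delta_Cons append_Cons)
    next
      case 3
      then show ?thesis by (auto simp only: delta_ult(2) append_Cons)
    qed simp
  qed
  have d: "distinct_adj ?r" by (simp add: distinct_adj_delta_shift)
  have dd: "distinct_adj (ult # pen # W @ ?r)"
    using distinct_adj_ends(2) d W2 r
      by (auto simp: upper_end_def W distinct_adj_append_iff distinct_adj_Cons)
  have eq: "delta_shift ult (- 1) (word_mult [1] ?r) = ult # pen # W @ ?r"
  proof -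
    have "delta_shift ult (- 1) (word_mult [1] ?r) = word_mult ((ult # pen # W) @ [1])
      (word_mult [1] ?r)"
      by (simp add: delta_shift_minus_1 delta_ult(2) W del: word_mult_Cons)
    also have "\<dots> = word_mult (ult # pen # W) ?r"
      using word_mult_rev_word_mult[OF d, of "[1]"]
        by (simp only: word_mult_append rev.simps append_Nil)
    finally show ?thesis using dd word_mult_eq_append[of "ult # pen # W" ?r] by simp
  qed
  have "word_less 0 (ult # pen # W @ ?r) upper_end"
  proof -
    \<comment> \<open>After 2 the item 1 comes last, so only a power starting with 1 2 needs a
      second letter, and there 2 < \<open>pen\<close>.\<close>
    have "word_less 2 ?r [1, pen]" using r m by (auto simp: cyc_less_def)
    moreover have "ult # pen # W @ ?r = (ult # pen # butlast W) @ 2 # ?r"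
      "upper_end = (ult # pen # butlast W) @ 2 # [1, pen]"
      using W2 append_butlast_last_id[of W] by (auto simp: upper_end_def W)
    ultimately show ?thesis by (simp only: word_less_append)
  qed
  then have 1: "word_le (delta_shift ult (- 1) (word_mult [1] ?r)) upper_end" unfolding eq
    by (simp add: word_le_def)
  have 2: "word_le lower_end (delta_shift ult (- 1) (word_mult [1] ?r))" unfolding eq
    by (simp add: word_le_def lower_end_def cyc_less_def)
  have ad: "delta_shift ult (- 1) (word_mult [1] ?r) \<in> reduced ult"
    by (intro delta_shift_reduced word_mult_reduced) (auto simp: reduced_def)
  have "delta_shift ult (l - 1) (delta_shift ult (- l) (word_mult [1] ?r)) = delta_shift ult (- 1)
    (word_mult [1] ?r)"
    using delta_shift_add[of "word_mult [1] ?r" ult "l - 1" "- l"]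
      distinct_adj_word_mult[OF d, of "[1]"] by (simp del: word_mult_Cons)
  then have "delta_shift ult (l - 1)
    (hurwitz (fat_power j) (delta_shift ult (- l) (word_mult [1] ?r))) = hurwitz (fat_power j)
      (delta_shift ult (- 1) (word_mult [1] ?r))"
    using hurwitz_delta_shift[OF fat_power_lists, of j "l - 1"
      "delta_shift ult (- l) (word_mult [1] ?r)"] by simp
  then show ?thesis unfolding trapped_def
    using word_le_hurwitz[OF fat_power_lists ends_reduced(1) ad 2]
      word_le_hurwitz[OF fat_power_lists ad ends_reduced(2) 1] by metis
qed

text \<open>Two levels are spent per factor; the one extra power leaves level 1, where [1] is not
  trapped.\<close>

lemma fat_power_not_short:
  assumes "\<And>c. c \<in> set cs \<Longrightarrow> c \<in> lists ({1..pen} \<times> UNIV) \<and>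
    (hurwitz c [1] = [1] \<or> hurwitz c [ult] = [ult])"
  shows "hurwitz (concat cs) [1] \<noteq> hurwitz (fat_power (Suc (2 * length cs)))
    (delta_shift ult (- l) (word_mult [1] (delta_shift ult l [])))"
proof
  assume *: "hurwitz (concat cs) [1] = hurwitz (fat_power (Suc (2 * length cs)))
    (delta_shift ult (- l) (word_mult [1] (delta_shift ult l [])))"
  have "trapped (1 + 2 * length cs) (hurwitz (concat cs) [1])"
    unfolding * using trapped_start[of "Suc (2 * length cs)" l] by (simp del: word_mult_Cons)
  then show False using trapped_chain[of cs 1] assms not_trapped_1 by blast
qed

end

section \<open>The full twist and the centralizer of the fat braid\<close>

abbreviation braid_words :: "nat \<Rightarrow> nat word set" where
  "braid_words n \<equiv> lists ({1..n} \<times> UNIV)"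

abbreviation braid_eq :: "nat \<Rightarrow> nat word \<Rightarrow> nat word \<Rightarrow> bool" where
  "braid_eq n \<equiv> pres_eq {1..n} (braid_rels n)"

lemma braid_eq_wordsD: "braid_eq n u v \<Longrightarrow> u \<in> braid_words n" "braid_eq n u v \<Longrightarrow> v \<in> braid_words n"
  using pres_eq_lists by blast+

lemma braid_eq_ctx:
  assumes "braid_eq n u v" "a \<in> braid_words n" "b \<in> braid_words n"
  shows "braid_eq n (a @ u @ b) (a @ v @ b)"
  by (intro pres_eq.append assms pres_eq.refl)

lemma braid_eq_pre: "braid_eq n u v \<Longrightarrow> a \<in> braid_words n \<Longrightarrow> braid_eq n (a @ u) (a @ v)"
  and braid_eq_post: "braid_eq n u v \<Longrightarrow> a \<in> braid_words n \<Longrightarrow> braid_eq n (u @ a) (v @ a)"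
  by (intro pres_eq.append pres_eq.refl; assumption)+

lemma braid_eq_far:
  assumes "i \<in> {1..n}" "j \<in> {1..n}" "\<bar>int i - int j\<bar> \<ge> 2"
  shows "braid_eq n [(i, True), (j, True)] [(j, True), (i, True)]"
  using assms by (intro pres_eq.rel) (auto simp: braid_rels_def)

lemma braid_eq_rel:
  assumes "i \<in> {1..n}" "Suc i \<in> {1..n}"
  shows "braid_eq n [(i, True), (Suc i, True), (i, True)] [(Suc i, True), (i, True), (Suc i, True)]"
  using assms by (intro pres_eq.rel) (auto simp: braid_rels_def)

lemma braid_eq_rev: "braid_eq n u v \<Longrightarrow> braid_eq n (rev u) (rev v)"
proof (induction rule: pres_eq.induct)
  case (refl w)
  then show ?case by (intro pres_eq.refl) auto
next
  case (append u u' v v')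
  then show ?case by (simp add: pres_eq.append)
next
  case (cancel s e)
  then show ?case using pres_eq.cancel[of s "{1..n}" "braid_rels n" "\<not> e"] by simp
next
  case (rel u v)
  have "(rev u, rev v) \<in> braid_rels n"
    using rel(1) by (auto simp: braid_rels_def)
  then show ?case using rel by (intro pres_eq.rel) auto
qed (auto intro: pres_eq.sym pres_eq.trans)

lemma braid_eq_far_word:
  assumes "j \<in> {1..n}" "w \<in> braid_words n" "\<And>i e. (i, e) \<in> set w \<Longrightarrow> e \<and> \<bar>int i - int j\<bar> \<ge> 2"
  shows "braid_eq n ([(j, True)] @ w) (w @ [(j, True)])"
  using assms(2,3)
proof (induction w rule: list.induct)
  case Nil
  then show ?case using assms by (auto intro: pres_eq.refl)
next
  case (Cons l w)
  obtain i where l: "l = (i, True)" using Cons.prems(2)[of "fst l" "snd l"] by (cases l) auto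
  have i: "i \<in> {1..n}" "\<bar>int j - int i\<bar> \<ge> 2" and w: "w \<in> braid_words n"
    using Cons.prems(2)[of i True] Cons.prems(1) l by auto
  have "braid_eq n ([(j, True), (i, True)] @ w) ([(i, True), (j, True)] @ w)"
    by (intro braid_eq_post braid_eq_far assms w i)
  moreover have "braid_eq n ([(i, True)] @ [(j, True)] @ w) ([(i, True)] @ w @ [(j, True)])"
    using Cons.IH Cons.prems w i by (intro braid_eq_pre) auto
  ultimately show ?case using pres_eq.trans by (fastforce simp: l)
qed

lemma cycle_word_braid_words: "k \<le> n \<Longrightarrow> cycle_word k \<in> braid_words n"
  by (auto simp: cycle_word_def)

text \<open>The braid relation is used only when i is next to the last letter; otherwise s_i
  commutes with the last letter and the shorter cycle applies.\<close>

lemma braid_eq_cycle_word: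
  assumes "1 \<le> i" "i < k" "k \<le> n"
  shows "braid_eq n (cycle_word k @ [(i, True)]) ([(Suc i, True)] @ cycle_word k)"
  using assms
proof (induction k)
  case (Suc k)
  show ?case
  proof (cases "i = k")
    case False
    have "braid_eq n (cycle_word k @ [(Suc k, True), (i, True)])
      (cycle_word k @ [(i, True), (Suc k, True)])"
      using Suc.prems False by (intro braid_eq_pre braid_eq_far cycle_word_braid_words) auto
    moreover have "braid_eq n ((cycle_word k @ [(i, True)]) @ [(Suc k, True)])
      (([(Suc i, True)] @ cycle_word k) @ [(Suc k, True)])"
      using Suc False by (intro braid_eq_post) auto
    ultimately show ?thesis using pres_eq.trans by (fastforce simp: cycle_word_Suc)
  next
    case True
    then obtain j where k: "k = Suc j" using Suc.prems by (cases k) auto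
    have "braid_eq n (cycle_word j @ [(k, True), (Suc k, True), (k, True)])
      (cycle_word j @ [(Suc k, True), (k, True), (Suc k, True)])"
      using Suc.prems True k by (intro braid_eq_pre braid_eq_rel cycle_word_braid_words) auto
    moreover have "braid_eq n ((cycle_word j @ [(Suc k, True)]) @ [(k, True), (Suc k, True)])
        (([(Suc k, True)] @ cycle_word j) @ [(k, True), (Suc k, True)])"
      using Suc.prems True k
      by (intro braid_eq_post pres_eq.sym[OF braid_eq_far_word] cycle_word_braid_words)
        (auto simp: cycle_word_def)
    ultimately show ?thesis using pres_eq.trans True by (fastforce simp: cycle_word_Suc k)
  qed
qed simp

lemma braid_eq_rev_cycle_word:
  assumes "1 \<le> i" "i < k" "k \<le> n"
  shows "braid_eq n (rev (cycle_word k) @ [(Suc i, True)]) ([(i, True)] @ rev (cycle_word k))"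
  using braid_eq_rev[OF pres_eq.sym[OF braid_eq_cycle_word[OF assms]]] by simp

lemma braid_eq_comm_inverse:
  assumes "braid_eq n ([(a, True)] @ w) (w @ [(a, True)])"
  shows "braid_eq n ([(a, False)] @ w) (w @ [(a, False)])"
proof -
  have aw: "a \<in> {1..n}" "w \<in> braid_words n" using braid_eq_wordsD[OF assms] by auto
  have c: "braid_eq n [(a, True), (a, False)] []" "braid_eq n [(a, False), (a, True)] []"
    using pres_eq.cancel[OF aw(1), of "braid_rels n"] by (metis (full_types))+
  have 1: "braid_eq n (([(a, False)] @ w) @ []) (([(a, False)] @ w) @ [(a, True), (a, False)])"
    using aw by (intro braid_eq_pre pres_eq.sym[OF c(1)]) auto
  have 2: "braid_eq n ([(a, False)] @ (w @ [(a, True)]) @ [(a, False)])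
    ([(a, False)] @ ([(a, True)] @ w) @ [(a, False)])"
    using aw by (intro braid_eq_ctx pres_eq.sym[OF assms]) auto
  have 3: "braid_eq n ([(a, False), (a, True)] @ w @ [(a, False)]) ([] @ w @ [(a, False)])"
    using aw by (intro braid_eq_post c(2)) auto
  show ?thesis using pres_eq.trans[OF 1 pres_eq.trans[OF _ 3]] 2 by simp
qed

section \<open>The half twist and centrality of its square\<close>

definition garside_word :: "nat \<Rightarrow> nat word" where
  "garside_word k = concat (map cycle_word (rev [1..<Suc k]))"

lemma garside_word_Suc: "garside_word (Suc k) = cycle_word (Suc k) @ garside_word k"
  by (simp add: garside_word_def)

lemma garside_eq: "garside n = braid_class n (garside_word n)"
  by (simp add: garside_def garside_word_def cycle_word_def[abs_def])

lemma garside_word_set: "set (garside_word k) \<subseteq> {1..k} \<times> {True}"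
  by (auto simp: garside_word_def cycle_word_def)

lemma garside_word_braid_words: "k \<le> n \<Longrightarrow> garside_word k \<in> braid_words n"
  using garside_word_set[of k] by (auto simp: lists_eq_set)

text \<open>A second recursion with the new factor on the right. It gives access to the last
  generator, which the recursion on the left does not reach.\<close>

lemma braid_eq_garside_word_Suc:
  "Suc k \<le> n \<Longrightarrow> braid_eq n (garside_word (Suc k)) (garside_word k @ rev (cycle_word (Suc k)))"
proof (induction k)
  case 0
  then show ?case by (auto simp: garside_word_def cycle_word_def intro!: pres_eq.refl)
next
  case (Suc k)
  let ?k = "Suc k" and ?s = "[(Suc (Suc k), True)]"
  have w: "cycle_word ?k \<in> braid_words n" "garside_word k \<in> braid_words n" "?s \<in> braid_words n"
    using Suc.prems cycle_word_braid_words[of ?k n] garside_word_braid_words[of k n] by auto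
  have "braid_eq n ((cycle_word ?k @ ?s) @ garside_word ?k)
    ((cycle_word ?k @ ?s) @ garside_word k @ rev (cycle_word ?k))"
    using w Suc by (intro braid_eq_pre) auto
  moreover have "braid_eq n (cycle_word ?k @ (?s @ garside_word k) @ rev (cycle_word ?k))
    (cycle_word ?k @ (garside_word k @ ?s) @ rev (cycle_word ?k))"
    using w Suc.prems garside_word_set[of k] by (intro braid_eq_ctx braid_eq_far_word) fastforce+
  ultimately show ?case using pres_eq.trans by (fastforce simp: cycle_word_Suc garside_word_Suc)
qed

lemma braid_eq_garside_word:
  "1 \<le> i \<Longrightarrow> i \<le> k \<Longrightarrow> k \<le> n \<Longrightarrow> braid_eq n (garside_word k @ [(i, True)])
    ([(Suc k - i, True)] @ garside_word k)"
proof (induction k arbitrary: i)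
  case (Suc k)
  have w: "cycle_word (Suc k) \<in> braid_words n" "garside_word k \<in> braid_words n"
    "rev (cycle_word (Suc k)) \<in> braid_words n" "[(i, True)] \<in> braid_words n"
    using Suc.prems cycle_word_braid_words[of "Suc k" n] garside_word_braid_words[of k n] by auto
  show ?case
  proof (cases "i \<le> k")
    case True
    have "braid_eq n (cycle_word (Suc k) @ garside_word k @ [(i, True)])
      (cycle_word (Suc k) @ [(Suc k - i, True)] @ garside_word k)"
      using Suc True w by (intro braid_eq_pre) auto
    moreover have "braid_eq n ((cycle_word (Suc k) @ [(Suc k - i, True)]) @ garside_word k)
      (([(Suc (Suc k - i), True)] @ cycle_word (Suc k)) @ garside_word k)"
      using Suc.prems True w by (intro braid_eq_post braid_eq_cycle_word) auto
    ultimately show ?thesis using pres_eq.trans True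
      by (fastforce simp: garside_word_Suc Suc_diff_le)
  next
    case False
    then have i: "i = Suc k" using Suc.prems by simp
    show ?thesis
    proof (cases k)
      case 0
      then show ?thesis using i Suc.prems
        by (auto simp: garside_word_def cycle_word_def intro!: pres_eq.refl)
    next
      case (Suc j)
      have g: "braid_eq n (garside_word (Suc k)) (garside_word k @ rev (cycle_word (Suc k)))"
        using Suc.prems by (intro braid_eq_garside_word_Suc) auto
      have "braid_eq n (garside_word (Suc k) @ [(i, True)])
        ((garside_word k @ rev (cycle_word (Suc k))) @ [(i, True)])"
        using g w by (intro braid_eq_post)
      moreover have "braid_eq n (garside_word k @ rev (cycle_word (Suc k)) @ [(Suc k, True)])
        (garside_word k @ [(k, True)] @ rev (cycle_word (Suc k)))"
        using w Suc Suc.prems by (intro braid_eq_pre braid_eq_rev_cycle_word) auto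
      moreover have "braid_eq n ((garside_word k @ [(k, True)]) @ rev (cycle_word (Suc k)))
        (([(1, True)] @ garside_word k) @ rev (cycle_word (Suc k)))"
        using w Suc Suc.prems Suc.IH[of k] by (intro braid_eq_post) auto
      moreover have "braid_eq n ([(1, True)] @ garside_word k @ rev (cycle_word (Suc k)))
        ([(1, True)] @ garside_word (Suc k))"
        using Suc.prems by (intro braid_eq_pre pres_eq.sym[OF g]) auto
      ultimately show ?thesis using i by (simp) (meson pres_eq.trans)
    qed
  qed
qed simp

definition full_twist :: "nat \<Rightarrow> nat word" where
  "full_twist n = garside_word n @ garside_word n"

lemma full_twist_braid_words: "full_twist n \<in> braid_words n"
  using garside_word_braid_words[of n n] by (simp add: full_twist_def)

lemma braid_eq_comm_braid_words:
  assumes "a \<in> braid_words n" "T \<subseteq> {1..n}" "w \<in> lists (T \<times> UNIV)"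
    and "\<And>j. j \<in> T \<Longrightarrow> braid_eq n ([(j, True)] @ a) (a @ [(j, True)])"
  shows "braid_eq n (w @ a) (a @ w)"
  using assms(3)
proof (induction w rule: list.induct)
  case Nil
  then show ?case using assms(1) by (simp add: pres_eq.refl)
next
  case (Cons l w)
  obtain i e where l: "l = (i, e)" by fastforce
  have i: "i \<in> T" "i \<in> {1..n}" and w: "w \<in> lists (T \<times> UNIV)" "w \<in> braid_words n"
    using Cons.prems l assms(2) by auto
  have "braid_eq n ([(i, e)] @ a) (a @ [(i, e)])"
    using assms(4)[OF i(1)] braid_eq_comm_inverse by (cases e) auto
  then have "braid_eq n (([(i, e)] @ a) @ w) ((a @ [(i, e)]) @ w)"
    using w by (intro braid_eq_post)
  moreover have "braid_eq n ([(i, e)] @ w @ a) ([(i, e)] @ a @ w)"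
    using Cons.IH w i by (intro braid_eq_pre) auto
  ultimately show ?case using pres_eq.trans l by fastforce
qed

lemma braid_eq_full_twist:
  assumes "w \<in> braid_words n"
  shows "braid_eq n (w @ full_twist n) (full_twist n @ w)"
proof (rule braid_eq_comm_braid_words[OF full_twist_braid_words order_refl assms])
  fix i assume i: "i \<in> {1..n}"
  have g: "garside_word n \<in> braid_words n" by (rule garside_word_braid_words) simp
  have "braid_eq n (garside_word n @ garside_word n @ [(i, True)])
    (garside_word n @ [(Suc n - i, True)] @ garside_word n)"
    using i g by (intro braid_eq_pre braid_eq_garside_word) auto
  moreover have "braid_eq n ((garside_word n @ [(Suc n - i, True)]) @ garside_word n)
    (([(Suc n - (Suc n - i), True)] @ garside_word n) @ garside_word n)"
    using i g by (intro braid_eq_post braid_eq_garside_word) auto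
  moreover have "Suc n - (Suc n - i) = i" using i by auto
  ultimately show "braid_eq n ([(i, True)] @ full_twist n) (full_twist n @ [(i, True)])"
    using pres_eq.trans pres_eq.sym by (fastforce simp: full_twist_def)
qed

text \<open>For j < m the generator s_j commutes with the last one, turns into s_{j+1} on crossing
  the reversed cycle, and back into s_j on crossing the cycle.\<close>

lemma braid_eq_fat_braid:
  assumes "m \<ge> 2" "w \<in> lists ({1..m - 1} \<times> UNIV)"
  shows "braid_eq (Suc m) (w @ fat_braid m) (fat_braid m @ w)"
proof (rule braid_eq_comm_braid_words[OF _ _ assms(2)])
  let ?n = "Suc m" and ?C = "cycle_word m"
  have C: "?C \<in> braid_words ?n" "rev ?C \<in> braid_words ?n" using cycle_word_braid_words[of m ?n]
    by auto
  show "fat_braid m \<in> braid_words ?n" using fat_braid_lists[OF assms(1)] by simp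
  show "{1..m - 1} \<subseteq> {1..?n}" by auto
  fix j assume j: "j \<in> {1..m - 1}"
  let ?j = "[(j, True)]"
  have jw: "?j \<in> braid_words ?n" "[(Suc j, True)] \<in> braid_words ?n" "[(?n, False)] \<in> braid_words ?n"
    using j by auto
  have "braid_eq ?n ([(?n, True)] @ ?j) (?j @ [(?n, True)])"
    using j braid_eq_far[of ?n ?n j] by auto
  then have 1: "braid_eq ?n ((?j @ [(?n, False)]) @ rev ?C @ ?C)
    (([(?n, False)] @ ?j) @ rev ?C @ ?C)"
    using C by (intro braid_eq_post pres_eq.sym[OF braid_eq_comm_inverse]) auto
  have 2: "braid_eq ?n ([(?n, False)] @ (?j @ rev ?C) @ ?C)
    ([(?n, False)] @ (rev ?C @ [(Suc j, True)]) @ ?C)"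
    using j C jw by (intro braid_eq_ctx pres_eq.sym[OF braid_eq_rev_cycle_word]) auto
  have 3: "braid_eq ?n (([(?n, False)] @ rev ?C) @ [(Suc j, True)] @ ?C)
    (([(?n, False)] @ rev ?C) @ ?C @ ?j)"
    using j C jw by (intro braid_eq_pre pres_eq.sym[OF braid_eq_cycle_word]) auto
  show "braid_eq ?n (?j @ fat_braid m) (fat_braid m @ ?j)"
    using pres_eq.trans[OF 1] pres_eq.trans[OF 2] 3 assms(1) by (simp add: fat_braid_def)
qed

lemma braid_eq_fat_power:
  assumes "m \<ge> 2" "w \<in> lists ({1..m - 1} \<times> UNIV)"
  shows "braid_eq (Suc m) (w @ fat_power m k) (fat_power m k @ w)"
proof (induction k)
  case 0
  then show ?case using braid_eq_wordsD(1)[OF braid_eq_fat_braid[OF assms]] assms(1)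
    by (simp add: fat_power_def pres_eq.refl)
next
  case (Suc k)
  note d = fat_braid_lists[OF assms(1)] fat_power_lists[OF assms(1), of k]
  have "braid_eq (Suc m) ((w @ fat_power m k) @ fat_braid m) ((fat_power m k @ w) @ fat_braid m)"
    using Suc d by (intro braid_eq_post) auto
  moreover have "braid_eq (Suc m) (fat_power m k @ w @ fat_braid m)
    (fat_power m k @ fat_braid m @ w)"
    using d by (intro braid_eq_pre braid_eq_fat_braid assms) auto
  ultimately show ?case using pres_eq.trans by (fastforce simp: fat_power_Suc[OF assms(1)])
qed

section \<open>Word length with respect to \<open>X_P\<close>\<close>

lemma hurwitz_garside_word_fix: "x > Suc k \<Longrightarrow> hurwitz (garside_word k) [x] = [x]"
proof (induction k)
  case (Suc k)
  then show ?case using hurwitz_cycle_word(3)[of "Suc k" x]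
    by (simp add: garside_word_Suc hurwitz_append)
qed (simp add: garside_word_def)

lemma hurwitz_garside_word_last: "hurwitz (garside_word k) [Suc k] = [1]"
  using hurwitz_garside_word_fix[of "k - 1" "Suc k"] hurwitz_cycle_word(2)[of k]
  by (cases k) (auto simp: garside_word_Suc hurwitz_append garside_word_def)

text \<open>The first half twist sends 1 to the last letter conjugated by delta; the second fixes
  delta and sends the last letter to 1.\<close>

lemma hurwitz_full_twist:
  assumes "n > 0"
  shows "hurwitz (full_twist n) [1] = word_mult (delta (Suc n))
    (word_mult [1] (rev (delta (Suc n))))"
proof -
  obtain k where n: "n = Suc k" using assms by (cases n) auto
  let ?d = "delta (Suc n)"
  define X where "X = word_mult ?d (word_mult [Suc n] (rev ?d))"
  have g: "garside_word k \<in> braid_words n" "garside_word n \<in> braid_words n"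
    using n garside_word_braid_words by auto
  have "X = delta n @ Suc n # rev (delta n)"
  proof -
    have d: "distinct_adj (delta n @ Suc n # rev (delta n))" "distinct_adj (Suc n # rev (delta n))"
      using assms by (auto simp: distinct_adj_append_iff distinct_adj_Cons)
    have "word_mult [Suc n] (rev ?d) = rev (delta n)" by (simp add: delta_Suc)
    moreover have "word_mult ?d (rev (delta n)) = word_mult (delta n) (Suc n # rev (delta n))"
      using letter_mult_Cons[OF d(2)] by (simp add: delta_Suc[of n] word_mult_append)
    ultimately show ?thesis unfolding X_def using word_mult_eq_append[OF d(1)] by metis
  qed
  then have "hurwitz (garside_word n) [1] = hurwitz (garside_word k) X"
    using hurwitz_cong[OF braid_eq_garside_word_Suc[of k n], of "[1]"]
      hurwitz_rev_cycle_word(1)[of n] n by (simp add: hurwitz_append)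
  also have "\<dots> = X"
    unfolding X_def hurwitz_word_mult hurwitz_delta[OF g(1)] hurwitz_rev_delta[OF g(1)]
      using n hurwitz_garside_word_fix[of k "Suc n"] by simp
  finally have "hurwitz (full_twist n) [1] = hurwitz (garside_word n) X"
    by (simp add: full_twist_def hurwitz_append)
  also have "\<dots> = word_mult ?d (word_mult [1] (rev ?d))"
    unfolding X_def hurwitz_word_mult hurwitz_delta[OF g(2)] hurwitz_rev_delta[OF g(2)]
      hurwitz_garside_word_last ..
  finally show ?thesis .
qed

lemma word_mult_delta_shift_Nil:
  "distinct_adj w \<Longrightarrow> word_mult (delta_shift N k []) w = delta_shift N k w"
  using delta_shift_word_mult[of w N k "[]"] by simp

lemma braid_eq_word_inv:
  assumes "t \<in> braid_words n"
  shows "braid_eq n (word_inv t @ t) []" "braid_eq n (t @ word_inv t) []"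
  using pres_eq_inverse[OF assms] pres_eq_inverse[OF word_inv_lists[OF assms]]
    word_inv_word_inv[of t]
  by (auto simp: word_inv_def[symmetric])

text \<open>Stands in for the powers of the full twist: centrality lets them be collected, and their
  effect on the letter 1 is conjugation by a power of delta. Both properties pass to products and
  inverses.\<close>

definition central_twist :: "nat \<Rightarrow> nat word \<Rightarrow> bool" where
  "central_twist n t \<longleftrightarrow> t \<in> braid_words n \<and> (\<forall>w\<in>braid_words n. braid_eq n (w @ t) (t @ w)) \<and>
     (\<exists>l. hurwitz t [1] = delta_shift (Suc n) l (word_mult [1] (delta_shift (Suc n) (- l) [])))"

lemma central_twist_braid_words: "central_twist n t \<Longrightarrow> t \<in> braid_words n"
  by (simp add: central_twist_def)

lemma central_twist_Nil: "central_twist n []"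
  unfolding central_twist_def by (auto intro!: exI[of _ 0] pres_eq.refl)

lemma central_twist_full_twist: "n > 0 \<Longrightarrow> central_twist n (full_twist n)"
  unfolding central_twist_def using full_twist_braid_words braid_eq_full_twist
    hurwitz_full_twist[of n]
  by (auto intro!: exI[of _ 1] simp: delta_shift_1 delta_shift_minus_1 word_mult_Nil_right)

text \<open>As t fixes delta, the exponents of successive conjugations add up.\<close>

lemma hurwitz_conj_aux:
  assumes "hurwitz t [1] = delta_shift (Suc n) l (word_mult [1] (delta_shift (Suc n) (- l) []))"
    "t \<in> braid_words n"
  shows "hurwitz t (delta_shift (Suc n) k (word_mult [1] (delta_shift (Suc n) (- k) []))) =
    delta_shift (Suc n) (k + l) (word_mult [1] (delta_shift (Suc n) (- (k + l)) []))"
proof -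
  have d: "distinct_adj (delta_shift (Suc n) j [])" for j by (simp add: distinct_adj_delta_shift)
  have "hurwitz t (delta_shift (Suc n) k (word_mult [1] (delta_shift (Suc n) (- k) []))) =
      delta_shift (Suc n) k (word_mult (hurwitz t [1]) (delta_shift (Suc n) (- k) []))"
    using assms(2) by (simp only: hurwitz_delta_shift hurwitz_word_mult hurwitz_empty)
  also have "\<dots> = delta_shift (Suc n) k
    (delta_shift (Suc n) l (word_mult [1]
      (word_mult (delta_shift (Suc n) (- l) []) (delta_shift (Suc n) (- k) []))))"
    unfolding assms(1) using d by (simp only: delta_shift_word_mult[symmetric] word_mult_assoc)
  also have "\<dots> = delta_shift (Suc n) (k + l) (word_mult [1] (delta_shift (Suc n) (- l + - k) []))"
    by (simp only: word_mult_delta_shift_Nil delta_shift_add distinct_adj_Nil distinct_adj_word_mult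
      distinct_adj_delta_shift)
  finally show ?thesis by (simp add: algebra_simps)
qed

lemma central_twist_append: "central_twist n s \<Longrightarrow> central_twist n t \<Longrightarrow> central_twist n (s @ t)"
proof -
  assume st: "central_twist n s" "central_twist n t"
  then have w: "s \<in> braid_words n" "t \<in> braid_words n" by (auto simp: central_twist_def)
  have "braid_eq n (w @ s @ t) ((s @ t) @ w)" if ww: "w \<in> braid_words n" for w
  proof -
    have "braid_eq n ((w @ s) @ t) ((s @ w) @ t)" using st ww w
      by (intro braid_eq_post) (auto simp: central_twist_def)
    moreover have "braid_eq n (s @ w @ t) (s @ t @ w)" using st ww w
      by (intro braid_eq_pre) (auto simp: central_twist_def)
    ultimately show ?thesis using pres_eq.trans by fastforce
  qed
  moreover obtain k l where "hurwitz s [1] = delta_shift (Suc n) k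
    (word_mult [1] (delta_shift (Suc n) (- k) []))"
    "hurwitz t [1] = delta_shift (Suc n) l (word_mult [1] (delta_shift (Suc n) (- l) []))" using st
      by (auto simp: central_twist_def)
  then have "hurwitz (s @ t) [1] = delta_shift (Suc n) (l + k)
    (word_mult [1] (delta_shift (Suc n) (- (l + k)) []))"
    using hurwitz_conj_aux w by (simp only: hurwitz_append)
  moreover have "s @ t \<in> braid_words n" using w by simp
  ultimately show ?thesis unfolding central_twist_def by blast
qed

lemma hurwitz_word_inv_central_twist:
  assumes "t \<in> braid_words n"
    "hurwitz t [1] = delta_shift (Suc n) l (word_mult [1] (delta_shift (Suc n) (- l) []))"
  shows "hurwitz (word_inv t) [1] = delta_shift (Suc n) (- l)
    (word_mult [1] (delta_shift (Suc n) l []))"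
proof -
  let ?v = "delta_shift (Suc n) (- l) (word_mult [1] (delta_shift (Suc n) l []))"
  have "hurwitz t ?v = [1]" using hurwitz_conj_aux[OF assms(2,1), of "- l"] by simp
  moreover have "distinct_adj ?v" by (intro distinct_adj_delta_shift distinct_adj_word_mult) simp
  ultimately show ?thesis using hurwitz_word_inv_hurwitz[of ?v t] by simp
qed

lemma central_twist_word_inv: assumes "central_twist n t" shows "central_twist n (word_inv t)"
proof -
  have t: "t \<in> braid_words n" "word_inv t \<in> braid_words n" using assms word_inv_lists
    by (auto simp: central_twist_def)
  have "braid_eq n (w @ word_inv t) (word_inv t @ w)" if w: "w \<in> braid_words n" for w
  proof -
    have "braid_eq n ([] @ w @ word_inv t) ((word_inv t @ t) @ w @ word_inv t)"
      using w t by (intro braid_eq_post pres_eq.sym[OF braid_eq_word_inv(1)]) auto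
    moreover have "braid_eq n (word_inv t @ (t @ w) @ word_inv t)
      (word_inv t @ (w @ t) @ word_inv t)"
      using w t assms by (intro braid_eq_ctx pres_eq.sym[of _ _ "w @ t"])
        (auto simp: central_twist_def)
    moreover have "braid_eq n ((word_inv t @ w) @ t @ word_inv t) ((word_inv t @ w) @ [])"
      using w t by (intro braid_eq_pre braid_eq_word_inv(2)) auto
    ultimately show ?thesis by simp (meson pres_eq.trans)
  qed
  moreover obtain l where "hurwitz t [1] = delta_shift (Suc n) l
    (word_mult [1] (delta_shift (Suc n) (- l) []))"
    using assms by (auto simp: central_twist_def)
  from hurwitz_word_inv_central_twist[OF t(1) this]
  have "\<exists>l. hurwitz (word_inv t) [1] = delta_shift (Suc n) l
    (word_mult [1] (delta_shift (Suc n) (- l) []))"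
    by (intro exI[of _ "- l"]) simp
  ultimately show ?thesis using t unfolding central_twist_def by blast
qed

section \<open>From words to elements of the braid group\<close>

lemma group_braid_group: "group (braid_group n)"
  by (simp add: braid_group_def group_presented_group)

lemma braid_class_mult:
  "u \<in> braid_words n \<Longrightarrow> v \<in> braid_words n \<Longrightarrow> braid_class n u \<otimes>\<^bsub>braid_group n\<^esub> braid_class n v
    = braid_class n (u @ v)"
  unfolding braid_group_def braid_class_def by (rule presented_group_mult)

lemma braid_class_Nil: "\<one>\<^bsub>braid_group n\<^esub> = braid_class n []"
  by (simp add: braid_group_def braid_class_def presented_group_def)

lemma carrier_braid_group: "carrier (braid_group n) = braid_class n ` braid_words n"
  by (simp add: braid_group_def braid_class_def[abs_def] presented_group_def)

lemma braid_class_closed: "u \<in> braid_words n \<Longrightarrow> braid_class n u \<in> carrier (braid_group n)"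
  by (simp add: carrier_braid_group)

lemma braid_class_eqI: "braid_eq n u v \<Longrightarrow> braid_class n u = braid_class n v"
  unfolding braid_class_def by (rule pres_class_eqI)

lemma braid_class_eqD: "v \<in> braid_words n \<Longrightarrow> braid_class n u = braid_class n v \<Longrightarrow> braid_eq n u v"
  unfolding braid_class_def pres_class_def by (auto intro: pres_eq.refl)

lemma inv_braid_class:
  assumes "u \<in> braid_words n" shows
    "inv\<^bsub>braid_group n\<^esub> (braid_class n u) = braid_class n (word_inv u)"
proof -
  interpret group "braid_group n" by (rule group_braid_group)
  show ?thesis
    using assms word_inv_lists[OF assms] braid_class_eqI[OF braid_eq_word_inv(1)[OF assms]]
    by (intro inv_equality braid_class_closed)
      (simp_all only: braid_class_mult braid_class_Nil)
qed

lemma generate_braid_words: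
  assumes "x \<in> generate (braid_group n) (braid_gen n ` T)" "T \<subseteq> {1..n}"
  shows "\<exists>w \<in> lists (T \<times> UNIV). x = braid_class n w"
  using assms(1)
proof (induction rule: generate.induct)
  case one
  then show ?case using braid_class_Nil by fastforce
next
  case (incl g)
  then obtain i where "i \<in> T" "g = braid_class n [(i, True)]" by (auto simp: braid_gen_def)
  then show ?case by (intro bexI[of _ "[(i, True)]"]) auto
next
  case (inv g)
  then obtain i where i: "i \<in> T" "g = braid_class n [(i, True)]" by (auto simp: braid_gen_def)
  then have "inv\<^bsub>braid_group n\<^esub> g = braid_class n [(i, False)]"
    using assms(2) inv_braid_class[of "[(i, True)]" n] by (auto simp: word_inv_def)
  then show ?case using i by (intro bexI[of _ "[(i, False)]"]) auto
next
  case (eng g1 g2)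
  then obtain u v where uv: "u \<in> lists (T \<times> UNIV)" "g1 = braid_class n u"
    "v \<in> lists (T \<times> UNIV)" "g2 = braid_class n v" by auto
  moreover have "u \<in> braid_words n" "v \<in> braid_words n" using uv assms(2) by fastforce+
  ultimately show ?case by (intro bexI[of _ "u @ v"]) (simp_all add: braid_class_mult)
qed

lemma braid_gen_closed: "T \<subseteq> {1..n} \<Longrightarrow> braid_gen n ` T \<subseteq> carrier (braid_group n)"
  by (auto simp: braid_gen_def intro!: braid_class_closed)

lemma full_twist_class:
  "garside n \<otimes>\<^bsub>braid_group n\<^esub> garside n = braid_class n (full_twist n)"
  using garside_word_braid_words[of n n] by (simp add: garside_eq braid_class_mult full_twist_def)

lemma generate_full_twist:
  assumes "x \<in> generate (braid_group n) {garside n \<otimes>\<^bsub>braid_group n\<^esub> garside n}" "n > 0"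
  shows "\<exists>t. central_twist n t \<and> x = braid_class n t"
  using assms(1)
proof (induction rule: generate.induct)
  case one
  then show ?case using braid_class_Nil central_twist_Nil by blast
next
  case (incl g)
  then show ?case using full_twist_class central_twist_full_twist[OF assms(2)] by auto
next
  case (inv g)
  then show ?case
    using full_twist_class central_twist_word_inv[OF central_twist_full_twist[OF assms(2)]]
      inv_braid_class[OF full_twist_braid_words] by auto
next
  case (eng g1 g2)
  then obtain s t where "central_twist n s" "g1 = braid_class n s" "central_twist n t"
    "g2 = braid_class n t" by blast
  then show ?case using central_twist_append[of n s t]
    braid_class_mult[OF central_twist_braid_words central_twist_braid_words] by blast
qed

lemma hurwitz_fix:
  assumes "w \<in> lists (T \<times> UNIV)" "x \<notin> T" "\<And>i. i \<in> T \<Longrightarrow> x \<noteq> Suc i"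
  shows "hurwitz w [x] = [x]"
  using assms(1)
proof (induction w rule: list.induct)
  case (Cons l w)
  then have "fst l \<in> T" "hurwitz w [x] = [x]" by auto
  then show ?case using assms(2) assms(3)[of "fst l"]
    by (auto simp: hurwitz_Cons twist_letter_def split: prod.splits)
qed simp

definition arc_fixing :: "nat \<Rightarrow> nat word \<Rightarrow> bool" where
  "arc_fixing n c \<longleftrightarrow> c \<in> braid_words n \<and> (hurwitz c [1] = [1] \<or> hurwitz c [Suc n] = [Suc n])"

lemma arc_fixing_word_inv: "arc_fixing n c \<Longrightarrow> arc_fixing n (word_inv c)"
  using hurwitz_word_inv_hurwitz[of "[1]" c] hurwitz_word_inv_hurwitz[of "[Suc n]" c] word_inv_lists
  by (auto simp: arc_fixing_def)

lemma parabolic_arc_fixing: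
  assumes "P \<in> proper_irred_std_parabolics n" "x \<in> P"
  shows "\<exists>c. arc_fixing n c \<and> x = braid_class n c"
proof -
  obtain i j where ij: "P = generate (braid_group n) (braid_gen n ` {i..j})" "1 \<le> i" "i \<le> j" "j \<le> n"
    "{i..j} \<noteq> {1..n}" using assms(1) by (auto simp: proper_irred_std_parabolics_def)
  then obtain w where w: "w \<in> lists ({i..j} \<times> UNIV)" "x = braid_class n w"
    using generate_braid_words[of x n "{i..j}"] assms(2) by auto
  \<comment> \<open>A proper interval of generators misses the first or the last one, hence does not
    move the first or the last letter.\<close>
  have "i > 1 \<or> j < n" using ij by force
  then have "hurwitz w [1] = [1] \<or> hurwitz w [Suc n] = [Suc n]"
    using hurwitz_fix[OF w(1)] ij by auto
  moreover have "w \<in> braid_words n" using w(1) ij by fastforce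
  ultimately show ?thesis using w(2) by (auto simp: arc_fixing_def)
qed

lemma X_P_element:
  assumes "x \<in> X_P n \<union> m_inv (braid_group n) ` X_P n" "n > 0"
  shows "\<exists>c. (arc_fixing n c \<or> central_twist n c) \<and> x = braid_class n c"
proof -
  have *: "\<exists>c. (arc_fixing n c \<or> central_twist n c) \<and> x = braid_class n c" if "x \<in> X_P n" for x
    using that parabolic_arc_fixing generate_full_twist[OF _ assms(2)] unfolding X_P_def by blast
  show ?thesis
  proof (cases "x \<in> X_P n")
    case False
    then obtain x' c where c: "x = inv\<^bsub>braid_group n\<^esub> x'" "arc_fixing n c \<or> central_twist n c"
      "x' = braid_class n c"
      using assms(1) * by blast
    then have "c \<in> braid_words n" by (auto simp: arc_fixing_def central_twist_def)
    then show ?thesis using c inv_braid_class arc_fixing_word_inv central_twist_word_inv by metis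
  qed (use * in blast)
qed

text \<open>Central factors are moved to the right end, so an arbitrary number of full twists costs
  nothing in the count of arc-fixing factors.\<close>

lemma X_P_factor:
  assumes "set xs \<subseteq> X_P n \<union> m_inv (braid_group n) ` X_P n" "n > 0"
  shows "\<exists>cs t. length cs \<le> length xs \<and> (\<forall>c\<in>set cs. arc_fixing n c) \<and> central_twist n t \<and>
    foldr (\<lambda>x y. x \<otimes>\<^bsub>braid_group n\<^esub> y) xs \<one>\<^bsub>braid_group n\<^esub> = braid_class n (concat cs @ t)"
  using assms(1)
proof (induction xs)
  case Nil
  show ?case using central_twist_Nil by (intro exI[of _ "[]"]) (auto simp: braid_class_Nil)
next
  case (Cons x xs)
  then obtain cs t where IH: "length cs \<le> length xs" "\<forall>c\<in>set cs. arc_fixing n c" "central_twist n t"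
    "foldr (\<lambda>x y. x \<otimes>\<^bsub>braid_group n\<^esub> y) xs \<one>\<^bsub>braid_group n\<^esub> = braid_class n (concat cs @ t)"
    by auto
  obtain c where c: "arc_fixing n c \<or> central_twist n c" "x = braid_class n c"
    using X_P_element[OF _ assms(2), of x] Cons.prems by (metis insert_subset list.simps(15))
  have w: "concat cs \<in> braid_words n" "t \<in> braid_words n" "c \<in> braid_words n"
    using IH c by (fastforce simp: arc_fixing_def central_twist_def)+
  have prod: "foldr (\<lambda>x y. x \<otimes>\<^bsub>braid_group n\<^esub> y) (x # xs) \<one>\<^bsub>braid_group n\<^esub> = braid_class n
    (c @ concat cs @ t)"
    using IH(4) c(2) w by (simp add: braid_class_mult)
  show ?case
  proof (cases "arc_fixing n c")
    case True
    then show ?thesis using IH prod by (intro exI[of _ "c # cs"] exI[of _ t]) auto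
  next
    case False
    then have "central_twist n c" using c by simp
    then have "braid_eq n ((c @ concat cs) @ t) ((concat cs @ c) @ t)"
      using w by (intro braid_eq_post pres_eq.sym[of _ _ "concat cs @ c"])
        (auto simp: central_twist_def)
    then have "braid_class n (c @ concat cs @ t) = braid_class n (concat cs @ c @ t)"
      using braid_class_eqI by fastforce
    then show ?thesis using IH prod central_twist_append[OF \<open>central_twist n c\<close> IH(3)]
      by (intro exI[of _ cs] exI[of _ "c @ t"]) auto
  qed
qed

lemma fat_power_X_P_length:
  assumes "m \<ge> 2" "set xs \<subseteq> X_P (Suc m) \<union> m_inv (braid_group (Suc m)) ` X_P (Suc m)"
    "foldr (\<lambda>x y. x \<otimes>\<^bsub>braid_group (Suc m)\<^esub> y) xs \<one>\<^bsub>braid_group (Suc m)\<^esub> =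
       braid_class (Suc m) (fat_power m (Suc (2 * K)))"
  shows "K < length xs"
proof (rule ccontr)
  assume "\<not> K < length xs"
  obtain cs t where cs: "length cs \<le> length xs" "\<forall>c\<in>set cs. arc_fixing (Suc m) c"
    "central_twist (Suc m) t"
    "braid_class (Suc m) (fat_power m (Suc (2 * K))) = braid_class (Suc m) (concat cs @ t)"
    using X_P_factor[OF assms(2)] assms(3) by auto
  \<comment> \<open>Padding with empty words, which fix both arcs, gives exactly K factors to match
    the exponent 2 K + 1.\<close>
  define ds where "ds = cs @ replicate (K - length cs) []"
  have ds: "length ds = K" "concat ds = concat cs"
    using cs(1) \<open>\<not> K < length xs\<close> by (simp_all add: ds_def)
  have fx: "c \<in> braid_words (Suc m) \<and>
    (hurwitz c [1] = [1] \<or> hurwitz c [Suc (Suc m)] = [Suc (Suc m)])" if "c \<in> set ds" for c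
    using that cs(2) by (auto simp: ds_def arc_fixing_def split: if_splits)
  have t: "t \<in> braid_words (Suc m)" using cs by (simp add: central_twist_def)
  obtain l where l: "hurwitz t [1] = delta_shift (Suc (Suc m)) l
    (word_mult [1] (delta_shift (Suc (Suc m)) (- l) []))"
    using cs by (auto simp: central_twist_def)
  have "concat cs @ t \<in> braid_words (Suc m)" using cs(2) t by (fastforce simp: arc_fixing_def)
  from braid_class_eqD[OF this cs(4)]
  \<comment> \<open>Evaluating at the preimage of [1] under t removes the central factor from the
    product and moves it, as a conjugation, to the side of the fat power.\<close>
  have "hurwitz (fat_power m (Suc (2 * K))) (hurwitz (word_inv t) [1]) = hurwitz (concat cs @ t)
    (hurwitz (word_inv t) [1])"
    by (rule hurwitz_cong) (simp add: distinct_adj_hurwitz)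
  also have "\<dots> = hurwitz (concat ds) [1]" using ds
    by (simp add: hurwitz_append hurwitz_hurwitz_word_inv)
  finally have "hurwitz (concat ds) [1] = hurwitz (fat_power m (Suc (2 * K)))
      (delta_shift (Suc (Suc m)) (- l) (word_mult [1] (delta_shift (Suc (Suc m)) l [])))"
    using hurwitz_word_inv_central_twist[OF t l] by simp
  then show False using fat_power_not_short[OF assms(1) fx] ds(1) by blast
qed

section \<open>Normalizers and the inclusion of X_P in X_NP\<close>

lemma (in group) normalizerI:
  assumes "H \<subseteq> carrier G" "x \<in> carrier G"
    and "\<And>a. a \<in> H \<Longrightarrow> x \<otimes> a \<otimes> inv x \<in> H" "\<And>a. a \<in> H \<Longrightarrow> inv x \<otimes> a \<otimes> x \<in> H"
  shows "x \<in> normalizer G H"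
proof -
  have "x <# H #> inv x = H"
  proof
    show "x <# H #> inv x \<subseteq> H"
      using assms by (auto simp: l_coset_def r_coset_def)
    show "H \<subseteq> x <# H #> inv x"
    proof
      fix a assume a: "a \<in> H"
      then have c: "a \<in> carrier G" using assms(1) by blast
      have "a = x \<otimes> (inv x \<otimes> a \<otimes> x) \<otimes> inv x"
        using c assms(2) by (simp add: m_assoc) (simp add: m_assoc[symmetric])
      then show "a \<in> x <# H #> inv x"
        using assms(4)[OF a] unfolding l_coset_def r_coset_def by blast
    qed
  qed
  then show ?thesis using assms(1,2) by (auto simp: normalizer_def stabilizer_def)
qed

lemma (in group) centralizing_normalizer:
  assumes "H \<subseteq> carrier G" "x \<in> carrier G" "\<And>a. a \<in> H \<Longrightarrow> a \<otimes> x = x \<otimes> a"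
  shows "x \<in> normalizer G H"
proof (rule normalizerI)
  fix a assume a: "a \<in> H"
  then have c: "a \<in> carrier G" using assms(1) by blast
  have "x \<otimes> a \<otimes> inv x = a" using assms(3)[OF a, symmetric] c assms(2) by (simp add: m_assoc)
  then show "x \<otimes> a \<otimes> inv x \<in> H" using a by simp
  have "inv x \<otimes> a \<otimes> x = a" using assms(3)[OF a] c assms(2) by (simp add: m_assoc inv_solve_left')
  then show "inv x \<otimes> a \<otimes> x \<in> H" using a by simp
qed (use assms in auto)

lemma (in group) subgroup_subset_normalizer:
  assumes "subgroup H G" "x \<in> H"
  shows "x \<in> normalizer G H"
proof -
  interpret H: subgroup H G by (rule assms)
  show ?thesis using assms(2) by (intro normalizerI) auto
qed

lemma parabolic_subgroup:
  assumes "P \<in> proper_irred_std_parabolics n"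
  shows "subgroup P (braid_group n)"
proof -
  obtain i j where "P = generate (braid_group n) (braid_gen n ` {i..j})" "1 \<le> i" "j \<le> n"
    using assms by (auto simp: proper_irred_std_parabolics_def)
  then show ?thesis
    using group.generate_is_subgroup[OF group_braid_group braid_gen_closed[of "{i..j}" n]] by auto
qed

text \<open>The subgroup of the fat puncture has at least one generator because m >= 2.\<close>

lemma low_parabolic:
  assumes "2 \<le> m"
  shows "generate (braid_group (Suc m)) (braid_gen (Suc m) ` {1..m - 1}) \<in>
    proper_irred_std_parabolics (Suc m)"
proof -
  have "Suc m \<in> {1..Suc m}" "Suc m \<notin> {1..m - 1}" by auto
  then have "{1..m - 1} \<noteq> {1..Suc m}" by metis
  moreover have "1 \<le> m - 1" "m - 1 \<le> Suc m" using assms by auto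
  ultimately show ?thesis unfolding proper_irred_std_parabolics_def by blast
qed

lemma fat_power_X_NP:
  assumes "2 \<le> m"
  shows "braid_class (Suc m) (fat_power m k) \<in> X_NP (Suc m)"
proof -
  interpret group "braid_group (Suc m)" by (rule group_braid_group)
  let ?P = "generate (braid_group (Suc m)) (braid_gen (Suc m) ` {1..m - 1})"
  have "braid_class (Suc m) (fat_power m k) \<in> normalizer (braid_group (Suc m)) ?P"
  proof (rule centralizing_normalizer)
    show "?P \<subseteq> carrier (braid_group (Suc m))"
      using parabolic_subgroup[OF low_parabolic[OF assms]] by (rule subgroup.subset)
    show "braid_class (Suc m) (fat_power m k) \<in> carrier (braid_group (Suc m))"
      using fat_power_lists[OF assms] by (rule braid_class_closed)
    fix a assume "a \<in> ?P"
    then obtain w where w: "w \<in> lists ({1..m - 1} \<times> UNIV)" "a = braid_class (Suc m) w"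
      using generate_braid_words[of a "Suc m" "{1..m - 1}"] by fastforce
    moreover have "w \<in> braid_words (Suc m)" using w(1) by fastforce
    ultimately show "a \<otimes>\<^bsub>braid_group (Suc m)\<^esub> braid_class (Suc m) (fat_power m k) =
        braid_class (Suc m) (fat_power m k) \<otimes>\<^bsub>braid_group (Suc m)\<^esub> a"
      using braid_class_eqI[OF braid_eq_fat_power[OF assms w(1), of k]]
        fat_power_lists[OF assms, of k]
      by (simp add: braid_class_mult del: in_lists_conv_set)
  qed
  then show ?thesis using low_parabolic[OF assms] by (auto simp: X_NP_def)
qed

text \<open>A subgroup lies in its own normalizer, and central elements normalize every subgroup, so
  any one proper parabolic serves for the full twists.\<close>

lemma X_P_subset_X_NP:
  assumes "2 \<le> m"
  shows "X_P (Suc m) \<subseteq> X_NP (Suc m)"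
proof
  interpret group "braid_group (Suc m)" by (rule group_braid_group)
  let ?P = "generate (braid_group (Suc m)) (braid_gen (Suc m) ` {1..m - 1})"
  fix x assume "x \<in> X_P (Suc m)"
  then consider P where "P \<in> proper_irred_std_parabolics (Suc m)" "x \<in> P"
    | "x \<in> generate (braid_group (Suc m)) {garside (Suc m) \<otimes>\<^bsub>braid_group (Suc m)\<^esub> garside (Suc m)}"
    unfolding X_P_def by blast
  then show "x \<in> X_NP (Suc m)"
  proof cases
    case 1
    then show ?thesis using subgroup_subset_normalizer[OF parabolic_subgroup]
      by (auto simp: X_NP_def)
  next
    case 2
    then obtain t where t: "central_twist (Suc m) t" "x = braid_class (Suc m) t"
      using generate_full_twist by blast
    have "x \<in> normalizer (braid_group (Suc m)) ?P"
    proof (rule centralizing_normalizer)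
      show P: "?P \<subseteq> carrier (braid_group (Suc m))"
        using parabolic_subgroup[OF low_parabolic[OF assms]] by (rule subgroup.subset)
      show "x \<in> carrier (braid_group (Suc m))" using t central_twist_braid_words braid_class_closed
        by blast
      fix a assume "a \<in> ?P"
      then obtain w where "w \<in> braid_words (Suc m)" "a = braid_class (Suc m) w"
        using P by (auto simp: carrier_braid_group)
      then show "a \<otimes>\<^bsub>braid_group (Suc m)\<^esub> x = x \<otimes>\<^bsub>braid_group (Suc m)\<^esub> a"
        using t braid_class_eqI[of "Suc m" "w @ t" "t @ w"] central_twist_braid_words[OF t(1)]
        by (simp add: central_twist_def braid_class_mult del: in_lists_conv_set)
    qed
    then show ?thesis using low_parabolic[OF assms] by (auto simp: X_NP_def)
  qed
qed

section \<open>Metrics\<close>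

text \<open>The infimum runs over natural numbers and so is attained: if all path lengths exceed r,
  they are at least floor r + 1. This turns extended real distances into actual paths.\<close>

lemma edge_dist_le_iff:
  "edge_dist E x y \<le> ereal r \<longleftrightarrow> (\<exists>k. (x, y) \<in> E ^^ k \<and> real k \<le> r)"
proof
  assume "\<exists>k. (x, y) \<in> E ^^ k \<and> real k \<le> r"
  then show "edge_dist E x y \<le> ereal r" unfolding edge_dist_def by (auto intro: INF_lower2)
next
  assume *: "edge_dist E x y \<le> ereal r"
  show "\<exists>k. (x, y) \<in> E ^^ k \<and> real k \<le> r"
  proof (rule ccontr)
    assume "\<not> ?thesis"
    then have "ereal (of_int (\<lfloor>r\<rfloor> + 1)) \<le> ereal (real k)" if "(x, y) \<in> E ^^ k" for k
      using that by (auto simp: not_le)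
        (metis floor_less_iff int_one_le_iff_zero_less add1_zle_eq of_int_1 of_int_add of_int_le_iff
          of_int_of_nat_eq)
    then have "ereal (of_int (\<lfloor>r\<rfloor> + 1)) \<le> edge_dist E x y"
      unfolding edge_dist_def by (intro INF_greatest) auto
    then have "ereal (of_int (\<lfloor>r\<rfloor> + 1)) \<le> ereal r" using * by (rule order_trans)
    then show False by simp linarith
  qed
qed

lemma edge_dist_triangle:
  "edge_dist E x y \<le> ereal r \<Longrightarrow> edge_dist E y z \<le> ereal s \<Longrightarrow> edge_dist E x z \<le> ereal (r + s)"
  unfolding edge_dist_le_iff by (metis add_mono of_nat_add relcompI relpow_add)

lemma edge_dist_sym:
  assumes "sym E" shows "edge_dist E x y = edge_dist E y x"
proof -
  have "sym (E ^^ k)" for k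
  proof (induction k)
    case (Suc k)
    then show ?case using assms unfolding sym_def
      by (metis relpow_Suc_D2 relpow_Suc_I relpow_Suc_E relpow_Suc_I2)
  qed (simp add: sym_def)
  then show ?thesis unfolding edge_dist_def by (metis sym_def)
qed

lemma sym_disjointness_edges: "sym (disjointness_edges V)"
  by (auto simp: sym_def disjointness_edges_def)

text \<open>Only a control function on finite radii is retained; such functions compose directly,
  without arithmetic on possibly infinite distances.\<close>

lemma quasi_isometry_lower:
  assumes "quasi_isometry V d W d' f"
  obtains b where "\<forall>x\<in>V. \<forall>y\<in>V. \<forall>r. d' (f x) (f y) \<le> ereal r \<longrightarrow> d x y \<le> ereal (b r)"
proof -
  obtain L C where L: "L \<ge> 1" and C: "C \<ge> 0"
    and *: "\<And>x y. x \<in> V \<Longrightarrow> y \<in> V \<Longrightarrow> ereal (1 / L) * d x y - ereal C \<le> d' (f x) (f y)"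
    using assms unfolding quasi_isometry_def by blast
  have "d x y \<le> ereal (L * (r + C))" if "x \<in> V" "y \<in> V" "d' (f x) (f y) \<le> ereal r" for x y r
  proof -
    have "ereal (1 / L) * d x y - ereal C \<le> ereal r" using * that order_trans by blast
    then show ?thesis using L by (cases "d x y") (auto simp: field_simps)
  qed
  then show ?thesis by (intro that[of "\<lambda>r. L * (r + C)"]) blast
qed

lemma quasi_isometry_upper:
  assumes "quasi_isometry V d W d' f"
  obtains b where "\<forall>x\<in>V. \<forall>y\<in>V. \<forall>r. d x y \<le> ereal r \<longrightarrow> d' (f x) (f y) \<le> ereal (b r)"
proof -
  obtain L C where L: "L \<ge> 1" and C: "C \<ge> 0"
    and *: "\<And>x y. x \<in> V \<Longrightarrow> y \<in> V \<Longrightarrow> d' (f x) (f y) \<le> ereal L * d x y + ereal C"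
    using assms unfolding quasi_isometry_def by blast
  have "d' (f x) (f y) \<le> ereal (L * r + C)" if "x \<in> V" "y \<in> V" "d x y \<le> ereal r" for x y r
  proof -
    have "ereal L * d x y \<le> ereal L * ereal r" using L that(3) by (intro ereal_mult_left_mono) auto
    then have "ereal L * d x y + ereal C \<le> ereal (L * r) + ereal C" by (intro add_right_mono) simp
    then show ?thesis using *[OF that(1,2)] by simp
  qed
  then show ?thesis by (intro that[of "\<lambda>r. L * r + C"]) blast
qed

lemma (in group) foldr_mult_closed:
  "set xs \<subseteq> carrier G \<Longrightarrow> foldr (\<lambda>x y. x \<otimes> y) xs \<one> \<in> carrier G"
  by (induction xs) auto

lemma (in group) cayley_relpow:
  assumes "X \<subseteq> carrier G" "g \<in> carrier G"
  shows "(g, h) \<in> cayley_edges G X ^^ k \<longleftrightarrow>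
    (\<exists>xs. length xs = k \<and> set xs \<subseteq> X \<union> m_inv G ` X \<and> h = g \<otimes> foldr (\<lambda>x y. x \<otimes> y) xs \<one>)"
  using assms(2)
proof (induction k arbitrary: g)
  case 0
  then show ?case by auto
next
  case (Suc k)
  have Y: "X \<union> m_inv G ` X \<subseteq> carrier G" using assms(1) by auto
  have "(g, h) \<in> cayley_edges G X ^^ Suc k \<longleftrightarrow>
      (\<exists>x \<in> X \<union> m_inv G ` X. (g \<otimes> x, h) \<in> cayley_edges G X ^^ k)"
  proof
    assume "(g, h) \<in> cayley_edges G X ^^ Suc k"
    then obtain w where "(g, w) \<in> cayley_edges G X" "(w, h) \<in> cayley_edges G X ^^ k"
      by (metis relpow_Suc_D2)
    then show "\<exists>x \<in> X \<union> m_inv G ` X. (g \<otimes> x, h) \<in> cayley_edges G X ^^ k"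
      unfolding cayley_edges_def by blast
  next
    assume "\<exists>x \<in> X \<union> m_inv G ` X. (g \<otimes> x, h) \<in> cayley_edges G X ^^ k"
    then obtain x where x: "x \<in> X \<union> m_inv G ` X" "(g \<otimes> x, h) \<in> cayley_edges G X ^^ k" by blast
    then have "(g, g \<otimes> x) \<in> cayley_edges G X" using Suc.prems unfolding cayley_edges_def by blast
    then show "(g, h) \<in> cayley_edges G X ^^ Suc k" using x(2) by (rule relpow_Suc_I2)
  qed
  also have "\<dots> \<longleftrightarrow> (\<exists>x \<in> X \<union> m_inv G ` X. \<exists>xs. length xs = k \<and> set xs \<subseteq> X \<union> m_inv G ` X \<and>
      h = (g \<otimes> x) \<otimes> foldr (\<lambda>x y. x \<otimes> y) xs \<one>)"
    using Y Suc.prems by (intro bex_cong refl Suc.IH m_closed) (blast intro: subsetD)+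
  also have "\<dots> \<longleftrightarrow> (\<exists>xs. length xs = Suc k \<and> set xs \<subseteq> X \<union> m_inv G ` X \<and>
      h = g \<otimes> foldr (\<lambda>x y. x \<otimes> y) xs \<one>)" (is "?L \<longleftrightarrow> ?R")
  proof -
    have eq: "(g \<otimes> x) \<otimes> foldr (\<lambda>x y. x \<otimes> y) xs \<one> = g \<otimes> foldr (\<lambda>x y. x \<otimes> y) (x # xs) \<one>"
      if "x \<in> X \<union> m_inv G ` X" "set xs \<subseteq> X \<union> m_inv G ` X" for x xs
    proof -
      have "x \<in> carrier G" "foldr (\<lambda>x y. x \<otimes> y) xs \<one> \<in> carrier G"
        using that Y foldr_mult_closed by blast+
      then show ?thesis using Suc.prems by (simp add: m_assoc)
    qed
    show ?thesis
    proof
      assume ?L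
      then obtain x xs where x: "x \<in> X \<union> m_inv G ` X" "length xs = k" "set xs \<subseteq> X \<union> m_inv G ` X"
        "h = (g \<otimes> x) \<otimes> foldr (\<lambda>x y. x \<otimes> y) xs \<one>" by blast
      then show ?R using eq[OF x(1,3)] by (intro exI[of _ "x # xs"]) simp
    next
      assume ?R
      then obtain ys where ys: "length ys = Suc k" "set ys \<subseteq> X \<union> m_inv G ` X"
        "h = g \<otimes> foldr (\<lambda>x y. x \<otimes> y) ys \<one>" by blast
      then obtain x xs where "ys = x # xs" by (cases ys) auto
      with ys have x: "x \<in> X \<union> m_inv G ` X" "length xs = k" "set xs \<subseteq> X \<union> m_inv G ` X"
        "h = g \<otimes> foldr (\<lambda>x y. x \<otimes> y) (x # xs) \<one>" by simp_all
      then show ?L using eq[OF x(1,3)] by (intro bexI[of _ x] exI[of _ xs]) auto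
    qed
  qed
  finally show ?case .
qed

lemma (in group) edge_dist_cayley:
  assumes "X \<subseteq> carrier G" "g \<in> carrier G" "h \<in> carrier G"
  shows "edge_dist (cayley_edges G X) g h = word_metric G X g h"
proof -
  let ?S = "{xs. set xs \<subseteq> X \<union> m_inv G ` X \<and> foldr (\<lambda>x y. x \<otimes> y) xs \<one> = inv g \<otimes> h}"
  have "h = g \<otimes> foldr (\<lambda>x y. x \<otimes> y) xs \<one> \<longleftrightarrow> foldr (\<lambda>x y. x \<otimes> y) xs \<one> = inv g \<otimes> h"
    if "set xs \<subseteq> X \<union> m_inv G ` X" for xs
  proof -
    have "set xs \<subseteq> carrier G" using that assms(1) by auto
    then show ?thesis using assms(2,3) foldr_mult_closed[of xs] inv_solve_left by metis
  qed
  then have "{k. (g, h) \<in> cayley_edges G X ^^ k} = length ` ?S"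
    using cayley_relpow[OF assms(1,2)] by (auto simp: image_iff)
  then show ?thesis unfolding edge_dist_def word_metric_def by (simp add: image_image)
qed

lemma (in group) word_metric_generator:
  assumes "x \<in> X" "X \<subseteq> carrier G"
  shows "word_metric G X \<one> x \<le> 1"
proof -
  have "x \<in> carrier G" using assms by blast
  then show ?thesis
    using assms unfolding word_metric_def by (intro INF_lower2[of "[x]"]) (auto simp: one_ereal_def)
qed

lemma word_metric_antimono:
  "X \<subseteq> Y \<Longrightarrow> word_metric G Y g h \<le> word_metric G X g h"
  unfolding word_metric_def by (intro INF_superset_mono) auto

section \<open>Comparison of the two word metrics on the braid group\<close>

context
  fixes m :: nat
  assumes m: "2 \<le> m"
begin

abbreviation (input) "Bm \<equiv> braid_group (Suc m)"

lemma X_P_closed: "X_P (Suc m) \<subseteq> carrier Bm"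
  using X_P_element[of _ "Suc m"] braid_class_closed
  by (fastforce simp: arc_fixing_def central_twist_def simp del: in_lists_conv_set)

lemma X_NP_closed: "X_NP (Suc m) \<subseteq> carrier Bm"
  by (auto simp: X_NP_def normalizer_def stabilizer_def)

lemma word_metric_fat_power_P:
  "ereal (real K) \<le> word_metric Bm (X_P (Suc m)) \<one>\<^bsub>Bm\<^esub>
    (braid_class (Suc m) (fat_power m (Suc (2 * K))))"
proof -
  interpret group Bm by (rule group_braid_group)
  show ?thesis
    unfolding word_metric_def
    using fat_power_X_P_length[OF m] braid_class_closed[OF fat_power_lists[OF m]]
    by (intro INF_greatest) (fastforce simp: less_imp_le)
qed

lemma word_metric_fat_power_NP:
  "word_metric Bm (X_NP (Suc m)) \<one>\<^bsub>Bm\<^esub> (braid_class (Suc m) (fat_power m k)) \<le> ereal 1"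
  using group.word_metric_generator[OF group_braid_group fat_power_X_NP[OF m] X_NP_closed]
  by (simp add: one_ereal_def)

text \<open>The common source of contradiction for all negative claims: the powers of the fat braid
  stay within distance 1 for X_NP and are unbounded for X_P.\<close>

lemma no_uniform_bound:
  assumes "\<And>x y. x \<in> carrier Bm \<Longrightarrow> y \<in> carrier Bm \<Longrightarrow> word_metric Bm (X_NP (Suc m)) x y \<le> ereal 1 \<Longrightarrow>
    word_metric Bm (X_P (Suc m)) x y \<le> ereal D"
  shows False
proof -
  interpret group Bm by (rule group_braid_group)
  obtain K :: nat where K: "D < real K" using reals_Archimedean2 by blast
  have "word_metric Bm (X_P (Suc m)) \<one>\<^bsub>Bm\<^esub> (braid_class (Suc m) (fat_power m (Suc (2 * K)))) \<le> ereal
    D"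
    using word_metric_fat_power_NP braid_class_closed[OF fat_power_lists[OF m]]
      by (intro assms) auto
  then have "ereal (real K) \<le> ereal D" using word_metric_fat_power_P order_trans by blast
  then show False using K by simp
qed

lemma lipschitz_id:
  "lipschitz_map (carrier Bm) (word_metric Bm (X_P (Suc m))) (carrier Bm)
    (word_metric Bm (X_NP (Suc m))) (\<lambda>g. g)"
  unfolding lipschitz_map_def using word_metric_antimono[OF X_P_subset_X_NP[OF m]]
  by (auto intro!: exI[of _ 1] simp: one_ereal_def[symmetric])

lemma not_quasi_isometry_id:
  "\<not> quasi_isometry (carrier Bm) (word_metric Bm (X_P (Suc m))) (carrier Bm)
    (word_metric Bm (X_NP (Suc m))) (\<lambda>g. g)"
proof
  assume "quasi_isometry (carrier Bm) (word_metric Bm (X_P (Suc m))) (carrier Bm)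
    (word_metric Bm (X_NP (Suc m))) (\<lambda>g. g)"
  then obtain b where "\<forall>x\<in>carrier Bm. \<forall>y\<in>carrier Bm. \<forall>r.
      word_metric Bm (X_NP (Suc m)) x y \<le> ereal r \<longrightarrow> word_metric Bm (X_P (Suc m)) x y \<le> ereal (b r)"
    by (rule quasi_isometry_lower)
  then show False by (intro no_uniform_bound) blast
qed

lemma not_lipschitz_id:
  "\<not> lipschitz_map (carrier Bm) (word_metric Bm (X_NP (Suc m))) (carrier Bm)
    (word_metric Bm (X_P (Suc m))) (\<lambda>g. g)"
proof
  assume "lipschitz_map (carrier Bm) (word_metric Bm (X_NP (Suc m))) (carrier Bm)
    (word_metric Bm (X_P (Suc m))) (\<lambda>g. g)"
  then obtain L where L: "L > 0" "\<And>x y. x \<in> carrier Bm \<Longrightarrow> y \<in> carrier Bm \<Longrightarrow>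
      word_metric Bm (X_P (Suc m)) x y \<le> ereal L * word_metric Bm (X_NP (Suc m)) x y"
    unfolding lipschitz_map_def by blast
  show False
  proof (rule no_uniform_bound)
    fix x y assume xy: "x \<in> carrier Bm" "y \<in> carrier Bm"
      "word_metric Bm (X_NP (Suc m)) x y \<le> ereal 1"
    then have "ereal L * word_metric Bm (X_NP (Suc m)) x y \<le> ereal L * ereal 1"
      using L(1) by (intro ereal_mult_left_mono) auto
    then show "word_metric Bm (X_P (Suc m)) x y \<le> ereal L" using L(2)[OF xy(1,2)] by simp
  qed
qed

text \<open>The composite of f and \<phi> stays at bounded distance from k. If \<phi> were a
  quasi-isometry, points at X_NP-distance at most 1 would have uniformly bounded
  X_P-distance.\<close>

lemma not_quasi_isometry_corresponding:
  fixes E :: "('a \<times> 'a) set" and F :: "('b \<times> 'b) set"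
  assumes "sym E" "sym F"
    and f: "quasi_isometry (carrier Bm) (word_metric Bm (X_P (Suc m))) V (edge_dist E) f"
    and k: "quasi_isometry (carrier Bm) (word_metric Bm (X_NP (Suc m))) W (edge_dist F) k"
    and corr: "corresponds_to_identity (carrier Bm) V (edge_dist E) f W (edge_dist F) k \<phi>"
  shows "\<not> quasi_isometry V (edge_dist E) W (edge_dist F) \<phi>"
proof
  assume \<phi>: "quasi_isometry V (edge_dist E) W (edge_dist F) \<phi>"
  let ?dP = "word_metric Bm (X_P (Suc m))" and ?dNP = "word_metric Bm (X_NP (Suc m))"
  have fV: "f g \<in> V" if "g \<in> carrier Bm" for g
    using f that by (auto simp: quasi_isometry_def)
  obtain \<psi> K where \<psi>: "\<psi> \<in> V \<rightarrow> carrier Bm"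
    "\<And>v. v \<in> V \<Longrightarrow> edge_dist E (f (\<psi> v)) v \<le> ereal K"
    "\<And>v. v \<in> V \<Longrightarrow> edge_dist F (\<phi> v) (k (\<psi> v)) \<le> ereal K"
    using corr unfolding corresponds_to_identity_def by blast
  obtain bf where "\<forall>x\<in>carrier Bm. \<forall>y\<in>carrier Bm. \<forall>r. edge_dist E (f x) (f y) \<le> ereal r \<longrightarrow> ?dP x y \<le>
    ereal (bf r)"
    using f by (rule quasi_isometry_lower)
  note bf = this[rule_format]
  obtain bk where "\<forall>x\<in>carrier Bm. \<forall>y\<in>carrier Bm. \<forall>r. ?dNP x y \<le> ereal r \<longrightarrow> edge_dist F (k x) (k y) \<le>
    ereal (bk r)"
    using k by (rule quasi_isometry_upper)
  note bk = this[rule_format]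
  obtain b where "\<forall>x\<in>V. \<forall>y\<in>V. \<forall>r. edge_dist F (\<phi> x) (\<phi> y) \<le> ereal r \<longrightarrow> edge_dist E x y \<le> ereal (b r)"
    using \<phi> by (rule quasi_isometry_lower)
  note b = this[rule_format]
  define R where "R = K + bk (bf K)"
  \<comment> \<open>The lower bound for f makes \<psi> (f g) close to g for X_P, hence also for the
    larger set X_NP, and k carries this over to the second graph.\<close>
  have close: "edge_dist F (\<phi> (f g)) (k g) \<le> ereal R" if g: "g \<in> carrier Bm" for g
  proof -
    have \<psi>g: "\<psi> (f g) \<in> carrier Bm" using \<psi>(1) fV[OF g] by blast
    have "?dP (\<psi> (f g)) g \<le> ereal (bf K)" using bf[OF \<psi>g g] \<psi>(2)[OF fV[OF g]] .
    then have "?dNP (\<psi> (f g)) g \<le> ereal (bf K)"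
      using word_metric_antimono[OF X_P_subset_X_NP[OF m]] order_trans by blast
    then have "edge_dist F (k (\<psi> (f g))) (k g) \<le> ereal (bk (bf K))" using bk[OF \<psi>g g] by blast
    then show ?thesis unfolding R_def by (rule edge_dist_triangle[OF \<psi>(3)[OF fV[OF g]]])
  qed
  show False
  proof (rule no_uniform_bound)
    fix x y assume xy: "x \<in> carrier Bm" "y \<in> carrier Bm" "?dNP x y \<le> ereal 1"
    have "edge_dist F (k y) (\<phi> (f y)) \<le> ereal R" using close[OF xy(2)] edge_dist_sym[OF assms(2)]
      by metis
    moreover have "edge_dist F (k x) (k y) \<le> ereal (bk 1)" using bk xy by blast
    ultimately have "edge_dist F (\<phi> (f x)) (\<phi> (f y)) \<le> ereal (R + (bk 1 + R))"
      by (intro edge_dist_triangle[OF close[OF xy(1)]] edge_dist_triangle)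
    then show "?dP x y \<le> ereal (bf (b (R + (bk 1 + R))))" using b bf fV xy by blast
  qed
qed

end

theorem proposition4p12:
  fixes n :: nat
  assumes "n \<ge> 3"
  shows "(gen_preceq (braid_group n) (X_NP n) (X_P n) \<and>
          \<not> gen_preceq (braid_group n) (X_P n) (X_NP n)) \<and>
         (lipschitz_map
            (carrier (braid_group n)) (edge_dist (cayley_edges (braid_group n) (X_P n)))
            (carrier (braid_group n)) (edge_dist (cayley_edges (braid_group n) (X_NP n))) (\<lambda>g. g) \<and>
          \<not> quasi_isometry
            (carrier (braid_group n)) (edge_dist (cayley_edges (braid_group n) (X_P n)))
            (carrier (braid_group n)) (edge_dist (cayley_edges (braid_group n) (X_NP n))) (\<lambda>g. g)) \<and>
         (\<forall>a \<in> arc_graph_verts n. \<forall>c \<in> curve_graph_verts n. \<forall>\<phi>.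
            quasi_isometry (carrier (braid_group n)) (word_metric (braid_group n) (X_P n))
              (arc_graph_verts n) (arc_graph_dist n) (\<lambda>g. braid_act g a) \<longrightarrow>
            quasi_isometry (carrier (braid_group n)) (word_metric (braid_group n) (X_NP n))
              (curve_graph_verts n) (curve_graph_dist n) (\<lambda>g. braid_act g c) \<longrightarrow>
            corresponds_to_identity (carrier (braid_group n))
              (arc_graph_verts n) (arc_graph_dist n) (\<lambda>g. braid_act g a)
              (curve_graph_verts n) (curve_graph_dist n) (\<lambda>g. braid_act g c) \<phi> \<longrightarrow>
            \<not> quasi_isometry (arc_graph_verts n) (arc_graph_dist n)
                (curve_graph_verts n) (curve_graph_dist n) \<phi>)"
proof -
  obtain m where n: "n = Suc m" and m: "2 \<le> m" using assms by (cases n) auto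
  note cayley = group.edge_dist_cayley[OF group_braid_group X_P_closed[OF m]]
    group.edge_dist_cayley[OF group_braid_group X_NP_closed[OF m]]
  show ?thesis
    unfolding n gen_preceq_def
  proof (intro conjI ballI allI impI)
    show "lipschitz_map (carrier (braid_group (Suc m))) (edge_dist (cayley_edges (braid_group (Suc m)) (X_P (Suc m))))
        (carrier (braid_group (Suc m))) (edge_dist (cayley_edges (braid_group (Suc m)) (X_NP (Suc m)))) (\<lambda>g. g)"
      using lipschitz_id[OF m] by (simp add: lipschitz_map_def cayley)
    show "\<not> quasi_isometry (carrier (braid_group (Suc m))) (edge_dist (cayley_edges (braid_group (Suc m)) (X_P (Suc m))))
        (carrier (braid_group (Suc m))) (edge_dist (cayley_edges (braid_group (Suc m)) (X_NP (Suc m)))) (\<lambda>g. g)"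
      using not_quasi_isometry_id[OF m] by (simp add: quasi_isometry_def cayley)
  qed (rule lipschitz_id[OF m] not_lipschitz_id[OF m]
      | rule not_quasi_isometry_corresponding[OF m sym_disjointness_edges sym_disjointness_edges]; assumption)+
qed

end
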